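(* Let $p$ be an odd prime, let $G$ be the Gupta--Sidki $p$-group, let $k\ge 1$, and let $\Gamma=G^{(\times k)}$ be the direct product of $k$ copies of $G$. If $H$ is a group (abstractly) commensurable with $\Gamma$, then all maximal subgroups of $H$ have finite index in $H$.
   Context: For an odd prime $p$, let $T$ be the $p$-regular rooted tree: its vertices are the finite words over the alphabet $\{0,1,\ldots,p-1\}$, the root is the empty word, and each word $u$ is joined by an edge to $ux$ for every letter $x$. $\mathrm{Aut}\,T$ is the group of root-preserving automorphisms of $T$, acting on the right, $v\mapsto v^g$. An automorphism $x$ fixing all vertices of level $1$ is written $x=(x_0,\ldots,x_{p-1})$, where $x_i\in\mathrm{Aut}\,T$ is defined by $(iw)^x=i\,w^{x_i}$ for all words $w$. The Gupta--Sidki $p$-group is $G=\langle a,b\rangle\le \mathrm{Aut}\,T$, where $a$ is defined by $(iw)^a=(i+1 \bmod p)w$ for every letter $i$ and word $w$, and $b$ is defined recursively by $b=(a,a^{-1},1,\ldots,1,b)$ (so $b$ has component $a$ at $0$, $a^{-1}$ at $1$, $b$ at $p-1$, and is trivial at the other letters). Two groups are (abstractly) commensurable if they have isomorphic subgroups of finite index. A maximal subgroup means a maximal proper subgroup. *)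

theory Defs
  imports "HOL-Algebra.Algebra" "HOL-Computational_Algebra.Primes"
begin

definition tree_words :: "nat \<Rightarrow> nat list set"
  where "tree_words p = lists {..<p}"

definition tree_adj :: "nat \<Rightarrow> nat list \<Rightarrow> nat list \<Rightarrow> bool"
  where "tree_adj p u v \<longleftrightarrow> u \<in> tree_words p \<and> v \<in> tree_words p \<and>
           ((\<exists>x. v = u @ [x]) \<or> (\<exists>x. u = v @ [x]))"

definition tree_auts :: "nat \<Rightarrow> (nat list \<Rightarrow> nat list) set"
  where "tree_auts p = {g \<in> Bij (tree_words p). g [] = [] \<and>
           (\<forall>u \<in> tree_words p. \<forall>v \<in> tree_words p. tree_adj p u v \<longleftrightarrow> tree_adj p (g u) (g v))}"

(* Automorphisms act on the right, so g \<otimes> h means: first g, then h. *)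
definition Aut_tree :: "nat \<Rightarrow> (nat list \<Rightarrow> nat list) monoid"
  where "Aut_tree p =
    \<lparr>carrier = tree_auts p,
     monoid.mult = \<lambda>g h. compose (tree_words p) h g,
     one = \<lambda>w \<in> tree_words p. w\<rparr>"

definition gs_a :: "nat \<Rightarrow> nat list \<Rightarrow> nat list"
  where "gs_a p = (\<lambda>w \<in> tree_words p. case w of [] \<Rightarrow> [] | i # u \<Rightarrow> (i + 1) mod p # u)"

(* For p \<ge> 3 the letters 0, 1 and p - 1 are distinct, so the order of the tests is irrelevant. *)
primrec gs_b_fun :: "nat \<Rightarrow> nat list \<Rightarrow> nat list"
  where
    "gs_b_fun p [] = []"
  | "gs_b_fun p (i # u) = i #
       (if i = 0 then gs_a p u
        else if i = 1 then (inv\<^bsub>Aut_tree p\<^esub> (gs_a p)) u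
        else if i = p - 1 then gs_b_fun p u
        else u)"

definition gs_b :: "nat \<Rightarrow> nat list \<Rightarrow> nat list"
  where "gs_b p = (\<lambda>w \<in> tree_words p. gs_b_fun p w)"

definition gupta_sidki :: "nat \<Rightarrow> (nat list \<Rightarrow> nat list) monoid"
  where "gupta_sidki p = subgroup_generated (Aut_tree p) {gs_a p, gs_b p}"

definition finite_index :: "'a set \<Rightarrow> ('a, 'b) monoid_scheme \<Rightarrow> bool"
  where "finite_index K G \<longleftrightarrow> finite (rcosets\<^bsub>G\<^esub> K)"

definition commensurable :: "('a, 'b) monoid_scheme \<Rightarrow> ('c, 'd) monoid_scheme \<Rightarrow> bool"
  where "commensurable G H \<longleftrightarrow>
    (\<exists>K L. subgroup K G \<and> finite_index K G \<and> subgroup L H \<and> finite_index L H \<and>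
           G\<lparr>carrier := K\<rparr> \<cong> H\<lparr>carrier := L\<rparr>)"

definition maximal_subgroup :: "'a set \<Rightarrow> ('a, 'b) monoid_scheme \<Rightarrow> bool"
  where "maximal_subgroup M G \<longleftrightarrow> subgroup M G \<and> M \<noteq> carrier G \<and>
    (\<forall>K. subgroup K G \<and> M \<subseteq> K \<longrightarrow> K = M \<or> K = carrier G)"


lemma Nil_tree_words [simp]: "[] \<in> tree_words p"
  and Cons_tree_words [simp]: "i # u \<in> tree_words p \<longleftrightarrow> i < p \<and> u \<in> tree_words p"
  and snoc_tree_words [simp]: "u @ [i] \<in> tree_words p \<longleftrightarrow> i < p \<and> u \<in> tree_words p"
  by (auto simp: tree_words_def)

lemma tree_autsD:
  assumes "g \<in> tree_auts p"
  shows "g \<in> Bij (tree_words p)" "g [] = []"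
    "\<And>u v. u \<in> tree_words p \<Longrightarrow> v \<in> tree_words p \<Longrightarrow> tree_adj p (g u) (g v) \<longleftrightarrow> tree_adj p u v"
    "\<And>u. u \<in> tree_words p \<Longrightarrow> g u \<in> tree_words p"
  using assms by (auto simp: tree_auts_def dest: Bij_imp_funcset)

lemma compose_tree_auts:
  assumes "g \<in> tree_auts p" "h \<in> tree_auts p"
  shows "compose (tree_words p) h g \<in> tree_auts p"
  using tree_autsD[OF assms(1)] tree_autsD[OF assms(2)]
  by (auto simp: tree_auts_def compose_Bij) (auto simp: compose_def)

lemma inv_into_tree_auts:
  assumes g: "g \<in> tree_auts p"
  shows "(\<lambda>w \<in> tree_words p. inv_into (tree_words p) g w) \<in> tree_auts p"
proof -
  let ?V = "tree_words p"
  have bij: "bij_betw g ?V ?V" using tree_autsD(1)[OF g] by (simp add: Bij_def)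
  have r: "g (inv_into ?V g u) = u" if "u \<in> ?V" for u
    using bij that by (simp add: bij_betw_inv_into_right)
  have m: "inv_into ?V g u \<in> ?V" if "u \<in> ?V" for u
    using tree_autsD(1)[OF g] that by (rule Bij_inv_into_mem)
  have "inv_into ?V g [] = []"
    using bij_betw_inv_into_left[OF bij, of "[]"] tree_autsD(2)[OF g] by simp
  moreover have "tree_adj p u v \<longleftrightarrow> tree_adj p (inv_into ?V g u) (inv_into ?V g v)"
    if "u \<in> ?V" "v \<in> ?V" for u v
    using tree_autsD(3)[OF g m[OF that(1)] m[OF that(2)]] that by (simp add: r)
  ultimately show ?thesis
    using restrict_inv_into_Bij[OF tree_autsD(1)[OF g]] by (auto simp: tree_auts_def)
qed

lemma group_Aut_tree: "group (Aut_tree p)"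
proof (rule groupI)
  fix g h k
  assume "g \<in> carrier (Aut_tree p)" "h \<in> carrier (Aut_tree p)" "k \<in> carrier (Aut_tree p)"
  then show "g \<otimes>\<^bsub>Aut_tree p\<^esub> h \<otimes>\<^bsub>Aut_tree p\<^esub> k = g \<otimes>\<^bsub>Aut_tree p\<^esub> (h \<otimes>\<^bsub>Aut_tree p\<^esub> k)"
    by (auto simp: Aut_tree_def intro!: compose_assoc dest!: tree_autsD(1) Bij_imp_funcset)
next
  fix g assume g: "g \<in> carrier (Aut_tree p)"
  then have "g \<in> tree_auts p" by (simp add: Aut_tree_def)
  note * = inv_into_tree_auts[OF this] tree_autsD(1)[OF this]
  have "compose (tree_words p) g (\<lambda>w \<in> tree_words p. inv_into (tree_words p) g w)
      = (\<lambda>w \<in> tree_words p. w)"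
    using *(2) by (auto simp: Bij_def compose_def fun_eq_iff bij_betw_inv_into_right)
  with *(1) show "\<exists>h \<in> carrier (Aut_tree p). h \<otimes>\<^bsub>Aut_tree p\<^esub> g = \<one>\<^bsub>Aut_tree p\<^esub>"
    by (auto simp: Aut_tree_def)
next
  fix g assume "g \<in> carrier (Aut_tree p)"
  then show "\<one>\<^bsub>Aut_tree p\<^esub> \<otimes>\<^bsub>Aut_tree p\<^esub> g = g"
    by (auto simp: Aut_tree_def compose_def fun_eq_iff
        dest!: tree_autsD(1) Bij_imp_extensional intro: extensional_arb[symmetric])
next
  show "\<one>\<^bsub>Aut_tree p\<^esub> \<in> carrier (Aut_tree p)"
    by (simp add: Aut_tree_def tree_auts_def id_Bij)
qed (simp add: Aut_tree_def compose_tree_auts)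

lemma tree_autsI:
  assumes bij: "bij_betw f (tree_words p) (tree_words p)"
    and ext: "f \<in> extensional (tree_words p)"
    and len: "\<And>u. u \<in> tree_words p \<Longrightarrow> length (f u) = length u"
    and pre: "\<And>u x. u @ [x] \<in> tree_words p \<Longrightarrow> butlast (f (u @ [x])) = f u"
  shows "f \<in> tree_auts p"
proof -
  have V: "f u \<in> tree_words p" if "u \<in> tree_words p" for u
    using bij that by (auto simp: bij_betw_def)
  have one: "(\<exists>x. f v = f u @ [x]) \<longleftrightarrow> (\<exists>x. v = u @ [x])"
    if uv: "u \<in> tree_words p" "v \<in> tree_words p" for u v
  proof
    assume "\<exists>x. v = u @ [x]"
    then obtain x where x: "v = u @ [x]" by blast
    then have "f v \<noteq> []" using len[OF uv(2)] by auto
    then show "\<exists>x. f v = f u @ [x]"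
      using pre[of u x] uv(2) x by (metis append_butlast_last_id)
  next
    assume "\<exists>x. f v = f u @ [x]"
    then obtain x where x: "f v = f u @ [x]" by blast
    then have "v \<noteq> []" using len[OF uv(2)] by auto
    then obtain w y where w: "v = w @ [y]" by (metis append_butlast_last_id)
    have "f w = f u" using pre[of w y] uv(2) w x by simp
    moreover have "w \<in> tree_words p" using uv(2) w by simp
    ultimately have "w = u" using bij uv(1) by (auto simp: bij_betw_def inj_on_def)
    then show "\<exists>x. v = u @ [x]" using w by blast
  qed
  have "f [] = []" using len[of "[]"] by simp
  then show ?thesis
    using bij ext one V by (auto simp: tree_auts_def Bij_def tree_adj_def)
qed

lemma tree_auts_length_butlast:
  assumes g: "g \<in> tree_auts p" and "u \<in> tree_words p"
  shows "length (g u) = length u \<and> (\<forall>v x. u = v @ [x] \<longrightarrow> butlast (g u) = g v)"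
  using assms(2)
proof (induction "length u" arbitrary: u rule: less_induct)
  case less
  show ?case
  proof (cases u rule: rev_cases)
    case Nil
    then show ?thesis using tree_autsD(2)[OF g] by simp
  next
    case (snoc v x)
    have v: "v \<in> tree_words p" and lv: "length (g v) = length v"
      using less snoc by auto
    have "tree_adj p v u" using snoc v less.prems by (auto simp: tree_adj_def)
    then have "tree_adj p (g v) (g u)" using tree_autsD(3)[OF g v less.prems] by simp
    then consider y where "g u = g v @ [y]" | y where "g v = g u @ [y]"
      by (auto simp: tree_adj_def)
    then show ?thesis
    proof cases
      case 1
      then show ?thesis using snoc lv by simp
    next
      case 2
      then have "v \<noteq> []" using lv by auto
      then obtain w z where w: "v = w @ [z]" by (metis append_butlast_last_id)
      have "butlast (g v) = g w" using less(1)[of v] v snoc w by simp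
      then have "g u = g w" using 2 by simp
      moreover have "w \<in> tree_words p" using v w by simp
      ultimately have "u = w"
        using tree_autsD(1)[OF g] less.prems by (auto simp: Bij_def bij_betw_def inj_on_def)
      then show ?thesis using snoc w by simp
    qed
  qed
qed

lemma tree_auts_length: "g \<in> tree_auts p \<Longrightarrow> u \<in> tree_words p \<Longrightarrow> length (g u) = length u"
  and tree_auts_butlast: "g \<in> tree_auts p \<Longrightarrow> v @ [x] \<in> tree_words p \<Longrightarrow> butlast (g (v @ [x])) = g v"
  using tree_auts_length_butlast by blast+

lemma gs_a_Nil [simp]: "gs_a p [] = []"
  and gs_a_Cons: "i < p \<Longrightarrow> u \<in> tree_words p \<Longrightarrow> gs_a p (i # u) = (i + 1) mod p # u"
  by (auto simp: gs_a_def)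

lemma gs_a_in_carrier: "gs_a p \<in> carrier (Aut_tree p)"
proof -
  have "bij_betw (gs_a p) (tree_words p) (tree_words p)"
  proof (rule bij_betwI')
    fix u v assume "u \<in> tree_words p" "v \<in> tree_words p"
    then show "gs_a p u = gs_a p v \<longleftrightarrow> u = v"
      by (cases u; cases v) (auto simp: gs_a_Cons mod_Suc split: if_splits)
  next
    fix u assume "u \<in> tree_words p"
    then show "gs_a p u \<in> tree_words p" by (cases u) (auto simp: gs_a_Cons)
  next
    fix v assume v: "v \<in> tree_words p"
    show "\<exists>u \<in> tree_words p. v = gs_a p u"
    proof (cases v)
      case Nil
      then show ?thesis by (auto intro!: bexI[of _ "[]"])
    next
      case (Cons i w)
      then show ?thesis using v
        by (intro bexI[of _ "(if i = 0 then p - 1 else i - 1) # w"]) (auto simp: gs_a_Cons)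
    qed
  qed
  then have "gs_a p \<in> tree_auts p"
  proof (rule tree_autsI)
    show "gs_a p \<in> extensional (tree_words p)" by (simp add: gs_a_def)
    show "length (gs_a p u) = length u" if "u \<in> tree_words p" for u
      using that by (cases u) (auto simp: gs_a_Cons)
    show "butlast (gs_a p (u @ [x])) = gs_a p u" if "u @ [x] \<in> tree_words p" for u x
      using that by (cases u) (auto simp: gs_a_Cons)
  qed
  then show ?thesis by (simp add: Aut_tree_def)
qed

lemma gs_b_in_carrier: "gs_b p \<in> carrier (Aut_tree p)"
proof -
  define c where "c = inv\<^bsub>Aut_tree p\<^esub> (gs_a p)"
  have a: "gs_a p \<in> tree_auts p" using gs_a_in_carrier by (simp add: Aut_tree_def)
  have c: "c \<in> tree_auts p"
    using group.inv_closed[OF group_Aut_tree gs_a_in_carrier] by (simp add: c_def Aut_tree_def)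
  have bijs: "bij_betw (gs_a p) (tree_words p) (tree_words p)"
    "bij_betw c (tree_words p) (tree_words p)"
    using tree_autsD(1)[OF a] tree_autsD(1)[OF c] by (auto simp: Bij_def)
  have eq: "gs_b_fun p (i # u) = i # (if i = 0 then gs_a p u else if i = 1 then c u
      else if i = p - 1 then gs_b_fun p u else u)" for i u
    by (simp add: c_def)
  have V: "gs_b_fun p u \<in> tree_words p" if "u \<in> tree_words p" for u
    using that by (induction u)
      (use tree_autsD(4)[OF a] tree_autsD(4)[OF c] in \<open>auto simp del: gs_b_fun.simps(2) simp: eq\<close>)
  have len: "length (gs_b_fun p u) = length u" if "u \<in> tree_words p" for u
    using that by (induction u)
      (use tree_auts_length[OF a] tree_auts_length[OF c] in \<open>auto simp del: gs_b_fun.simps(2) simp: eq\<close>)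
  have inj: "u = v" if "u \<in> tree_words p" "v \<in> tree_words p" "gs_b_fun p u = gs_b_fun p v" for u v
    using that
  proof (induction u arbitrary: v)
    case Nil
    then show ?case by (cases v) auto
  next
    case (Cons i u)
    then obtain w where v: "v = i # w" by (cases v) auto
    have "u \<in> tree_words p" "w \<in> tree_words p" using Cons v by auto
    with Cons.prems(3) Cons.IH[of w] bijs show ?case
      unfolding v eq by (auto simp: bij_betw_def inj_on_def split: if_splits)
  qed
  have surj: "\<exists>u \<in> tree_words p. gs_b_fun p u = v" if "v \<in> tree_words p" for v
    using that
  proof (induction v)
    case Nil
    show ?case by (rule bexI[of _ "[]"]) auto
  next
    case (Cons i v)
    then have iv: "i < p" "v \<in> tree_words p" by auto
    have "\<exists>u \<in> tree_words p. (if i = 0 then gs_a p u else if i = 1 then c u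
      else if i = p - 1 then gs_b_fun p u else u) = v"
      using Cons.IH[OF iv(2)] iv(2) bij_betw_imp_surj_on[OF bijs(1)] bij_betw_imp_surj_on[OF bijs(2)]
      by (cases "i = 0"; cases "i = 1"; cases "i = p - 1") (simp_all add: image_iff set_eq_iff, metis+)
    then obtain u where "u \<in> tree_words p" "gs_b_fun p (i # u) = i # v" unfolding eq by auto
    with iv show ?case by (intro bexI[of _ "i # u"]) auto
  qed
  have "gs_b p \<in> tree_auts p"
  proof (rule tree_autsI)
    show "bij_betw (gs_b p) (tree_words p) (tree_words p)"
      by (rule bij_betwI') (use inj surj V in \<open>fastforce simp: gs_b_def\<close>)+
    show "gs_b p \<in> extensional (tree_words p)" by (simp add: gs_b_def)
    show "length (gs_b p u) = length u" if "u \<in> tree_words p" for u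
      using that by (simp add: gs_b_def len)
    have "butlast (gs_b_fun p (u @ [x])) = gs_b_fun p u" if "u @ [x] \<in> tree_words p" for u x
      using that
    proof (induction u)
      case Nil
      show ?case using tree_autsD(2)[OF a] tree_autsD(2)[OF c] unfolding append_Nil eq by simp
    next
      case (Cons i u)
      then have u: "u @ [x] \<in> tree_words p" by simp
      have ne: "gs_a p (u @ [x]) \<noteq> []" "c (u @ [x]) \<noteq> []" "gs_b_fun p (u @ [x]) \<noteq> []"
        using tree_auts_length[OF a u] tree_auts_length[OF c u] len[OF u] by auto
      note tree_auts_butlast[OF a u] tree_auts_butlast[OF c u]
      then show ?case using Cons.IH[OF u] ne unfolding append_Cons eq by simp
    qed
    then show "butlast (gs_b p (u @ [x])) = gs_b p u" if "u @ [x] \<in> tree_words p" for u x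
      using that by (simp add: gs_b_def)
  qed
  then show ?thesis by (simp add: Aut_tree_def)
qed

lemma gs_b_Cons:
  assumes "i < p" "u \<in> tree_words p"
  shows "gs_b p (i # u) = i #
       (if i = 0 then gs_a p u
        else if i = 1 then (inv\<^bsub>Aut_tree p\<^esub> (gs_a p)) u
        else if i = p - 1 then gs_b p u
        else u)"
  using assms by (simp add: gs_b_def)

lemma carrier_gupta_sidki:
  "carrier (gupta_sidki p) = generate (Aut_tree p) {gs_a p, gs_b p}"
  using gs_a_in_carrier[of p] gs_b_in_carrier[of p]
  by (simp add: gupta_sidki_def carrier_subgroup_generated)

lemma group_gupta_sidki: "group (gupta_sidki p)"
  unfolding gupta_sidki_def by (rule group.group_subgroup_generated[OF group_Aut_tree])

end

theory Submission
  imports Defs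
begin

text \<open>
  Call a subgroup \<open>D\<close> of a group \<open>K\<close> dense if \<open>D N = K\<close> for every normal subgroup \<open>N\<close> of finite
  index. A maximal subgroup of infinite index is dense and proper, so it suffices that \<open>H\<close> has no
  proper dense subgroup, and this property passes from a subgroup of finite index to the whole group.

  Let \<open>G\<close> be the Gupta--Sidki group. It is a branch group: every nontrivial normal subgroup contains
  a copy of \<open>[G', G]\<close> at each vertex of some level, hence has finite index, and two nontrivial normal
  subgroups never commute. Consequently, if \<open>K \<le> G \<times> \<dots> \<times> G\<close> contains such copies in every factor, then
  a dense subgroup of \<open>K\<close> that projects onto every factor is all of \<open>K\<close>. Indeed the projection of a
  dense subgroup to two factors is not a graph, and commutators produce nontrivial elements supported
  on a single factor.

  For \<open>K\<close> the stabilizer of the first level this says that a dense subgroup \<open>D\<close> of \<open>G\<close> equals \<open>G\<close> as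
  soon as one of its first-level sections (again dense in \<open>G\<close>) does. Passing to sections (up to conjugation)
  reduces the number of \<open>b\<close>-syllables, first of an element of \<open>D\<close> with nonzero exponent sum in \<open>b\<close> until a
  conjugate of \<open>b\<close> lies in \<open>D\<close>, then of an element \<open>g\<close> with \<open>a\<close> and the conjugate of \<open>b\<close> by \<open>g\<close> in \<open>D\<close>,
  until \<open>a, b \<in> D\<close>; so \<open>G\<close> has no proper dense subgroup (Pervova's theorem). Finally, a subgroup of
  finite index in a power of \<open>G\<close> contains, for a deep enough level, lifts that make all of its sections
  surjective, and the statement about \<open>K\<close> applies once more.
\<close>

section \<open>Finite index and dense subgroups\<close>

text \<open>Maximality may be lost when passing to a subgroup of finite index, to an image or to a
  section; profinite density survives all three, hence its central role. Syllable counts control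
  sections because exactly one section of \<open>b\<close>, at the letter \<open>p - 1\<close>,
  involves \<open>b\<close> again: every \<open>b\<close>-syllable of an element goes to one
  first-level section, and exponent sums split in the same way. A section is therefore shorter
  unless all syllables meet at one letter; then the element has the form \<open>a^x b^e a^y\<close>
  and is treated by hand. The sections \<open>a\<close> and \<open>a^-1\<close> of \<open>b\<close>
  cancel in the sum of rotations, so for an element moving the first level a section of its
  \<open>p\<close>-th power fixes that level; this enters the stabilizer without extra syllables.
  For normal subgroups \<open>[G', G]\<close> appears instead of \<open>G'\<close>, since the
  construction yields commutators \<open>[r, s]\<close> with \<open>r\<close> in \<open>G'\<close>,
  only elements of \<open>G'\<close> being known to lift to a single vertex. All this uses just the
  wreath recursion, faithfulness and the generators, so it is done in locales, and tree
  automorphisms enter only at the end.\<close>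

lemma finite_image_factor:
  assumes "finite (c ` A)" and "\<And>x y. x \<in> A \<Longrightarrow> y \<in> A \<Longrightarrow> c x = c y \<Longrightarrow> f x = f y"
  shows "finite (f ` A)"
proof -
  have "f x = f (inv_into A c (c x))" if "x \<in> A" for x
    by (rule assms(2)) (use that in \<open>auto intro: inv_into_into simp: f_inv_into_f\<close>)
  then have "f ` A \<subseteq> (\<lambda>k. f (inv_into A c k)) ` (c ` A)" by blast
  with assms(1) show ?thesis by (meson finite_imageI finite_subset)
qed

context group
begin

lemma inv_mult_cancel [simp]:
  "x \<in> carrier G \<Longrightarrow> y \<in> carrier G \<Longrightarrow> inv x \<otimes> (x \<otimes> y) = y"
  "x \<in> carrier G \<Longrightarrow> y \<in> carrier G \<Longrightarrow> x \<otimes> (inv x \<otimes> y) = y"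
  by (simp_all add: m_assoc[symmetric])

text \<open>Finite index is handled through colourings \<open>c\<close> with finitely many values
  for which equal colours force \<open>x y^-1\<close> into \<open>K\<close>. Colourings combine by
  tupling, so preimages, towers and cores can all be treated in one way.\<close>

lemma finite_indexI:
  assumes K: "subgroup K G" and fin: "finite (c ` carrier G)"
    and c: "\<And>x y. x \<in> carrier G \<Longrightarrow> y \<in> carrier G \<Longrightarrow> c x = c y \<Longrightarrow> x \<otimes> inv y \<in> K"
  shows "finite_index K G"
proof -
  have "K #> x = K #> y" if "x \<in> carrier G" "y \<in> carrier G" "c x = c y" for x y
  proof -
    have "x = (x \<otimes> inv y) \<otimes> y" using that by (simp add: m_assoc)
    then have "x \<in> K #> y" using c[OF that] unfolding r_coset_def by blast
    then show ?thesis using repr_independence[OF _ that(2) K] by simp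
  qed
  then have "finite ((\<lambda>x. K #> x) ` carrier G)" by (rule finite_image_factor[OF fin])
  moreover have "rcosets K = (\<lambda>x. K #> x) ` carrier G" by (auto simp: RCOSETS_def)
  ultimately show ?thesis by (simp add: finite_index_def)
qed

lemma finite_indexE:
  assumes K: "subgroup K G" and fin: "finite_index K G"
  obtains c :: "'a \<Rightarrow> 'a set" where "finite (c ` carrier G)"
    "\<And>x y. x \<in> carrier G \<Longrightarrow> y \<in> carrier G \<Longrightarrow> c x = c y \<Longrightarrow> x \<otimes> inv y \<in> K"
proof
  have "rcosets K = (\<lambda>x. K #> x) ` carrier G" by (auto simp: RCOSETS_def)
  with fin show "finite ((\<lambda>x. K #> x) ` carrier G)" by (simp add: finite_index_def)
next
  fix x y assume xy: "x \<in> carrier G" "y \<in> carrier G" "K #> x = K #> y"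
  then have "x \<in> K #> y" using rcos_self[OF xy(1) K] by simp
  then obtain k where "k \<in> K" "x = k \<otimes> y" unfolding r_coset_def by blast
  moreover have "k \<in> carrier G" using \<open>k \<in> K\<close> K by (rule subgroup.mem_carrier[rotated])
  ultimately show "x \<otimes> inv y \<in> K" using xy by (simp add: m_assoc)
qed

lemma finite_index_mono:
  assumes "subgroup K G" "subgroup L G" "K \<subseteq> L" "finite_index K G"
  shows "finite_index L G"
proof -
  obtain c :: "'a \<Rightarrow> 'a set" where c: "finite (c ` carrier G)"
    "\<And>x y. x \<in> carrier G \<Longrightarrow> y \<in> carrier G \<Longrightarrow> c x = c y \<Longrightarrow> x \<otimes> inv y \<in> K"
    using finite_indexE[OF assms(1,4)] by blast
  show ?thesis by (rule finite_indexI[OF assms(2) c(1)]) (use c(2) assms(3) in blast)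
qed

lemma subgroup_vimage_family:
  assumes "group G'" "\<And>i. i \<in> I \<Longrightarrow> \<phi> i \<in> hom G G'" "\<And>i. i \<in> I \<Longrightarrow> subgroup (N i) G'"
  shows "subgroup {x \<in> carrier G. \<forall>i\<in>I. \<phi> i x \<in> N i} G"
proof (rule subgroupI)
  have 1: "\<phi> i \<one> = \<one>\<^bsub>G'\<^esub>" if "i \<in> I" for i
    using hom_one[OF assms(2)[OF that] is_group assms(1)] .
  then show "{x \<in> carrier G. \<forall>i\<in>I. \<phi> i x \<in> N i} \<noteq> {}"
    using subgroup.one_closed[OF assms(3)] by (auto intro!: exI[of _ \<one>])
  have "\<phi> i (inv x) = inv\<^bsub>G'\<^esub> (\<phi> i x)" if "i \<in> I" "x \<in> carrier G" for i x
    using group_hom.hom_inv[of G G' "\<phi> i" x] assms that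
    by (simp add: group_hom_def group_hom_axioms_def)
  then show "inv x \<in> {x \<in> carrier G. \<forall>i\<in>I. \<phi> i x \<in> N i}"
    if "x \<in> {x \<in> carrier G. \<forall>i\<in>I. \<phi> i x \<in> N i}" for x
    using that subgroup.m_inv_closed[OF assms(3)] by auto
  show "x \<otimes> y \<in> {x \<in> carrier G. \<forall>i\<in>I. \<phi> i x \<in> N i}"
    if "x \<in> {x \<in> carrier G. \<forall>i\<in>I. \<phi> i x \<in> N i}" "y \<in> {x \<in> carrier G. \<forall>i\<in>I. \<phi> i x \<in> N i}" for x y
    using that subgroup.m_closed[OF assms(3)] hom_mult[OF assms(2)] by auto
qed auto

lemma normal_vimage_family:
  assumes "group G'" "\<And>i. i \<in> I \<Longrightarrow> \<phi> i \<in> hom G G'" "\<And>i. i \<in> I \<Longrightarrow> N i \<lhd> G'"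
  shows "{x \<in> carrier G. \<forall>i\<in>I. \<phi> i x \<in> N i} \<lhd> G"
proof -
  have inv: "\<phi> i (inv x) = inv\<^bsub>G'\<^esub> (\<phi> i x)" if "i \<in> I" "x \<in> carrier G" for i x
    using group_hom.hom_inv[of G G' "\<phi> i" x] assms that
    by (simp add: group_hom_def group_hom_axioms_def)
  have "subgroup {x \<in> carrier G. \<forall>i\<in>I. \<phi> i x \<in> N i} G"
    using assms by (intro subgroup_vimage_family) (auto intro: normal_imp_subgroup)
  moreover have "\<phi> i (g \<otimes> x \<otimes> inv g) \<in> N i"
    if "g \<in> carrier G" "x \<in> carrier G" "i \<in> I" "\<phi> i x \<in> N i" for g x i
  proof -
    have "\<phi> i g \<otimes>\<^bsub>G'\<^esub> \<phi> i x \<otimes>\<^bsub>G'\<^esub> inv\<^bsub>G'\<^esub> (\<phi> i g) \<in> N i"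
      using that by (intro normal.inv_op_closed2[OF assms(3)] hom_in_carrier[OF assms(2)])
    then show ?thesis using that by (simp add: hom_mult[OF assms(2)] inv)
  qed
  ultimately show ?thesis by (simp add: normal_inv_iff)
qed

text \<open>An element is coloured by the tuple of the colours of its images; restricting the tuple
  to \<open>I\<close> places it in a finite \<open>PiE\<close>.\<close>

lemma finite_index_vimage_family:
  fixes G' :: "('c, 'd) monoid_scheme" and \<phi> :: "'i \<Rightarrow> 'a \<Rightarrow> 'c"
  assumes "group G'" "finite I" "\<And>i. i \<in> I \<Longrightarrow> \<phi> i \<in> hom G G'"
    and N: "\<And>i. i \<in> I \<Longrightarrow> subgroup (N i) G'" "\<And>i. i \<in> I \<Longrightarrow> finite_index (N i) G'"
  shows "finite_index {x \<in> carrier G. \<forall>i\<in>I. \<phi> i x \<in> N i} G"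
proof -
  interpret G': group G' by fact
  have "\<exists>c :: 'c \<Rightarrow> 'c set. finite (c ` carrier G') \<and>
      (\<forall>x\<in>carrier G'. \<forall>y\<in>carrier G'. c x = c y \<longrightarrow> x \<otimes>\<^bsub>G'\<^esub> inv\<^bsub>G'\<^esub> y \<in> N i)" if "i \<in> I" for i
    by (rule G'.finite_indexE[OF N[OF that]], rule exI, rule conjI, assumption) simp
  then have "\<forall>i\<in>I. \<exists>c :: 'c \<Rightarrow> 'c set. finite (c ` carrier G') \<and>
      (\<forall>x\<in>carrier G'. \<forall>y\<in>carrier G'. c x = c y \<longrightarrow> x \<otimes>\<^bsub>G'\<^esub> inv\<^bsub>G'\<^esub> y \<in> N i)" by blast
  from bchoice[OF this] obtain c :: "'i \<Rightarrow> 'c \<Rightarrow> 'c set" where c: "\<And>i. i \<in> I \<Longrightarrow> finite (c i ` carrier G')"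
      "\<And>i x y. i \<in> I \<Longrightarrow> x \<in> carrier G' \<Longrightarrow> y \<in> carrier G' \<Longrightarrow> c i x = c i y \<Longrightarrow> x \<otimes>\<^bsub>G'\<^esub> inv\<^bsub>G'\<^esub> y \<in> N i"
    by blast
  have inv: "\<phi> i (inv x) = inv\<^bsub>G'\<^esub> (\<phi> i x)" if "i \<in> I" "x \<in> carrier G" for i x
    using group_hom.hom_inv[of G G' "\<phi> i" x] assms that
    by (simp add: group_hom_def group_hom_axioms_def)
  show ?thesis
  proof (rule finite_indexI[OF subgroup_vimage_family[OF assms(1,3) N(1)]])
    have "(\<lambda>x. \<lambda>i\<in>I. c i (\<phi> i x)) ` carrier G \<subseteq> (\<Pi>\<^sub>E i\<in>I. c i ` carrier G')"
      using hom_in_carrier[OF assms(3)] by auto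
    then show "finite ((\<lambda>x. \<lambda>i\<in>I. c i (\<phi> i x)) ` carrier G)"
      using finite_PiE[OF assms(2) c(1)] by (rule finite_subset)
  next
    fix x y assume xy: "x \<in> carrier G" "y \<in> carrier G" "(\<lambda>i\<in>I. c i (\<phi> i x)) = (\<lambda>i\<in>I. c i (\<phi> i y))"
    have "\<phi> i (x \<otimes> inv y) \<in> N i" if i: "i \<in> I" for i
    proof -
      have "c i (\<phi> i x) = c i (\<phi> i y)" using fun_cong[OF xy(3), of i] i by simp
      then have "\<phi> i x \<otimes>\<^bsub>G'\<^esub> inv\<^bsub>G'\<^esub> (\<phi> i y) \<in> N i"
        using c(2)[OF i] hom_in_carrier[OF assms(3)[OF i]] xy by auto
      then show ?thesis using hom_mult[OF assms(3)[OF i]] xy inv i by simp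
    qed
    with xy show "x \<otimes> inv y \<in> {x \<in> carrier G. \<forall>i\<in>I. \<phi> i x \<in> N i}" by simp
  qed auto
qed

lemma hom_of_subgroup: "subgroup K G \<Longrightarrow> \<phi> \<in> hom G G' \<Longrightarrow> \<phi> \<in> hom (G\<lparr>carrier := K\<rparr>) G'"
  by (auto simp: hom_def dest: subgroup.mem_carrier)

text \<open>Let \<open>r x\<close> be a fixed element with the \<open>c\<close>-colour of
  \<open>x\<close>. The new colour of \<open>x\<close> is this colour together with the
  \<open>d\<close>-colour of the remainder \<open>x (r x)^-1\<close>, which lies in
  \<open>K\<close>.\<close>

lemma finite_index_trans:
  assumes K: "subgroup K G" "finite_index K G"
    and N: "subgroup N G" "N \<subseteq> K" "finite_index N (G\<lparr>carrier := K\<rparr>)"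
  shows "finite_index N G"
proof -
  have NK: "subgroup N (G\<lparr>carrier := K\<rparr>)" using N(1,2) by (simp add: K(1) subgroup_incl)
  interpret K: group "G\<lparr>carrier := K\<rparr>" using subgroup_imp_group[OF K(1)] .
  obtain c :: "'a \<Rightarrow> 'a set" where c: "finite (c ` carrier G)"
    "\<And>x y. x \<in> carrier G \<Longrightarrow> y \<in> carrier G \<Longrightarrow> c x = c y \<Longrightarrow> x \<otimes> inv y \<in> K"
    using finite_indexE[OF K] by blast
  obtain d :: "'a \<Rightarrow> 'a set" where d: "finite (d ` K)"
    "\<And>x y. x \<in> K \<Longrightarrow> y \<in> K \<Longrightarrow> d x = d y \<Longrightarrow> x \<otimes> inv y \<in> N"
    using K.finite_indexE[OF NK N(3)] by (auto simp: m_inv_consistent[OF K(1)])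
  define r where "r x = inv_into (carrier G) c (c x)" for x
  have r: "r x \<in> carrier G" "c (r x) = c x" if "x \<in> carrier G" for x
    using that unfolding r_def by (auto intro: inv_into_into simp: f_inv_into_f)
  have rK: "x \<otimes> inv (r x) \<in> K" if "x \<in> carrier G" for x
    using c(2)[OF that r(1)[OF that]] r(2)[OF that] by simp
  show ?thesis
  proof (rule finite_indexI[OF N(1)])
    have "(\<lambda>x. (c x, d (x \<otimes> inv (r x)))) ` carrier G \<subseteq> (c ` carrier G) \<times> (d ` K)"
      using rK by auto
    then show "finite ((\<lambda>x. (c x, d (x \<otimes> inv (r x)))) ` carrier G)"
      using c(1) d(1) finite_subset by blast
  next
    fix x y assume xy: "x \<in> carrier G" "y \<in> carrier G"
      "(c x, d (x \<otimes> inv (r x))) = (c y, d (y \<otimes> inv (r y)))"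
    have e: "r x = r y" using xy by (simp add: r_def)
    have "(x \<otimes> inv (r x)) \<otimes> inv (y \<otimes> inv (r y)) \<in> N"
      using xy rK by (intro d(2)) auto
    then show "x \<otimes> inv y \<in> N"
      using xy r(1)[OF xy(2)] by (simp add: e inv_mult_group m_assoc)
  qed
qed

lemma finite_index_image:
  assumes "group G'" "\<phi> \<in> hom G G'" "\<phi> ` carrier G = carrier G'" "subgroup K G" "finite_index K G"
  shows "finite_index (\<phi> ` K) G'"
proof -
  interpret G': group G' by fact
  interpret \<phi>: group_hom G G' \<phi> using assms by unfold_locales
  obtain c :: "'a \<Rightarrow> 'a set" where c: "finite (c ` carrier G)"
    "\<And>x y. x \<in> carrier G \<Longrightarrow> y \<in> carrier G \<Longrightarrow> c x = c y \<Longrightarrow> x \<otimes> inv y \<in> K"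
    using finite_indexE[OF assms(4,5)] by blast
  define r where "r y = inv_into (carrier G) \<phi> y" for y
  have r: "r y \<in> carrier G" "\<phi> (r y) = y" if "y \<in> carrier G'" for y
    using that assms(3) unfolding r_def by (auto intro: inv_into_into simp: f_inv_into_f)
  show ?thesis
  proof (rule G'.finite_indexI[OF \<phi>.subgroup_img_is_subgroup[OF assms(4)]])
    have "(\<lambda>y. c (r y)) ` carrier G' \<subseteq> c ` carrier G" using r by auto
    then show "finite ((\<lambda>y. c (r y)) ` carrier G')" using c(1) by (rule finite_subset)
    fix x y assume xy: "x \<in> carrier G'" "y \<in> carrier G'" "c (r x) = c (r y)"
    then have "r x \<otimes> inv (r y) \<in> K" using c(2) r by blast
    then have "\<phi> (r x \<otimes> inv (r y)) \<in> \<phi> ` K" by blast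
    with xy r show "x \<otimes>\<^bsub>G'\<^esub> inv\<^bsub>G'\<^esub> y \<in> \<phi> ` K" by simp
  qed
qed

lemma finite_index_core:
  assumes K: "subgroup K G" "finite_index K G"
  obtains N where "N \<lhd> G" "finite_index N G" "N \<subseteq> K"
proof -
  define N where "N = {x \<in> carrier G. \<forall>g\<in>carrier G. g \<otimes> x \<otimes> inv g \<in> K}"
  interpret K: subgroup K G by fact
  obtain c :: "'a \<Rightarrow> 'a set" where c: "finite (c ` carrier G)"
    "\<And>x y. x \<in> carrier G \<Longrightarrow> y \<in> carrier G \<Longrightarrow> c x = c y \<Longrightarrow> x \<otimes> inv y \<in> K"
    using finite_indexE[OF K] by blast
  define r where "r f = inv_into (carrier G) c f" for f
  have r: "r (c x) \<in> carrier G" "c (r (c x)) = c x" if "x \<in> carrier G" for x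
    using that unfolding r_def by (auto intro: inv_into_into simp: f_inv_into_f)
  have sub: "subgroup N G"
  proof (rule subgroupI)
    show "N \<noteq> {}" unfolding N_def by (auto intro!: exI[of _ \<one>])
    show "inv x \<in> N" if "x \<in> N" for x
    proof -
      have "inv (g \<otimes> x \<otimes> inv g) \<in> K" if "g \<in> carrier G" for g
        using \<open>x \<in> N\<close> that by (simp add: N_def)
      then show ?thesis using that by (auto simp: N_def inv_mult_group m_assoc)
    qed
    show "x \<otimes> y \<in> N" if "x \<in> N" "y \<in> N" for x y
    proof -
      have "(g \<otimes> x \<otimes> inv g) \<otimes> (g \<otimes> y \<otimes> inv g) \<in> K" if "g \<in> carrier G" for g
        using \<open>x \<in> N\<close> \<open>y \<in> N\<close> that by (simp add: N_def)
      then show ?thesis using that by (auto simp: N_def m_assoc)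
    qed
  qed (auto simp: N_def)
  have "h \<otimes> x \<otimes> inv h \<in> N" if "h \<in> carrier G" "x \<in> N" for h x
  proof -
    have "(g \<otimes> h) \<otimes> x \<otimes> inv (g \<otimes> h) \<in> K" if "g \<in> carrier G" for g
      using \<open>x \<in> N\<close> that \<open>h \<in> carrier G\<close> by (simp add: N_def)
    then show ?thesis using that by (auto simp: N_def inv_mult_group m_assoc)
  qed
  then have "N \<lhd> G" using sub by (simp add: normal_inv_iff)
  moreover have "finite_index N G"
  proof (rule finite_indexI[OF sub])
    \<comment> \<open>The colour of \<open>x\<close> records its action on the coset colours. One
      representative per colour suffices: \<open>g\<close> and \<open>r (c g)\<close> differ by an
      element of \<open>K\<close>, which is absorbed on both sides when conjugating by
      \<open>g\<close>.\<close>
    let ?c = "\<lambda>x. \<lambda>f\<in>c ` carrier G. c (r f \<otimes> x)"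
    have "?c ` carrier G \<subseteq> (\<Pi>\<^sub>E f\<in>c ` carrier G. c ` carrier G)" using r by auto
    moreover have "finite (\<Pi>\<^sub>E f\<in>c ` carrier G. c ` carrier G)" by (rule finite_PiE) (use c in auto)
    ultimately show "finite (?c ` carrier G)" by (rule finite_subset)
    fix x y assume xy: "x \<in> carrier G" "y \<in> carrier G" "?c x = ?c y"
    have "g \<otimes> (x \<otimes> inv y) \<otimes> inv g \<in> K" if g: "g \<in> carrier G" for g
    proof -
      let ?r = "r (c g)"
      have rc: "?r \<in> carrier G" using r g by blast
      have "c (?r \<otimes> x) = c (?r \<otimes> y)" using fun_cong[OF xy(3), of "c g"] g by simp
      then have "(?r \<otimes> x) \<otimes> inv (?r \<otimes> y) \<in> K" using xy rc by (intro c(2)) auto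
      moreover have "g \<otimes> inv ?r \<in> K" using c(2)[OF g rc] r(2)[OF g] by simp
      moreover have "?r \<otimes> inv g \<in> K" using c(2)[OF rc g] r(2)[OF g] by simp
      ultimately have "(g \<otimes> inv ?r) \<otimes> ((?r \<otimes> x) \<otimes> inv (?r \<otimes> y)) \<otimes> (?r \<otimes> inv g) \<in> K" by simp
      then show ?thesis using g xy rc by (simp add: inv_mult_group m_assoc)
    qed
    then show "x \<otimes> inv y \<in> N" using xy by (simp add: N_def)
  qed
  moreover have "N \<subseteq> K" unfolding N_def by (auto dest: bspec[of _ _ \<one>])
  ultimately show ?thesis by (rule that)
qed

end

section \<open>Density in the profinite topology\<close>

definition profinitely_dense :: "'a set \<Rightarrow> ('a, 'b) monoid_scheme \<Rightarrow> bool"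
  where "profinitely_dense D G \<longleftrightarrow> subgroup D G \<and>
    (\<forall>N. N \<lhd> G \<and> finite_index N G \<longrightarrow> (\<forall>x\<in>carrier G. \<exists>d\<in>D. \<exists>n\<in>N. x = d \<otimes>\<^bsub>G\<^esub> n))"

definition no_proper_dense :: "('a, 'b) monoid_scheme \<Rightarrow> bool"
  where "no_proper_dense G \<longleftrightarrow> (\<forall>D. profinitely_dense D G \<longrightarrow> D = carrier G)"

lemma profinitely_denseD:
  assumes "profinitely_dense D G"
  shows "subgroup D G"
    and "\<And>N x. N \<lhd> G \<Longrightarrow> finite_index N G \<Longrightarrow> x \<in> carrier G \<Longrightarrow> \<exists>d\<in>D. \<exists>n\<in>N. x = d \<otimes>\<^bsub>G\<^esub> n"
  using assms by (auto simp: profinitely_dense_def)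

context group
begin

text \<open>If \<open>M\<close> has infinite index, then \<open>M N\<close> strictly contains
  \<open>M\<close> for every normal \<open>N\<close> of finite index, and maximality makes it the
  whole group. So \<open>M\<close> would be dense and proper.\<close>

lemma maximal_subgroup_finite_index:
  assumes "no_proper_dense G" and M: "maximal_subgroup M G"
  shows "finite_index M G"
proof (rule ccontr)
  assume inf: "\<not> finite_index M G"
  have sM: "subgroup M G" using M unfolding maximal_subgroup_def by blast
  have "\<exists>d\<in>M. \<exists>n\<in>N. x = d \<otimes> n" if N: "N \<lhd> G" "finite_index N G" and x: "x \<in> carrier G" for N x
  proof -
    have sN: "subgroup N G" using N(1) by (rule normal_imp_subgroup)
    have s: "subgroup (M <#> N) G"
      unfolding commut_normal[OF sM N(1)] by (rule mult_norm_subgroup[OF N(1) sM])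
    have "\<one> \<otimes> n \<in> M <#> N" if "n \<in> N" for n
      using that subgroup.one_closed[OF sM] unfolding set_mult_def by blast
    then have "N \<subseteq> M <#> N" using subgroup.mem_carrier[OF sN] by auto
    have "m \<otimes> \<one> \<in> M <#> N" if "m \<in> M" for m
      using that subgroup.one_closed[OF sN] unfolding set_mult_def by blast
    then have sub: "M \<subseteq> M <#> N" using subgroup.mem_carrier[OF sM] by auto
    have "M <#> N \<noteq> M"
      using \<open>N \<subseteq> M <#> N\<close> finite_index_mono[OF sN sM] N(2) inf by blast
    then have "M <#> N = carrier G" using s sub M unfolding maximal_subgroup_def by blast
    with x have "x \<in> M <#> N" by simp
    then show ?thesis unfolding set_mult_def by blast
  qed
  with sM have "profinitely_dense M G" unfolding profinitely_dense_def by blast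
  then have "M = carrier G" using assms(1) by (simp add: no_proper_dense_def)
  moreover have "M \<noteq> carrier G" using M unfolding maximal_subgroup_def by blast
  ultimately show False by blast
qed

text \<open>A normal subgroup \<open>N\<close> of \<open>K\<close> need not be normal in the whole
  group, so it is shrunk to its core \<open>N'\<close>. From \<open>x = d n\<close> with
  \<open>x\<close> and \<open>n\<close> in \<open>K\<close> it follows that \<open>d\<close> is in
  \<open>K\<close>.\<close>

lemma profinitely_dense_Int:
  assumes K: "subgroup K G" "finite_index K G" and D: "profinitely_dense D G"
  shows "profinitely_dense (D \<inter> K) (G\<lparr>carrier := K\<rparr>)"
proof -
  interpret K: subgroup K G by fact
  interpret D: subgroup D G using profinitely_denseD(1)[OF D] .
  have "\<exists>d\<in>D \<inter> K. \<exists>n\<in>N. x = d \<otimes> n"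
    if N: "N \<lhd> G\<lparr>carrier := K\<rparr>" "finite_index N (G\<lparr>carrier := K\<rparr>)" and x: "x \<in> K" for N x
  proof -
    have sNK: "subgroup N (G\<lparr>carrier := K\<rparr>)"
      using N(1) by (rule normal_imp_subgroup)
    then have sN: "subgroup N G" "N \<subseteq> K" using incl_subgroup[OF K(1)] subgroup.subset by force+
    then have "finite_index N G" using finite_index_trans[OF K] N(2) by blast
    then obtain N' where N': "N' \<lhd> G" "finite_index N' G" "N' \<subseteq> N"
      using finite_index_core[OF sN(1)] by blast
    obtain d n where dn: "d \<in> D" "n \<in> N'" "x = d \<otimes> n"
      using profinitely_denseD(2)[OF D N'(1,2) K.mem_carrier[OF x]] by blast
    have nK: "n \<in> K" using dn N' sN by blast
    have "d = x \<otimes> inv n" using dn nK by (simp add: m_assoc)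
    then have "d \<in> K" using x nK by simp
    then show ?thesis using dn N' by blast
  qed
  moreover have "subgroup (D \<inter> K) (G\<lparr>carrier := K\<rparr>)"
    by (rule subgroup_incl) (use subgroups_Inter_pair K(1) D.subgroup_axioms in auto)
  ultimately show ?thesis by (simp add: profinitely_dense_def)
qed

lemma dense_containing_finite_index:
  assumes K: "subgroup K G" "finite_index K G" "K \<subseteq> D" and D: "profinitely_dense D G"
  shows "D = carrier G"
proof -
  interpret D: subgroup D G using profinitely_denseD(1)[OF D] .
  obtain N where N: "N \<lhd> G" "finite_index N G" "N \<subseteq> K" using finite_index_core[OF K(1,2)] by blast
  have "x \<in> D" if "x \<in> carrier G" for x
    using profinitely_denseD(2)[OF D N(1,2) that] N(3) K(3) by (metis D.m_closed subsetD)
  then show ?thesis using D.subset by blast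
qed

lemma no_proper_dense_if_finite_index:
  assumes K: "subgroup K G" "finite_index K G" and "no_proper_dense (G\<lparr>carrier := K\<rparr>)"
  shows "no_proper_dense G"
  unfolding no_proper_dense_def
proof (intro allI impI)
  fix D assume D: "profinitely_dense D G"
  then have "D \<inter> K = K"
    using assms(3) profinitely_dense_Int[OF K] by (auto simp: no_proper_dense_def)
  then show "D = carrier G" using dense_containing_finite_index[OF K _ D] by blast
qed

lemma profinitely_dense_image:
  assumes "group G'" "\<phi> \<in> hom G G'" "\<phi> ` carrier G = carrier G'" "profinitely_dense D G"
  shows "profinitely_dense (\<phi> ` D) G'"
proof -
  interpret \<phi>: group_hom G G' \<phi> using assms by (simp add: group_hom_def group_hom_axioms_def)
  interpret D: subgroup D G using profinitely_denseD(1)[OF assms(4)] .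
  have "\<exists>d\<in>\<phi> ` D. \<exists>n\<in>N. y = d \<otimes>\<^bsub>G'\<^esub> n"
    if N: "N \<lhd> G'" "finite_index N G'" and y: "y \<in> carrier G'" for N y
  proof -
    obtain x where x: "x \<in> carrier G" "y = \<phi> x" using y assms(3) by blast
    \<comment> \<open>The one-element index set specialises the family lemmas to a single
      homomorphism.\<close>
    let ?N = "{x \<in> carrier G. \<forall>i\<in>{()}. \<phi> x \<in> N}"
    have "?N \<lhd> G" using assms N by (intro normal_vimage_family) auto
    moreover have "finite_index ?N G"
      using assms N normal_imp_subgroup[OF N(1)] by (intro finite_index_vimage_family) auto
    ultimately have "\<exists>d\<in>D. \<exists>n\<in>?N. x = d \<otimes> n"
      by (rule profinitely_denseD(2)[OF assms(4) _ _ x(1)])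
    then obtain d n where "d \<in> D" "n \<in> ?N" "x = d \<otimes> n" by blast
    then have "y = \<phi> d \<otimes>\<^bsub>G'\<^esub> \<phi> n" "\<phi> n \<in> N" "d \<in> D" using x by simp_all
    then show ?thesis by blast
  qed
  then show ?thesis
    using \<phi>.subgroup_img_is_subgroup[OF D.subgroup_axioms] by (simp add: profinitely_dense_def)
qed

text \<open>By \<open>inj\<close> the maps \<open>\<phi> i\<close> embed \<open>K\<close> into a
  power of the group. Elements of \<open>D\<close> supported on one coordinate clear the coordinates
  of \<open>x\<close> one at a time, until what remains is trivial.\<close>

lemma subgroup_contains_supported:
  assumes "group K" "finite I" and hom: "\<And>i. i \<in> I \<Longrightarrow> \<phi> i \<in> hom K G"
    and inj: "\<And>x. x \<in> carrier K \<Longrightarrow> \<forall>i\<in>I. \<phi> i x = \<one> \<Longrightarrow> x = \<one>\<^bsub>K\<^esub>"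
    and D: "subgroup D K"
    and A: "\<And>i y. i \<in> I \<Longrightarrow> y \<in> A i \<Longrightarrow> \<exists>d\<in>D. \<phi> i d = y \<and> (\<forall>j\<in>I - {i}. \<phi> j d = \<one>)"
    and x: "x \<in> carrier K" "\<forall>i\<in>I. \<phi> i x \<in> A i"
  shows "x \<in> D"
proof -
  interpret K: group K by fact
  interpret D: subgroup D K by fact
  have "x \<in> D" if "finite J" "J \<subseteq> I" "x \<in> carrier K" "\<forall>i\<in>J. \<phi> i x \<in> A i" "\<forall>i\<in>I - J. \<phi> i x = \<one>"
    for J x
    using that
  proof (induction J arbitrary: x)
    case empty
    then show ?case using inj[of x] by simp
  next
    case (insert i J)
    then obtain d where d: "d \<in> D" "\<phi> i d = \<phi> i x" "\<forall>j\<in>I - {i}. \<phi> j d = \<one>" using A[of i] by blast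
    have [simp]: "d \<in> carrier K" using d by simp
    have *: "\<phi> j (x \<otimes>\<^bsub>K\<^esub> inv\<^bsub>K\<^esub> d) = \<phi> j x \<otimes> inv (\<phi> j d)" "\<phi> j x \<in> carrier G" if "j \<in> I" for j
    proof -
      interpret group_hom K G "\<phi> j" using hom[OF that] by unfold_locales
      show "\<phi> j (x \<otimes>\<^bsub>K\<^esub> inv\<^bsub>K\<^esub> d) = \<phi> j x \<otimes> inv (\<phi> j d)" "\<phi> j x \<in> carrier G"
        using insert.prems by simp_all
    qed
    have "x \<otimes>\<^bsub>K\<^esub> inv\<^bsub>K\<^esub> d \<in> D"
    proof (rule insert.IH)
      show "\<forall>j\<in>J. \<phi> j (x \<otimes>\<^bsub>K\<^esub> inv\<^bsub>K\<^esub> d) \<in> A j"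
      proof
        fix j assume "j \<in> J"
        then have "j \<in> I" "j \<noteq> i" "\<phi> j x \<in> A j" using insert by auto
        then show "\<phi> j (x \<otimes>\<^bsub>K\<^esub> inv\<^bsub>K\<^esub> d) \<in> A j" using d(3) by (simp add: *)
      qed
      show "\<forall>j\<in>I - J. \<phi> j (x \<otimes>\<^bsub>K\<^esub> inv\<^bsub>K\<^esub> d) = \<one>"
      proof
        fix j assume "j \<in> I - J"
        then show "\<phi> j (x \<otimes>\<^bsub>K\<^esub> inv\<^bsub>K\<^esub> d) = \<one>"
          using insert.prems(4) * d(2,3) by (cases "j = i") auto
      qed
    qed (use insert in auto)
    then have "(x \<otimes>\<^bsub>K\<^esub> inv\<^bsub>K\<^esub> d) \<otimes>\<^bsub>K\<^esub> d \<in> D" using d(1) by (rule D.m_closed)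
    then show ?case using insert.prems by (simp add: K.m_assoc)
  qed
  from this[of I x] show ?thesis using assms(2) x by blast
qed

end

section \<open>Dense subgroups of subdirect products\<close>

locale noncommuting_just_infinite = group +
  assumes just_infinite: "N \<lhd> G \<Longrightarrow> N \<noteq> {\<one>} \<Longrightarrow> finite_index N G"
    and noncommuting: "A \<lhd> G \<Longrightarrow> A \<noteq> {\<one>} \<Longrightarrow> B \<lhd> G \<Longrightarrow> B \<noteq> {\<one>} \<Longrightarrow>
      \<exists>x\<in>A. \<exists>y\<in>B. x \<otimes> y \<noteq> y \<otimes> x"
begin

text \<open>The hypothesis \<open>sep\<close> is what makes density incompatible with graphs:
  \<open>K\<close> contains an element supported at \<open>i\<close> that a finite quotient detects.
  Once \<open>D\<close> has nontrivial elements supported on each single coordinate, just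
  infiniteness gives these subgroups finite index, and hence \<open>D\<close> as well.\<close>

lemma dense_subdirect_eq_carrier:
  assumes K: "group K" and fin: "finite I" and hom: "\<And>i. i \<in> I \<Longrightarrow> \<phi> i \<in> hom K G"
    and inj: "\<And>x. x \<in> carrier K \<Longrightarrow> \<forall>i\<in>I. \<phi> i x = \<one> \<Longrightarrow> x = \<one>\<^bsub>K\<^esub>"
    and D: "profinitely_dense D K" and surj: "\<And>i. i \<in> I \<Longrightarrow> \<phi> i ` D = carrier G"
    and sep: "\<And>i. i \<in> I \<Longrightarrow> \<exists>N x. N \<lhd> G \<and> finite_index N G \<and> x \<in> carrier K \<and> \<phi> i x \<notin> N \<and>
      (\<forall>j\<in>I - {i}. \<phi> j x = \<one>)"
  shows "D = carrier K"
proof -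
  interpret K: group K by fact
  interpret D: subgroup D K using profinitely_denseD(1)[OF D] .
  have gh: "group_hom K G (\<phi> i)" if "i \<in> I" for i
    using hom[OF that] by unfold_locales
  define E where "E J = {d \<in> D. \<forall>j\<in>J. \<phi> j d = \<one>}" for J
  have sE: "subgroup (E J) K" if "J \<subseteq> I" for J
  proof -
    have "subgroup {x \<in> carrier K. \<forall>j\<in>J. \<phi> j x \<in> {\<one>}} K"
      using hom that by (intro K.subgroup_vimage_family[where G' = G]) (auto simp: triv_subgroup)
    moreover have "E J = D \<inter> {x \<in> carrier K. \<forall>j\<in>J. \<phi> j x \<in> {\<one>}}" by (auto simp: E_def)
    ultimately show ?thesis using K.subgroups_Inter_pair D.subgroup_axioms by simp
  qed
  \<comment> \<open>\<open>E J\<close> is normal in \<open>D\<close>, and \<open>\<phi> i\<close>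
    maps \<open>D\<close> onto the whole group.\<close>
  have nE: "\<phi> i ` E J \<lhd> G" if i: "i \<in> I" and J: "J \<subseteq> I" for i J
  proof -
    interpret i: group_hom K G "\<phi> i" using gh[OF i] .
    have "g \<otimes> x \<otimes> inv g \<in> \<phi> i ` E J" if g: "g \<in> carrier G" and x: "x \<in> \<phi> i ` E J" for g x
    proof -
      obtain d where d: "d \<in> D" "g = \<phi> i d" using g surj[OF i] by blast
      obtain e where e: "e \<in> E J" "x = \<phi> i e" using x by blast
      have ed: "e \<in> D" "\<And>j. j \<in> J \<Longrightarrow> \<phi> j e = \<one>" using e(1) by (auto simp: E_def)
      have "\<phi> j (d \<otimes>\<^bsub>K\<^esub> e \<otimes>\<^bsub>K\<^esub> inv\<^bsub>K\<^esub> d) = \<one>" if "j \<in> J" for j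
      proof -
        interpret j: group_hom K G "\<phi> j" using gh that J by blast
        show ?thesis using d ed that by simp
      qed
      then have "d \<otimes>\<^bsub>K\<^esub> e \<otimes>\<^bsub>K\<^esub> inv\<^bsub>K\<^esub> d \<in> E J" using d ed by (simp add: E_def)
      moreover have "g \<otimes> x \<otimes> inv g = \<phi> i (d \<otimes>\<^bsub>K\<^esub> e \<otimes>\<^bsub>K\<^esub> inv\<^bsub>K\<^esub> d)" using d ed e by simp
      ultimately show ?thesis by blast
    qed
    then show ?thesis
      using i.subgroup_img_is_subgroup[OF sE[OF J]] by (simp add: normal_inv_iff)
  qed
  have pair: "\<exists>d\<in>D. \<phi> j d = \<one> \<and> \<phi> i d \<noteq> \<one>" if i: "i \<in> I" and j: "j \<in> I" and ij: "i \<noteq> j" for i j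
  proof (rule ccontr)
    interpret i: group_hom K G "\<phi> i" using gh[OF i] .
    interpret j: group_hom K G "\<phi> j" using gh[OF j] .
    assume "\<not> ?thesis"
    then have graph: "\<phi> i d = \<one>" if "d \<in> D" "\<phi> j d = \<one>" for d using that by blast
    obtain N x where N: "N \<lhd> G" "finite_index N G" and x: "x \<in> carrier K" "\<phi> i x \<notin> N" "\<phi> j x = \<one>"
      using sep[OF i] j ij by blast
    have sN: "subgroup N G" using N(1) by (rule normal_imp_subgroup)
    interpret KD: group "K\<lparr>carrier := D\<rparr>" using K.subgroup_imp_group[OF D.subgroup_axioms] .
    let ?E = "{d \<in> carrier (K\<lparr>carrier := D\<rparr>). \<forall>u\<in>{()}. \<phi> i d \<in> N}"
    have homD: "\<phi> i \<in> hom (K\<lparr>carrier := D\<rparr>) G" "\<phi> j \<in> hom (K\<lparr>carrier := D\<rparr>) G"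
      using K.hom_of_subgroup[OF D.subgroup_axioms] hom i j by blast+
    have E: "?E \<lhd> K\<lparr>carrier := D\<rparr>"
      using homD N(1) by (intro KD.normal_vimage_family[where G' = G]) auto
    have Efi: "finite_index ?E (K\<lparr>carrier := D\<rparr>)"
      using homD N(2) sN by (intro KD.finite_index_vimage_family[where G' = G]) auto
    \<comment> \<open>If the projection of \<open>D\<close> to the coordinates \<open>j, i\<close>
      is a graph, \<open>?N'\<close> consists of the \<open>j\<close>-coordinates whose partners lie
      in \<open>N\<close>. Approximating \<open>x\<close> modulo \<open>?U\<close> then forces
      \<open>\<phi> i x\<close> into \<open>N\<close>.\<close>
    let ?N' = "\<phi> j ` ?E"
    have Nfi: "finite_index ?N' G"
      using homD surj[OF j] Efi normal_imp_subgroup[OF E]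
      by (intro KD.finite_index_image) auto
    have nN': "?N' \<lhd> G"
    proof -
      have "g \<otimes> y \<otimes> inv g \<in> ?N'" if g: "g \<in> carrier G" and y: "y \<in> ?N'" for g y
      proof -
        obtain d where d: "d \<in> D" "g = \<phi> j d" using g surj[OF j] by blast
        obtain e where e: "e \<in> D" "\<phi> i e \<in> N" "y = \<phi> j e" using y by auto
        have "\<phi> i d \<otimes> \<phi> i e \<otimes> inv (\<phi> i d) \<in> N"
          using N(1) d e by (intro normal.inv_op_closed2) auto
        then have "d \<otimes>\<^bsub>K\<^esub> e \<otimes>\<^bsub>K\<^esub> inv\<^bsub>K\<^esub> d \<in> ?E" using d e by simp
        moreover have "g \<otimes> y \<otimes> inv g = \<phi> j (d \<otimes>\<^bsub>K\<^esub> e \<otimes>\<^bsub>K\<^esub> inv\<^bsub>K\<^esub> d)" using d e by simp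
        ultimately show ?thesis by blast
      qed
      moreover have "subgroup ?N' G"
      proof -
        interpret group_hom "K\<lparr>carrier := D\<rparr>" G "\<phi> j" using homD by unfold_locales
        show ?thesis by (rule subgroup_img_is_subgroup[OF normal_imp_subgroup[OF E]])
      qed
      ultimately show ?thesis by (simp add: normal_inv_iff)
    qed
    let ?M = "\<lambda>l. if l = i then N else ?N'"
    let ?U = "{y \<in> carrier K. \<forall>l\<in>{i, j}. \<phi> l y \<in> ?M l}"
    have "?U \<lhd> K"
      using hom i j N(1) nN' by (intro K.normal_vimage_family[where G' = G]) auto
    moreover have "finite_index ?U K"
      using hom i j sN N(2) Nfi normal_imp_subgroup[OF nN']
      by (intro K.finite_index_vimage_family[where G' = G]) auto
    ultimately have "\<exists>d\<in>D. \<exists>u\<in>?U. x = d \<otimes>\<^bsub>K\<^esub> u"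
      by (rule profinitely_denseD(2)[OF D _ _ x(1)])
    then obtain d u where du: "d \<in> D" "u \<in> carrier K" "\<phi> i u \<in> N" "\<phi> j u \<in> ?N'" "x = d \<otimes>\<^bsub>K\<^esub> u"
      using ij by auto
    obtain e where e: "e \<in> D" "\<phi> i e \<in> N" "\<phi> j u = \<phi> j e" using du(4) by auto
    \<comment> \<open>At \<open>j\<close> the elements \<open>u\<close> and \<open>e\<close> agree,
      so \<open>d e\<close> has the same coordinate there as \<open>d u = x\<close>.\<close>
    have "\<phi> j (d \<otimes>\<^bsub>K\<^esub> e) = \<one>" using x(3) du e by simp
    then have "\<phi> i (d \<otimes>\<^bsub>K\<^esub> e) = \<one>" using graph du e by simp
    then have "\<phi> i d = inv (\<phi> i e)" using du(1) e(1) by (simp add: inv_equality)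
    then have "\<phi> i d \<in> N" using subgroup.m_inv_closed[OF sN e(2)] by simp
    then have "\<phi> i x \<in> N" using du subgroup.m_closed[OF sN] by simp
    with x(2) show False by blast
  qed
  have multi: "\<exists>d\<in>E J. \<phi> i d \<noteq> \<one>" if "i \<in> I" "finite J" "J \<subseteq> I - {i}" for i J
    using that(2,3)
  proof (induction J)
    case empty
    obtain N x where "N \<lhd> G" "x \<in> carrier K" "\<phi> i x \<notin> N" using sep[OF \<open>i \<in> I\<close>] by blast
    then have "\<phi> i x \<noteq> \<one>" "\<phi> i x \<in> carrier G"
      using subgroup.one_closed[OF normal_imp_subgroup] hom_in_carrier[OF hom[OF \<open>i \<in> I\<close>]] by force+
    then have "\<phi> i x \<in> \<phi> i ` D" using surj[OF \<open>i \<in> I\<close>] by simp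
    then obtain d where "d \<in> D" "\<phi> i d = \<phi> i x" by auto
    with \<open>\<phi> i x \<noteq> \<one>\<close> show ?case unfolding E_def by (intro bexI[of _ d]) simp_all
  next
    case (insert j J)
    have ij: "i \<in> I" "j \<in> I" "i \<noteq> j" "J \<subseteq> I" "{j} \<subseteq> I" using insert.prems \<open>i \<in> I\<close> by auto
    interpret i: group_hom K G "\<phi> i" using gh[OF ij(1)] .
    have "\<phi> i ` E J \<noteq> {\<one>}" using insert by blast
    moreover have "\<phi> i ` E {j} \<noteq> {\<one>}" using pair[OF ij(1-3)] by (auto simp: E_def)
    ultimately obtain d e where de: "d \<in> E J" "e \<in> E {j}" "\<phi> i d \<otimes> \<phi> i e \<noteq> \<phi> i e \<otimes> \<phi> i d"
      using noncommuting[OF nE[OF ij(1,4)] _ nE[OF ij(1,5)]] by blast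
    have dD: "d \<in> D" "e \<in> D" "d \<in> carrier K" "e \<in> carrier K" using de by (auto simp: E_def)
    \<comment> \<open>The commutator of \<open>d\<close> and \<open>e\<close> vanishes wherever one
      of them does, hence on all of \<open>insert j J\<close>.\<close>
    let ?f = "(d \<otimes>\<^bsub>K\<^esub> e) \<otimes>\<^bsub>K\<^esub> inv\<^bsub>K\<^esub> (e \<otimes>\<^bsub>K\<^esub> d)"
    have "\<phi> l ?f = \<one>" if l: "l \<in> insert j J" for l
    proof -
      have "l \<in> I" using l ij by blast
      then interpret l: group_hom K G "\<phi> l" by (rule gh)
      have "\<phi> l d = \<one> \<or> \<phi> l e = \<one>" using l de by (auto simp: E_def)
      then show ?thesis using dD by auto
    qed
    then have "?f \<in> E (insert j J)" using dD by (simp add: E_def)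
    moreover have "\<phi> i ?f \<noteq> \<one>"
    proof
      assume "\<phi> i ?f = \<one>"
      then have "(\<phi> i d \<otimes> \<phi> i e) \<otimes> inv (\<phi> i e \<otimes> \<phi> i d) = \<one>" using dD by simp
      then have "\<phi> i d \<otimes> \<phi> i e = \<phi> i e \<otimes> \<phi> i d"
        using dD by (metis i.hom_closed inv_equality inv_inv m_closed inv_closed)
      with de show False by blast
    qed
    ultimately show ?case by blast
  qed
  define A where "A i = \<phi> i ` E (I - {i})" for i
  have A: "A i \<lhd> G" "finite_index (A i) G" if "i \<in> I" for i
  proof -
    show 1: "A i \<lhd> G" unfolding A_def using that by (intro nE) auto
    have "A i \<noteq> {\<one>}" using multi[OF that, of "I - {i}"] fin by (auto simp: A_def)
    with 1 show "finite_index (A i) G" by (rule just_infinite)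
  qed
  let ?U = "{x \<in> carrier K. \<forall>i\<in>I. \<phi> i x \<in> A i}"
  have "x \<in> D" if "x \<in> ?U" for x
  proof (rule subgroup_contains_supported[OF K fin hom inj D.subgroup_axioms])
    show "\<exists>d\<in>D. \<phi> i d = y \<and> (\<forall>j\<in>I - {i}. \<phi> j d = \<one>)" if "y \<in> A i" for i y
      using that by (auto simp: A_def E_def)
  qed (use that in auto)
  then have "?U \<subseteq> D" by blast
  moreover have "subgroup ?U K" "finite_index ?U K"
    using hom A normal_imp_subgroup[OF A(1)] fin
    by (intro K.subgroup_vimage_family[where G' = G] K.finite_index_vimage_family[where G' = G]; auto)+
  ultimately show ?thesis using K.dense_containing_finite_index D by blast
qed

end

section \<open>Self-similar groups\<close>

text \<open>The wreath recursion of a right action: \<open>(j w)^g\<close> is \<open>act g j\<close>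
  followed by \<open>w^(sec g j)\<close>. No tree is presupposed; the action on words is rebuilt
  from the recursion.\<close>

locale self_similar_group = group G for G (structure) +
  fixes p :: nat and act :: "'a \<Rightarrow> nat \<Rightarrow> nat" and sec :: "'a \<Rightarrow> nat \<Rightarrow> 'a"
  assumes p_pos: "0 < p"
    and act_less [simp]: "g \<in> carrier G \<Longrightarrow> j < p \<Longrightarrow> act g j < p"
    and sec_closed [simp]: "g \<in> carrier G \<Longrightarrow> j < p \<Longrightarrow> sec g j \<in> carrier G"
    and act_one [simp]: "j < p \<Longrightarrow> act \<one> j = j"
    and act_mult [simp]: "g \<in> carrier G \<Longrightarrow> h \<in> carrier G \<Longrightarrow> j < p \<Longrightarrow>
      act (g \<otimes> h) j = act h (act g j)"
    and sec_mult [simp]: "g \<in> carrier G \<Longrightarrow> h \<in> carrier G \<Longrightarrow> j < p \<Longrightarrow>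
      sec (g \<otimes> h) j = sec g j \<otimes> sec h (act g j)"
begin

primrec actw :: "'a \<Rightarrow> nat list \<Rightarrow> nat list"
  where "actw g [] = []" | "actw g (j # v) = act g j # actw (sec g j) v"

primrec secw :: "'a \<Rightarrow> nat list \<Rightarrow> 'a"
  where "secw g [] = g" | "secw g (j # v) = secw (sec g j) v"

definition words :: "nat \<Rightarrow> nat list set"
  where "words n = {v. set v \<subseteq> {..<p} \<and> length v = n}"

lemma words_0 [simp]: "words 0 = {[]}"
  and Cons_words [simp]: "j # v \<in> words (Suc n) \<longleftrightarrow> j < p \<and> v \<in> words n"
  and singleton_words [simp]: "[j] \<in> words n \<longleftrightarrow> j < p \<and> n = 1"
  by (auto simp: words_def)

lemma words_Suc_iff: "v \<in> words (Suc n) \<longleftrightarrow> (\<exists>j u. v = j # u \<and> j < p \<and> u \<in> words n)"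
  by (cases v) (auto simp: words_def)

lemma words_1: "v \<in> words 1 \<longleftrightarrow> (\<exists>j<p. v = [j])"
  by (auto simp: words_Suc_iff)

lemma finite_words [simp]: "finite (words n)"
  unfolding words_def by (rule finite_lists_length_eq) simp

lemma append_words: "u \<in> words m \<Longrightarrow> v \<in> words n \<Longrightarrow> u @ v \<in> words (m + n)"
  by (auto simp: words_def)

lemma words_append_split:
  assumes "w \<in> words (m + n)"
  obtains u v where "u \<in> words m" "v \<in> words n" "w = u @ v"
  using assms set_take_subset[of m w] set_drop_subset[of m w] append_take_drop_id[of m w]
  by (intro that[of "take m w" "drop m w"]) (auto simp: words_def)

lemma replicate_words: "replicate n 0 \<in> words n"
  using p_pos by (auto simp: words_def)

lemma length_words: "v \<in> words n \<Longrightarrow> length v = n"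
  by (simp add: words_def)

lemma sec_one [simp]:
  assumes "j < p" shows "sec \<one> j = \<one>"
proof -
  have "sec (\<one> \<otimes> \<one>) j = sec \<one> j \<otimes> sec \<one> j" using assms by (subst sec_mult) simp_all
  then show ?thesis using assms by simp
qed

lemma set_words [simp]: "v \<in> words n \<Longrightarrow> set v \<subseteq> {..<p}"
  by (simp add: words_def)

lemma set_actw [simp]: "g \<in> carrier G \<Longrightarrow> set v \<subseteq> {..<p} \<Longrightarrow> set (actw g v) \<subseteq> {..<p}"
  by (induction v arbitrary: g) auto

lemma length_actw [simp]: "length (actw g v) = length v"
  by (induction v arbitrary: g) auto

lemma actw_words [simp]: "g \<in> carrier G \<Longrightarrow> v \<in> words n \<Longrightarrow> actw g v \<in> words n"
  using set_actw[of g v] unfolding words_def by simp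

lemma secw_closed [simp]: "g \<in> carrier G \<Longrightarrow> set v \<subseteq> {..<p} \<Longrightarrow> secw g v \<in> carrier G"
  by (induction v arbitrary: g) auto

lemma actw_one [simp]: "set v \<subseteq> {..<p} \<Longrightarrow> actw \<one> v = v"
  by (induction v) auto

lemma secw_one [simp]: "set v \<subseteq> {..<p} \<Longrightarrow> secw \<one> v = \<one>"
  by (induction v) auto

lemma actw_mult [simp]:
  "g \<in> carrier G \<Longrightarrow> h \<in> carrier G \<Longrightarrow> set v \<subseteq> {..<p} \<Longrightarrow> actw (g \<otimes> h) v = actw h (actw g v)"
  by (induction v arbitrary: g h) auto

lemma secw_mult [simp]:
  "g \<in> carrier G \<Longrightarrow> h \<in> carrier G \<Longrightarrow> set v \<subseteq> {..<p} \<Longrightarrow>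
    secw (g \<otimes> h) v = secw g v \<otimes> secw h (actw g v)"
  by (induction v arbitrary: g h) auto

lemma actw_append: "actw g (u @ v) = actw g u @ actw (secw g u) v"
  by (induction u arbitrary: g) auto

lemma secw_append: "secw g (u @ v) = secw (secw g u) v"
  by (induction u arbitrary: g) auto

lemma actw_inv_cancel [simp]:
  assumes "g \<in> carrier G" "set v \<subseteq> {..<p}"
  shows "actw (inv g) (actw g v) = v" "actw g (actw (inv g) v) = v"
  using actw_mult[of g "inv g" v] actw_mult[of "inv g" g v] assms by simp_all

lemma secw_inv:
  assumes "g \<in> carrier G" "set v \<subseteq> {..<p}"
  shows "secw (inv g) (actw g v) = inv (secw g v)"
proof -
  have "secw (g \<otimes> inv g) v = \<one>" using assms by (subst r_inv) auto
  then have "secw g v \<otimes> secw (inv g) (actw g v) = \<one>" using assms by (subst (asm) secw_mult) auto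
  then have "secw (inv g) (actw g v) \<otimes> secw g v = \<one>" by (rule inv_comm) (use assms in auto)
  then have "inv (secw g v) = secw (inv g) (actw g v)" by (rule inv_equality) (use assms in auto)
  then show ?thesis by simp
qed

lemma sec_inv:
  assumes "g \<in> carrier G" "j < p"
  shows "sec (inv g) (act g j) = inv (sec g j)"
  using secw_inv[of g "[j]"] assms by simp

lemma act_inv_cancel [simp]:
  assumes "g \<in> carrier G" "j < p"
  shows "act (inv g) (act g j) = j" "act g (act (inv g) j) = j"
  using actw_inv_cancel[of g "[j]"] assms by simp_all

lemma bij_betw_act:
  assumes "g \<in> carrier G" shows "bij_betw (act g) {..<p} {..<p}"
  by (rule bij_betw_byWitness[where f' = "act (inv g)"]) (use assms in auto)

section \<open>Level stabilizers and elements supported below one vertex\<close>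

definition level_stab :: "nat \<Rightarrow> 'a set"
  where "level_stab n = {g \<in> carrier G. \<forall>u\<in>words n. actw g u = u}"

lemma level_stabD:
  assumes "g \<in> level_stab n"
  shows "g \<in> carrier G" "u \<in> words n \<Longrightarrow> actw g u = u"
  using assms by (auto simp: level_stab_def)

lemma level_stab_1: "g \<in> level_stab 1 \<longleftrightarrow> g \<in> carrier G \<and> (\<forall>j<p. act g j = j)"
  by (auto simp: level_stab_def words_Suc_iff dest: bspec[of _ _ "[_]"])

lemma normal_level_stab: "level_stab n \<lhd> G"
proof -
  have "subgroup (level_stab n) G"
  proof (rule subgroupI)
    show "level_stab n \<noteq> {}" by (auto simp: level_stab_def intro!: exI[of _ \<one>])
    show "inv g \<in> level_stab n" if "g \<in> level_stab n" for g
    proof -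
      have "actw (inv g) u = u" if "u \<in> words n" for u
        using actw_inv_cancel(1) level_stabD[OF \<open>g \<in> level_stab n\<close>] that by (metis set_words)
      then show ?thesis using that by (simp add: level_stab_def)
    qed
  qed (auto simp: level_stab_def)
  moreover have "g \<otimes> x \<otimes> inv g \<in> level_stab n" if "g \<in> carrier G" "x \<in> level_stab n" for g x
  proof -
    have "actw (g \<otimes> x \<otimes> inv g) u = u" if "u \<in> words n" for u
      using \<open>g \<in> carrier G\<close> \<open>x \<in> level_stab n\<close> that by (simp add: level_stab_def)
    then show ?thesis using that by (simp add: level_stab_def)
  qed
  ultimately show ?thesis by (simp add: normal_inv_iff)
qed

lemma subgroup_level_stab: "subgroup (level_stab n) G"
  by (rule normal_imp_subgroup[OF normal_level_stab])

lemma actw_diff: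
  assumes "g \<in> carrier G" "h \<in> carrier G" "u \<in> words n" "actw g u = actw h u"
  shows "actw (g \<otimes> inv h) u = u" "secw (g \<otimes> inv h) u = secw g u \<otimes> inv (secw h u)"
  using assms by (auto simp: secw_inv)

text \<open>An element is coloured by its action on level \<open>n\<close> together with the
  \<open>N\<close>-colours of its sections there.\<close>

lemma finite_index_level_stab_vimage:
  assumes N: "subgroup N G" "finite_index N G"
  shows "subgroup {g \<in> level_stab n. \<forall>u\<in>words n. secw g u \<in> N} G" (is "subgroup ?R G")
    and "finite_index {g \<in> level_stab n. \<forall>u\<in>words n. secw g u \<in> N} G"
proof -
  interpret S: subgroup "level_stab n" G by (rule subgroup_level_stab)
  have inv: "secw (inv g) u = inv (secw g u)" if "g \<in> level_stab n" "u \<in> words n" for g u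
    using secw_inv[of g u] level_stabD(1)[of g n] level_stabD(2)[of g n u] that by simp
  show sub: "subgroup ?R G"
  proof (rule subgroupI)
    show "?R \<noteq> {}" using subgroup.one_closed[OF N(1)] by (auto intro!: exI[of _ \<one>])
    show "inv g \<in> ?R" if "g \<in> ?R" for g
      using that subgroup.m_inv_closed[OF N(1)] by (auto simp: inv)
    show "g \<otimes> h \<in> ?R" if "g \<in> ?R" "h \<in> ?R" for g h
      using that subgroup.m_closed[OF N(1)] by (auto dest: level_stabD)
  qed (auto dest: level_stabD)
  obtain c :: "'a \<Rightarrow> 'a set" where c: "finite (c ` carrier G)"
    "\<And>x y. x \<in> carrier G \<Longrightarrow> y \<in> carrier G \<Longrightarrow> c x = c y \<Longrightarrow> x \<otimes> inv y \<in> N"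
    using finite_indexE[OF N] by blast
  let ?c = "\<lambda>g. \<lambda>u\<in>words n. (actw g u, c (secw g u))"
  show "finite_index ?R G"
  proof (rule finite_indexI[OF sub])
    have "?c ` carrier G \<subseteq> (\<Pi>\<^sub>E u\<in>words n. words n \<times> c ` carrier G)" by auto
    moreover have "finite (\<Pi>\<^sub>E u\<in>words n. words n \<times> c ` carrier G)"
      using c(1) by (intro finite_PiE) auto
    ultimately show "finite (?c ` carrier G)" by (rule finite_subset)
    fix g h assume gh: "g \<in> carrier G" "h \<in> carrier G" "?c g = ?c h"
    have "actw g u = actw h u" "c (secw g u) = c (secw h u)" if "u \<in> words n" for u
      using fun_cong[OF gh(3), of u] that by auto
    then have "actw (g \<otimes> inv h) u = u \<and> secw (g \<otimes> inv h) u \<in> N" if "u \<in> words n" for u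
      using actw_diff[OF gh(1,2) that] that gh(1,2) c(2) by simp
    then show "g \<otimes> inv h \<in> ?R" using gh(1,2) unfolding level_stab_def by blast
  qed
qed

lemma finite_index_carrier: "finite_index (carrier G) G"
  by (rule finite_indexI[where c = "\<lambda>_. ()"]) (auto simp: subgroup_self)

lemma finite_index_level_stab: "finite_index (level_stab n) G"
  by (rule finite_index_mono[OF finite_index_level_stab_vimage(1)[where n = n, OF subgroup_self finite_index_carrier]
        subgroup_level_stab _ finite_index_level_stab_vimage(2)[where n = n, OF subgroup_self finite_index_carrier]])
    blast

lemma secw_hom: "u \<in> words n \<Longrightarrow> (\<lambda>g. secw g u) \<in> hom (G\<lparr>carrier := level_stab n\<rparr>) G"
  unfolding hom_def level_stab_def by simp

lemma sec_hom: "j < p \<Longrightarrow> (\<lambda>g. sec g j) \<in> hom (G\<lparr>carrier := level_stab 1\<rparr>) G"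
  using secw_hom[of "[j]" 1] by simp

lemma secw_stab_inv:
  "g \<in> level_stab n \<Longrightarrow> u \<in> words n \<Longrightarrow> secw (inv g) u = inv (secw g u)"
  using secw_inv[of g u] level_stabD(1)[of g n] level_stabD(2)[of g n u] by simp

lemma sec_stab_inv: "g \<in> level_stab 1 \<Longrightarrow> j < p \<Longrightarrow> sec (inv g) j = inv (sec g j)"
  using secw_stab_inv[of g 1 "[j]"] by simp

text \<open>\<open>lifts v x y\<close>: the element \<open>y\<close> acts as \<open>x\<close> below the vertex \<open>v\<close> and trivially elsewhere.\<close>

definition lifts :: "nat list \<Rightarrow> 'a \<Rightarrow> 'a \<Rightarrow> bool"
  where "lifts v x y \<longleftrightarrow> y \<in> level_stab (length v) \<and>
    (\<forall>u\<in>words (length v). secw y u = (if u = v then x else \<one>))"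

lemma liftsD:
  assumes "lifts v x y" "v \<in> words n"
  shows "y \<in> level_stab n" "y \<in> carrier G" "secw y v = x" "u \<in> words n \<Longrightarrow> u \<noteq> v \<Longrightarrow> secw y u = \<one>"
    "u \<in> words n \<Longrightarrow> actw y u = u"
  using assms length_words[OF assms(2)] by (auto simp: lifts_def level_stab_def)

lemma liftsI:
  assumes "v \<in> words n" "y \<in> level_stab n" "secw y v = x"
    "\<And>u. u \<in> words n \<Longrightarrow> u \<noteq> v \<Longrightarrow> secw y u = \<one>"
  shows "lifts v x y"
  using assms length_words[OF assms(1)] by (auto simp: lifts_def)

lemma lifts_one: "v \<in> words n \<Longrightarrow> lifts v \<one> \<one>"
  by (rule liftsI) (auto simp: level_stab_def)

lemma lifts_mult:
  assumes "lifts v x y" "lifts v x' y'" "v \<in> words n"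
  shows "lifts v (x \<otimes> x') (y \<otimes> y')"
proof (rule liftsI[OF assms(3)])
  show "y \<otimes> y' \<in> level_stab n"
    using liftsD(1)[OF assms(1,3)] liftsD(1)[OF assms(2,3)]
    by (rule subgroup.m_closed[OF subgroup_level_stab])
qed (use liftsD[OF assms(1,3)] liftsD[OF assms(2,3)] assms(3) in auto)

lemma lifts_inv:
  assumes "lifts v x y" "v \<in> words n"
  shows "lifts v (inv x) (inv y)"
proof (rule liftsI[OF assms(2)])
  show "inv y \<in> level_stab n"
    using liftsD(1)[OF assms] by (rule subgroup.m_inv_closed[OF subgroup_level_stab])
qed (use liftsD[OF assms] assms(2) in \<open>auto simp: secw_stab_inv\<close>)

lemma lifts_conj:
  assumes "lifts v x y" "v \<in> words n" "g \<in> carrier G"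
  shows "lifts (actw g v) (inv (secw g v) \<otimes> x \<otimes> secw g v) (inv g \<otimes> y \<otimes> g)"
proof (rule liftsI)
  note D = liftsD[OF assms(1,2)]
  show "actw g v \<in> words n" using assms by simp
  have "inv g \<otimes> y \<otimes> inv (inv g) \<in> level_stab n"
    using assms D(1) normal_level_stab by (intro normal.inv_op_closed2) auto
  then show "inv g \<otimes> y \<otimes> g \<in> level_stab n" using assms by simp
  have *: "secw (inv g \<otimes> y \<otimes> g) (actw g u) = inv (secw g u) \<otimes> secw y u \<otimes> secw g u"
    if "u \<in> words n" for u
    using that assms D by (simp add: secw_inv)
  show "secw (inv g \<otimes> y \<otimes> g) (actw g v) = inv (secw g v) \<otimes> x \<otimes> secw g v"
    using *[OF assms(2)] D by simp
  fix u assume u: "u \<in> words n" "u \<noteq> actw g v"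
  let ?u = "actw (inv g) u"
  have "?u \<in> words n" "actw g ?u = u" using u assms by simp_all
  with u show "secw (inv g \<otimes> y \<otimes> g) u = \<one>" using *[of ?u] D(4)[of ?u] assms by force
qed

lemma lifts_append:
  assumes "lifts u x' y" "lifts v x x'" "u \<in> words m" "v \<in> words n"
  shows "lifts (u @ v) x y"
proof (rule liftsI)
  note D = liftsD[OF assms(1,3)] and E = liftsD[OF assms(2,4)]
  show "u @ v \<in> words (m + n)" using append_words assms by blast
  have *: "actw y w = w \<and> secw y w = (if w = u @ v then x else \<one>)" if w: "w \<in> words (m + n)" for w
  proof -
    obtain s t where st: "s \<in> words m" "t \<in> words n" "w = s @ t" using words_append_split[OF w] .
    show ?thesis
    proof (cases "s = u")
      case True
      then show ?thesis using st D E by (auto simp: actw_append secw_append)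
    next
      case False
      then have "w \<noteq> u @ v" using st(1,3) assms(3) length_words[of _ m] by (metis append_eq_append_conv)
      with False show ?thesis using st D by (auto simp: actw_append secw_append)
    qed
  qed
  then show "y \<in> level_stab (m + n)" using D by (auto simp: level_stab_def)
  show "secw y (u @ v) = x" "\<And>w. w \<in> words (m + n) \<Longrightarrow> w \<noteq> u @ v \<Longrightarrow> secw y w = \<one>"
    using * \<open>u @ v \<in> words (m + n)\<close> by auto
qed

end

locale faithful_self_similar_group = self_similar_group +
  assumes faithful: "g \<in> carrier G \<Longrightarrow> (\<And>n v. v \<in> words n \<Longrightarrow> actw g v = v) \<Longrightarrow> g = \<one>"
begin

lemma trivial_if_trivial_sections:
  assumes g: "g \<in> carrier G" and "\<And>j. j < p \<Longrightarrow> act g j = j" "\<And>j. j < p \<Longrightarrow> sec g j = \<one>"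
  shows "g = \<one>"
proof (rule faithful[OF g])
  fix n v assume "v \<in> words n"
  then show "actw g v = v" using assms(2,3) by (cases n) (auto simp: words_Suc_iff)
qed

lemma level_stab_trivial:
  assumes "g \<in> level_stab n" "\<And>u. u \<in> words n \<Longrightarrow> secw g u = \<one>"
  shows "g = \<one>"
  using assms
proof (induction n arbitrary: g)
  case 0
  then show ?case by simp
next
  case (Suc n)
  have g: "g \<in> carrier G" and fx: "\<And>j u. j < p \<Longrightarrow> u \<in> words n \<Longrightarrow> act g j = j \<and> actw (sec g j) u = u"
    using level_stabD(1)[OF Suc.prems(1)] level_stabD(2)[OF Suc.prems(1), of "_ # _"] by simp_all
  show ?case
  proof (rule trivial_if_trivial_sections[OF g])
    show "act g j = j" if "j < p" for j using fx[OF that replicate_words] by simp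
    show "sec g j = \<one>" if "j < p" for j
    proof (rule Suc.IH)
      show "sec g j \<in> level_stab n" using fx[OF that] g that by (simp add: level_stab_def)
      show "secw (sec g j) u = \<one>" if "u \<in> words n" for u
        using Suc.prems(2)[of "j # u"] that \<open>j < p\<close> by simp
    qed
  qed
qed

lemma moves_word:
  assumes "g \<in> carrier G" "g \<noteq> \<one>"
  obtains n u where "u \<in> words n" "actw g u \<noteq> u"
  using faithful assms by blast

text \<open>Every extension of a moved word is moved, so padding with zeros reaches all deeper
  levels.\<close>

lemma moves_long_word:
  assumes "g \<in> carrier G" "g \<noteq> \<one>"
  obtains n where "\<And>m. n \<le> m \<Longrightarrow> \<exists>u\<in>words m. actw g u \<noteq> u"
proof -
  obtain n u where u: "u \<in> words n" "actw g u \<noteq> u" using moves_word[OF assms] .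
  have "u @ replicate (m - n) 0 \<in> words m" "actw g (u @ replicate (m - n) 0) \<noteq> u @ replicate (m - n) 0"
    if "n \<le> m" for m
  proof -
    show "u @ replicate (m - n) 0 \<in> words m"
      using append_words[OF u(1) replicate_words[of "m - n"]] that by simp
    show "actw g (u @ replicate (m - n) 0) \<noteq> u @ replicate (m - n) 0"
      using u(2) by (simp add: actw_append)
  qed
  then show thesis using that by blast
qed

end

section \<open>Commutator subgroups\<close>

context group
begin

text \<open>\<open>Z y\<close> is the centralizer of \<open>y\<close> modulo \<open>N\<close>. It is
  shown to be everything in two passes, first for \<open>y\<close> in \<open>S\<close> and then for
  arbitrary elements, using that the inverse of \<open>[x, y]\<close> is
  \<open>[y, x]\<close>.\<close>

lemma derived_le_normal:
  assumes N: "N \<lhd> G" and S: "S \<subseteq> carrier G" "generate G S = carrier G"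
    and comm: "\<And>x y. x \<in> S \<Longrightarrow> y \<in> S \<Longrightarrow> x \<otimes> y \<otimes> inv x \<otimes> inv y \<in> N"
  shows "derived G (carrier G) \<subseteq> N"
proof -
  interpret N: normal N G by fact
  define Z where "Z y = {x \<in> carrier G. x \<otimes> y \<otimes> inv x \<otimes> inv y \<in> N}" for y
  have sub: "subgroup (Z y) G" if y: "y \<in> carrier G" for y
  proof (rule subgroupI)
    show "Z y \<noteq> {}" using y by (auto simp: Z_def intro!: exI[of _ \<one>])
    show "inv x \<in> Z y" if "x \<in> Z y" for x
    proof -
      have x: "x \<in> carrier G" "x \<otimes> y \<otimes> inv x \<otimes> inv y \<in> N" using that by (auto simp: Z_def)
      have "inv x \<otimes> inv (x \<otimes> y \<otimes> inv x \<otimes> inv y) \<otimes> x \<in> N"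
        using x by (intro N.inv_op_closed1) auto
      then show ?thesis using x y by (simp add: Z_def inv_mult_group m_assoc)
    qed
    show "x \<otimes> x' \<in> Z y" if "x \<in> Z y" "x' \<in> Z y" for x x'
    proof -
      have x: "x \<in> carrier G" "x \<otimes> y \<otimes> inv x \<otimes> inv y \<in> N"
        "x' \<in> carrier G" "x' \<otimes> y \<otimes> inv x' \<otimes> inv y \<in> N" using that by (auto simp: Z_def)
      have "(x \<otimes> (x' \<otimes> y \<otimes> inv x' \<otimes> inv y) \<otimes> inv x) \<otimes> (x \<otimes> y \<otimes> inv x \<otimes> inv y) \<in> N"
        by (rule N.m_closed[OF N.inv_op_closed2[OF x(1,4)] x(2)])
      then show ?thesis using x y by (simp add: Z_def inv_mult_group m_assoc)
    qed
  qed (auto simp: Z_def)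
  have gen: "Z y = carrier G" if "y \<in> carrier G" "S \<subseteq> Z y" for y
    using generate_subgroup_incl[OF that(2) sub[OF that(1)]] S(2) by (auto simp: Z_def)
  have "S \<subseteq> Z y" if "y \<in> S" for y using that comm S by (auto simp: Z_def)
  then have Zy: "Z y = carrier G" if "y \<in> S" for y using gen[of y] that S by blast
  have "S \<subseteq> Z x" if x: "x \<in> carrier G" for x
  proof
    fix y assume y: "y \<in> S"
    then have yc: "y \<in> carrier G" using S by blast
    have "x \<otimes> y \<otimes> inv x \<otimes> inv y \<in> N" using Zy[OF y] x by (auto simp: Z_def)
    then have "inv (x \<otimes> y \<otimes> inv x \<otimes> inv y) \<in> N" by simp
    then show "y \<in> Z x" using x yc by (simp add: Z_def inv_mult_group m_assoc)
  qed
  then have "Z x = carrier G" if "x \<in> carrier G" for x using gen that by blast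
  then have "derived_set G (carrier G) \<subseteq> N" by (auto simp: Z_def)
  then show ?thesis unfolding derived_def by (rule generate_subgroup_incl[OF _ N.subgroup_axioms])
qed

lemma pow_mult_commute:
  "x \<in> carrier G \<Longrightarrow> y \<in> carrier G \<Longrightarrow> x \<otimes> y = y \<otimes> x \<Longrightarrow> x [^] (n::nat) \<otimes> y = y \<otimes> x [^] n"
proof (induction n)
  case (Suc n)
  have "x [^] Suc n \<otimes> y = x [^] n \<otimes> (x \<otimes> y)" using Suc.prems by (simp add: m_assoc)
  also have "\<dots> = (x [^] n \<otimes> y) \<otimes> x" using Suc.prems by (simp add: m_assoc)
  also have "\<dots> = y \<otimes> x [^] Suc n" using Suc by (simp add: m_assoc)
  finally show ?case .
qed simp

lemma nat_pow_mod:
  assumes "x \<in> carrier G" "x [^] (p::nat) = \<one>"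
  shows "x [^] (n mod p) = x [^] n"
proof -
  have "x [^] n = (x [^] p) [^] (n div p) \<otimes> x [^] (n mod p)"
    using assms(1) by (simp add: nat_pow_pow nat_pow_mult)
  then show ?thesis using assms by simp
qed

text \<open>Here \<open>d\<close> is the central commutator of \<open>b\<close> and
  \<open>a\<close>, and \<open>f k i j\<close> is the Heisenberg normal form
  \<open>d^k a^i b^j\<close>. Moving \<open>b\<close> past \<open>a^p = 1\<close> gives
  \<open>d^p = 1\<close>, so all three exponents count modulo \<open>p\<close> only.\<close>

lemma finite_two_generated_class_two:
  assumes ab: "a \<in> carrier G" "b \<in> carrier G" "generate G {a, b} = carrier G"
    and tors: "a [^] (p::nat) = \<one>" "b [^] p = \<one>" "0 < p"
    and d: "d \<in> carrier G" "b \<otimes> a = d \<otimes> (a \<otimes> b)" "d \<otimes> a = a \<otimes> d" "d \<otimes> b = b \<otimes> d"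
  shows "finite (carrier G)"
proof -
  note [simp] = ab(1,2) d(1)
  define f where "f k i j = d [^] (k::nat) \<otimes> (a [^] (i::nat) \<otimes> b [^] (j::nat))" for k i j
  have ddm: "d [^] (k::nat) \<otimes> d [^] (l::nat) = d [^] (k + l)" for k l by (simp add: nat_pow_mult)
  have da: "a [^] (i::nat) \<otimes> d [^] (k::nat) = d [^] k \<otimes> a [^] i"
    and db: "b [^] (i::nat) \<otimes> d [^] (k::nat) = d [^] k \<otimes> b [^] i" for i k
  proof -
    have "d \<otimes> a [^] i = a [^] i \<otimes> d" "d \<otimes> b [^] i = b [^] i \<otimes> d"
      using pow_mult_commute[of a d i] pow_mult_commute[of b d i] d by simp_all
    then show "a [^] i \<otimes> d [^] k = d [^] k \<otimes> a [^] i" "b [^] i \<otimes> d [^] k = d [^] k \<otimes> b [^] i"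
      by (simp_all add: pow_mult_commute)
  qed
  have ba1: "b \<otimes> a [^] (i::nat) = d [^] i \<otimes> (a [^] i \<otimes> b)" for i
  proof (induction i)
    case (Suc i)
    have "b \<otimes> a [^] Suc i = (b \<otimes> a [^] i) \<otimes> a" by (simp add: m_assoc)
    also have "\<dots> = d [^] i \<otimes> (a [^] i \<otimes> (d \<otimes> (a \<otimes> b)))" unfolding Suc by (simp add: m_assoc d(2))
    also have "\<dots> = d [^] i \<otimes> ((a [^] i \<otimes> d) \<otimes> (a \<otimes> b))" by (simp add: m_assoc)
    also have "\<dots> = d [^] i \<otimes> ((d \<otimes> a [^] i) \<otimes> (a \<otimes> b))" using da[of i 1] by simp
    finally show ?case by (simp add: m_assoc)
  qed simp
  have ba: "b [^] (j::nat) \<otimes> a [^] (i::nat) = d [^] (i * j) \<otimes> (a [^] i \<otimes> b [^] j)" for i j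
  proof (induction j)
    case (Suc j)
    have "b [^] Suc j \<otimes> a [^] i = b [^] j \<otimes> (d [^] i \<otimes> (a [^] i \<otimes> b))" by (simp add: m_assoc ba1)
    also have "\<dots> = (b [^] j \<otimes> d [^] i) \<otimes> (a [^] i \<otimes> b)" by (simp add: m_assoc)
    also have "\<dots> = d [^] i \<otimes> ((b [^] j \<otimes> a [^] i) \<otimes> b)" unfolding db by (simp add: m_assoc)
    also have "\<dots> = (d [^] i \<otimes> d [^] (i * j)) \<otimes> (a [^] i \<otimes> (b [^] j \<otimes> b))"
      unfolding Suc by (simp add: m_assoc)
    finally show ?case unfolding ddm by simp
  qed simp
  have f_mult: "f k i j \<otimes> f l m n = f (k + l + m * j) (i + m) (j + n)" for k i j l m n
  proof -
    have "f k i j \<otimes> f l m n = d [^] k \<otimes> (a [^] i \<otimes> ((b [^] j \<otimes> d [^] l) \<otimes> (a [^] m \<otimes> b [^] n)))"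
      by (simp add: f_def m_assoc)
    also have "\<dots> = d [^] k \<otimes> ((a [^] i \<otimes> d [^] l) \<otimes> ((b [^] j \<otimes> a [^] m) \<otimes> b [^] n))"
      unfolding db by (simp add: m_assoc)
    also have "\<dots> = d [^] k \<otimes> (d [^] l \<otimes> ((a [^] i \<otimes> d [^] (m * j)) \<otimes> (a [^] m \<otimes> (b [^] j \<otimes> b [^] n))))"
      unfolding da[of i l] ba by (simp add: m_assoc)
    also have "\<dots> = (d [^] k \<otimes> (d [^] l \<otimes> d [^] (m * j))) \<otimes> ((a [^] i \<otimes> a [^] m) \<otimes> (b [^] j \<otimes> b [^] n))"
      unfolding da by (simp add: m_assoc)
    finally show ?thesis by (simp add: f_def ddm nat_pow_mult add.assoc)
  qed
  have dp: "d [^] p = \<one>"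
  proof -
    have "b = d [^] p \<otimes> b" using ba1[of p] tors by simp
    then show ?thesis by (metis ab(2) d(1) l_one nat_pow_closed one_closed r_cancel)
  qed
  have "carrier G \<subseteq> {f k i j | k i j. True}"
  proof
    fix x assume "x \<in> carrier G"
    then have "x \<in> generate G {a, b}" using ab by simp
    then show "x \<in> {f k i j | k i j. True}"
    proof (induction x rule: generate.induct)
      case one
      have "\<one> = f 0 0 0" by (simp add: f_def)
      then show ?case by blast
    next
      case (incl h)
      have "a = f 0 1 0" "b = f 0 0 1" by (simp_all add: f_def)
      with incl show ?case by blast
    next
      case (inv h)
      have "x [^] (p - 1) \<otimes> x = x [^] p" if "x \<in> carrier G" for x
        using that tors(3) by (metis Suc_diff_1 nat_pow_Suc)
      then have "inv a = a [^] (p - 1)" "inv b = b [^] (p - 1)"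
        using tors by (simp_all add: inv_equality)
      then have "inv a = f 0 (p - 1) 0" "inv b = f 0 0 (p - 1)" by (simp_all add: f_def)
      with inv show ?case by blast
    next
      case (eng h1 h2)
      then show ?case using f_mult by blast
    qed
  qed
  moreover have "f k i j = f (k mod p) (i mod p) (j mod p)" for k i j
    unfolding f_def using tors dp by (simp add: nat_pow_mod)
  then have "{f k i j | k i j. True} \<subseteq> (\<lambda>(k, i, j). f k i j) ` ({..<p} \<times> {..<p} \<times> {..<p})"
    using tors(3) by (force simp: image_iff)
  ultimately show ?thesis by (meson finite_SigmaI finite_imageI finite_lessThan finite_subset)
qed

text \<open>The subgroup \<open>[G', G]\<close>, third term of the lower central series.\<close>

definition gamma3 :: "'a set"
  where "gamma3 = generate G {r \<otimes> s \<otimes> inv r \<otimes> inv s | r s. r \<in> derived G (carrier G) \<and> s \<in> carrier G}"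

lemma derived_normal: "derived G (carrier G) \<lhd> G"
  by (rule derived_self_is_normal)

lemma derived_carrier [simp]: "x \<in> derived G (carrier G) \<Longrightarrow> x \<in> carrier G"
  using derived_in_carrier[of "carrier G"] by blast

lemma comm_in_derived:
  "x \<in> carrier G \<Longrightarrow> y \<in> carrier G \<Longrightarrow> x \<otimes> y \<otimes> inv x \<otimes> inv y \<in> derived G (carrier G)"
  unfolding derived_def by (rule generate.incl) blast

lemma comm_in_gamma3:
  "r \<in> derived G (carrier G) \<Longrightarrow> s \<in> carrier G \<Longrightarrow> r \<otimes> s \<otimes> inv r \<otimes> inv s \<in> gamma3"
  unfolding gamma3_def by (rule generate.incl) blast

lemma gamma3_normal: "gamma3 \<lhd> G"
  unfolding gamma3_def
proof (rule normal_generateI)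
  fix h g assume "h \<in> {r \<otimes> s \<otimes> inv r \<otimes> inv s | r s. r \<in> derived G (carrier G) \<and> s \<in> carrier G}"
    and g: "g \<in> carrier G"
  then obtain r s where rs: "r \<in> derived G (carrier G)" "s \<in> carrier G" "h = r \<otimes> s \<otimes> inv r \<otimes> inv s"
    by blast
  have "g \<otimes> r \<otimes> inv g \<in> derived G (carrier G)"
    using derived_normal g rs by (intro normal.inv_op_closed2)
  moreover have "g \<otimes> h \<otimes> inv g =
      (g \<otimes> r \<otimes> inv g) \<otimes> (g \<otimes> s \<otimes> inv g) \<otimes> inv (g \<otimes> r \<otimes> inv g) \<otimes> inv (g \<otimes> s \<otimes> inv g)"
    using rs g by (simp add: inv_mult_group m_assoc)
  ultimately show "g \<otimes> h \<otimes> inv g \<in> {r \<otimes> s \<otimes> inv r \<otimes> inv s | r s. r \<in> derived G (carrier G) \<and> s \<in> carrier G}"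
    using rs(2) g by blast
qed auto

lemma gamma3_subset_derived: "gamma3 \<subseteq> derived G (carrier G)"
  unfolding gamma3_def
  by (rule generate_subgroup_incl[OF _ normal_imp_subgroup[OF derived_normal]]) (auto intro: comm_in_derived)

text \<open>Commutators are central modulo \<open>gamma3\<close>, so the quotient has the finite
  class-two normal form.\<close>

lemma finite_index_gamma3:
  assumes ab: "a \<in> carrier G" "b \<in> carrier G" "generate G {a, b} = carrier G"
    and tors: "a [^] (p::nat) = \<one>" "b [^] p = \<one>" "0 < p"
  shows "finite_index gamma3 G"
proof -
  interpret N: normal gamma3 G by (rule gamma3_normal)
  interpret Q: group "G Mod gamma3" by (rule N.factorgroup_is_group)
  let ?q = "\<lambda>x. gamma3 #> x"
  interpret q: group_hom G "G Mod gamma3" ?q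
    using N.r_coset_hom_Mod by (simp add: group_hom_def group_hom_axioms_def)
  have carrier: "carrier (G Mod gamma3) = ?q ` carrier G"
    by (auto simp: FactGroup_def RCOSETS_def)
  let ?d = "b \<otimes> a \<otimes> inv b \<otimes> inv a"
  have q_eq: "?q x = ?q y" if "x \<in> carrier G" "y \<in> carrier G" "x \<otimes> inv y \<in> gamma3" for x y
  proof -
    have "x = (x \<otimes> inv y) \<otimes> y" using that by (simp add: m_assoc)
    then have "x \<in> ?q y" using that(3) unfolding r_coset_def by blast
    then show ?thesis using repr_independence[OF _ that(2) N.subgroup_axioms] by simp
  qed
  have cent: "?q ?d \<otimes>\<^bsub>G Mod gamma3\<^esub> ?q s = ?q s \<otimes>\<^bsub>G Mod gamma3\<^esub> ?q ?d" if s: "s \<in> carrier G" for s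
  proof -
    have "?d \<otimes> s \<otimes> inv ?d \<otimes> inv s \<in> gamma3" using ab s by (intro comm_in_gamma3 comm_in_derived)
    then have "?d \<otimes> s \<otimes> inv (s \<otimes> ?d) \<in> gamma3" using ab s by (simp add: inv_mult_group m_assoc)
    then have "?q (?d \<otimes> s) = ?q (s \<otimes> ?d)" using ab s by (intro q_eq) auto
    then show ?thesis using ab s by simp
  qed
  have "finite (carrier (G Mod gamma3))"
  proof (rule Q.finite_two_generated_class_two)
    show "generate (G Mod gamma3) {?q a, ?q b} = carrier (G Mod gamma3)"
      using q.generate_img[of "{a, b}"] ab by (simp add: carrier)
    show "?q a [^]\<^bsub>G Mod gamma3\<^esub> p = \<one>\<^bsub>G Mod gamma3\<^esub>" "?q b [^]\<^bsub>G Mod gamma3\<^esub> p = \<one>\<^bsub>G Mod gamma3\<^esub>"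
      using q.hom_nat_pow[of a p] q.hom_nat_pow[of b p] ab tors q.hom_one by simp_all
    have "?d \<otimes> (a \<otimes> b) = b \<otimes> a" using ab by (simp add: m_assoc)
    then show "?q b \<otimes>\<^bsub>G Mod gamma3\<^esub> ?q a = ?q ?d \<otimes>\<^bsub>G Mod gamma3\<^esub> (?q a \<otimes>\<^bsub>G Mod gamma3\<^esub> ?q b)"
      using ab q.hom_mult by (metis inv_closed m_closed)
    show "?q a \<in> carrier (G Mod gamma3)" "?q b \<in> carrier (G Mod gamma3)" "?q ?d \<in> carrier (G Mod gamma3)"
      by (rule q.hom_closed, use ab in simp)+
    show "?q ?d \<otimes>\<^bsub>G Mod gamma3\<^esub> ?q a = ?q a \<otimes>\<^bsub>G Mod gamma3\<^esub> ?q ?d"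
      "?q ?d \<otimes>\<^bsub>G Mod gamma3\<^esub> ?q b = ?q b \<otimes>\<^bsub>G Mod gamma3\<^esub> ?q ?d"
      by (rule cent[OF ab(1)], rule cent[OF ab(2)])
  qed (rule tors(3))
  then show ?thesis by (simp add: finite_index_def FactGroup_def)
qed

end

section \<open>The Gupta--Sidki group as a branch group\<close>

locale gupta_sidki_group = faithful_self_similar_group +
  fixes a b :: 'a
  assumes p_prime: "Factorial_Ring.prime p" and p_odd: "odd p"
    and a_closed [simp]: "a \<in> carrier G" and b_closed [simp]: "b \<in> carrier G"
    and generate_ab: "generate G {a, b} = carrier G"
    and act_a [simp]: "j < p \<Longrightarrow> act a j = Suc j mod p"
    and sec_a [simp]: "j < p \<Longrightarrow> sec a j = \<one>"
    and act_b [simp]: "j < p \<Longrightarrow> act b j = j"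
    and sec_b: "j < p \<Longrightarrow>
      sec b j = (if j = 0 then a else if j = 1 then inv a else if j = p - 1 then b else \<one>)"
begin

abbreviation "G' \<equiv> derived G (carrier G)"

lemma p_ge_3: "3 \<le> p"
  using prime_ge_2_nat[OF p_prime] p_odd by (cases "p = 2") auto

lemma p_gt [simp]: "0 < p" "Suc 0 < p" "p - Suc 0 < p"
  using p_ge_3 by auto

lemma p_minus_one_neq [simp]: "p - Suc 0 \<noteq> 0" "0 \<noteq> p - Suc 0" "p - Suc 0 \<noteq> Suc 0" "Suc 0 \<noteq> p - Suc 0"
  using p_ge_3 by auto

lemma sec_b_simps [simp]: "sec b 0 = a" "sec b (Suc 0) = inv a" "sec b (p - Suc 0) = b"
  "1 < j \<Longrightarrow> j < p - 1 \<Longrightarrow> sec b j = \<one>"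
  using p_ge_3 by (simp_all add: sec_b)

lemma generate_abI:
  assumes "subgroup H G" "a \<in> H" "b \<in> H" shows "H = carrier G"
  using generate_subgroup_incl[of "{a, b}" H] assms generate_ab subgroup.subset by blast

lemma act_a_pow [simp]: "j < p \<Longrightarrow> act (a [^] n) j = (j + n) mod p"
  by (induction n) (auto simp: mod_Suc)

lemma sec_a_pow [simp]: "j < p \<Longrightarrow> sec (a [^] (n::nat)) j = \<one>"
  by (induction n) auto

lemma a_pow_p [simp]: "a [^] p = \<one>"
  by (rule trivial_if_trivial_sections) auto

text \<open>The sections of \<open>b^p\<close> are \<open>p\<close>-th powers of \<open>a\<close>,
  \<open>a^-1\<close> and \<open>1\<close>, all trivial, except for \<open>b^p\<close> itself at
  \<open>p - 1\<close>. Hence it fixes all words, by induction on their length.\<close>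

lemma b_pow_p [simp]: "b [^] p = \<one>"
proof (rule faithful)
  have act: "act (b [^] n) j = j" if "j < p" for n :: nat and j using that by (induction n) auto
  have sec: "sec (b [^] n) j = sec b j [^] n" if "j < p" for n :: nat and j
    using that by (induction n) (auto simp: act)
  have inv_a: "inv a [^] p = \<one>" by (simp add: nat_pow_inv)
  show "actw (b [^] p) v = v" if "v \<in> words n" for n v
    using that
  proof (induction n arbitrary: v)
    case (Suc n)
    then obtain j u where v: "v = j # u" "j < p" "u \<in> words n" by (auto simp: words_Suc_iff)
    have "sec (b [^] p) j = (if j = p - 1 then b [^] p else \<one>)"
      using v(2) inv_a p_ge_3 by (simp add: sec sec_b del: nat_pow_Suc)
    then show ?case using v Suc.IH act by simp
  qed simp
qed simp

section \<open>Rotation of the first level\<close>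

definition rot :: "'a \<Rightarrow> nat"
  where "rot g = act g 0"

text \<open>Both generators act on the letters as powers of one \<open>p\<close>-cycle.\<close>

lemma act_rot:
  assumes "g \<in> carrier G" "j < p" shows "act g j = (j + rot g) mod p"
proof -
  let ?R = "{g \<in> carrier G. \<exists>n. \<forall>j<p. act g j = (j + n) mod p}"
  have "subgroup ?R G"
  proof (rule subgroupI)
    show "?R \<noteq> {}" by (auto intro!: exI[of _ \<one>] exI[of _ 0])
    show "inv g \<in> ?R" if "g \<in> ?R" for g
    proof -
      obtain n where g: "g \<in> carrier G" "\<And>j. j < p \<Longrightarrow> act g j = (j + n) mod p"
        using \<open>g \<in> ?R\<close> by blast
      have "act (inv g) j = (j + (p - n mod p)) mod p" if j: "j < p" for j
      proof -
        let ?i = "(j + (p - n mod p)) mod p"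
        have "act g ?i = (?i + n) mod p" by (rule g(2)) simp
        also have "\<dots> = (j + (p - n mod p) + n mod p) mod p" by (simp add: mod_simps)
        also have "j + (p - n mod p) + n mod p = j + p" using mod_less_divisor[OF p_gt(1), of n] by linarith
        also have "(j + p) mod p = j" using j by simp
        finally have "act g ?i = j" .
        then show ?thesis using act_inv_cancel(1)[OF g(1), of ?i] by simp
      qed
      then show ?thesis using g by blast
    qed
    show "g \<otimes> h \<in> ?R" if "g \<in> ?R" "h \<in> ?R" for g h
    proof -
      obtain n m where gh: "g \<in> carrier G" "\<And>j. j < p \<Longrightarrow> act g j = (j + n) mod p"
        "h \<in> carrier G" "\<And>j. j < p \<Longrightarrow> act h j = (j + m) mod p"
        using \<open>g \<in> ?R\<close> \<open>h \<in> ?R\<close> by blast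
      have "act (g \<otimes> h) j = (j + (n + m)) mod p" if "j < p" for j
        using gh that by (simp add: mod_simps add.assoc)
      then show ?thesis using gh by blast
    qed
  qed auto
  moreover have "a \<in> ?R" by (auto intro!: exI[of _ 1])
  moreover have "b \<in> ?R" by (auto intro!: exI[of _ 0])
  ultimately have "?R = carrier G" by (rule generate_abI)
  then obtain n where n: "\<forall>j<p. act g j = (j + n) mod p" using assms(1) by blast
  then have "rot g = n mod p" by (simp add: rot_def)
  with n assms(2) show ?thesis by (simp add: mod_simps)
qed

lemma rot_less [simp]: "g \<in> carrier G \<Longrightarrow> rot g < p"
  by (simp add: rot_def)

lemma rot_mult: "g \<in> carrier G \<Longrightarrow> h \<in> carrier G \<Longrightarrow> rot (g \<otimes> h) = (rot g + rot h) mod p"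
  using act_rot[of h "rot g"] by (simp add: rot_def)

lemma level_stab_rot: "g \<in> level_stab 1 \<longleftrightarrow> g \<in> carrier G \<and> rot g = 0"
proof
  show "g \<in> carrier G \<and> rot g = 0" if "g \<in> level_stab 1"
    using that level_stab_1 by (simp add: rot_def)
  show "g \<in> level_stab 1" if "g \<in> carrier G \<and> rot g = 0"
    using that level_stab_1 by (simp add: act_rot)
qed

lemma level_stab_1D: "g \<in> level_stab 1 \<Longrightarrow> g \<in> carrier G" "g \<in> level_stab 1 \<Longrightarrow> j < p \<Longrightarrow> act g j = j"
  by (simp_all add: level_stab_1[unfolded One_nat_def])

lemma b_stab: "b \<in> level_stab 1"
  by (simp add: level_stab_1[unfolded One_nat_def])

lemma derived_le_level_stab: "G' \<subseteq> level_stab 1"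
proof (rule derived_le_normal[OF normal_level_stab _ generate_ab])
  have stab: "x \<in> level_stab 1 \<Longrightarrow> inv x \<in> level_stab 1"
      "x \<in> level_stab 1 \<Longrightarrow> y \<in> level_stab 1 \<Longrightarrow> x \<otimes> y \<in> level_stab 1"
      "g \<in> carrier G \<Longrightarrow> x \<in> level_stab 1 \<Longrightarrow> g \<otimes> x \<otimes> inv g \<in> level_stab 1" for x y g
    using subgroup.m_inv_closed[OF subgroup_level_stab] subgroup.m_closed[OF subgroup_level_stab]
      normal.inv_op_closed2[OF normal_level_stab] by blast+
  have "b \<otimes> (a \<otimes> inv b \<otimes> inv a) \<in> level_stab 1" "a \<otimes> b \<otimes> inv a \<otimes> inv b \<in> level_stab 1"
    using b_stab by (intro stab; simp)+
  then have "b \<otimes> a \<otimes> inv b \<otimes> inv a \<in> level_stab 1" "a \<otimes> b \<otimes> inv a \<otimes> inv b \<in> level_stab 1"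
    by (simp_all add: m_assoc)
  moreover have "\<one> \<in> level_stab 1" using subgroup.one_closed[OF subgroup_level_stab] .
  ultimately show "x \<otimes> y \<otimes> inv x \<otimes> inv y \<in> level_stab 1" if "x \<in> {a, b}" "y \<in> {a, b}" for x y
    using that by (auto simp: m_assoc)
qed simp

lemma derived_stab: "x \<in> G' \<Longrightarrow> x \<in> level_stab 1"
  using derived_le_level_stab by blast

text \<open>The sections of \<open>bconj m\<close> are those of \<open>b\<close>, shifted cyclically
  by \<open>m\<close>. Products of such conjugates provide stabilizer elements with prescribed
  sections.\<close>

definition bconj :: "nat \<Rightarrow> 'a"
  where "bconj m = a [^] m \<otimes> b \<otimes> inv (a [^] m)"

lemma sec_inv_a_pow: "j < p \<Longrightarrow> sec (inv (a [^] (n::nat))) j = \<one>"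
  using sec_inv[of "a [^] n" "act (inv (a [^] n)) j"] by simp

lemma conj_a_pow:
  assumes "x \<in> level_stab 1"
  shows "a [^] (m::nat) \<otimes> x \<otimes> inv (a [^] m) \<in> level_stab 1"
    and "j < p \<Longrightarrow> sec (a [^] m \<otimes> x \<otimes> inv (a [^] m)) j = sec x ((j + m) mod p)"
proof -
  show "a [^] m \<otimes> x \<otimes> inv (a [^] m) \<in> level_stab 1"
    using assms by (intro normal.inv_op_closed2[OF normal_level_stab]) auto
  show "j < p \<Longrightarrow> sec (a [^] m \<otimes> x \<otimes> inv (a [^] m)) j = sec x ((j + m) mod p)"
    using level_stab_1D[OF assms] by (simp add: sec_inv_a_pow)
qed

lemma bconj_closed [simp]: "bconj m \<in> carrier G"
  by (simp add: bconj_def)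

lemma bconj_stab: "bconj m \<in> level_stab 1"
  unfolding bconj_def by (rule conj_a_pow(1)[OF b_stab])

lemma act_bconj [simp]: "j < p \<Longrightarrow> act (bconj m) j = j"
  by (rule level_stab_1D(2)[OF bconj_stab])

lemma sec_bconj: "j < p \<Longrightarrow> sec (bconj m) j = sec b ((j + m) mod p)"
  unfolding bconj_def by (rule conj_a_pow(2)[OF b_stab])

lemma bconj_diff_derived: "bconj m \<otimes> inv (bconj n) \<in> G'"
proof -
  interpret subgroup G' G by (rule normal_imp_subgroup[OF derived_normal])
  have "(a [^] m \<otimes> b \<otimes> inv (a [^] m) \<otimes> inv b) \<otimes> inv (a [^] n \<otimes> b \<otimes> inv (a [^] n) \<otimes> inv b) \<in> G'"
    by (intro m_closed m_inv_closed comm_in_derived) auto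
  then show ?thesis by (simp add: bconj_def inv_mult_group m_assoc)
qed

lemma level_stab_1_hom: "j < p \<Longrightarrow> group_hom (G\<lparr>carrier := level_stab 1\<rparr>) G (\<lambda>g. sec g j)"
  using sec_hom subgroup_imp_group[OF subgroup_level_stab]
  by (simp add: group_hom_def group_hom_axioms_def)

lemma subgroup_sec_image:
  assumes "subgroup H G" "H \<subseteq> level_stab 1" "j < p"
  shows "subgroup ((\<lambda>g. sec g j) ` H) G"
  using group_hom.subgroup_img_is_subgroup[OF level_stab_1_hom[OF assms(3)]]
    subgroup_incl[OF assms(1) subgroup_level_stab assms(2)] by blast

text \<open>At the letter \<open>0\<close>, \<open>bconj 0 (bconj 1)^-1\<close> has section
  \<open>a^2\<close> and \<open>bconj (p - 1) (bconj 0)^-1\<close> has section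
  \<open>b a^-1\<close>. Since \<open>p\<close> is odd, \<open>a\<close> is a power of
  \<open>a^2\<close>, so these two sections generate the group. Conjugation by a power of
  \<open>a\<close> replaces \<open>0\<close> by \<open>j\<close>.\<close>

lemma sec_derived_surj:
  assumes j: "j < p" and x: "x \<in> carrier G"
  obtains g where "g \<in> G'" "g \<in> level_stab 1" "sec g j = x"
proof -
  let ?H = "(\<lambda>g. sec g 0) ` G'"
  have sub: "subgroup ?H G"
    by (rule subgroup_sec_image[OF normal_imp_subgroup[OF derived_normal] derived_le_level_stab p_gt(1)])
  have secs: "sec (bconj m \<otimes> inv (bconj n)) 0 = sec b (m mod p) \<otimes> inv (sec b (n mod p))" for m n
    using sec_stab_inv[OF bconj_stab, of 0 n] by (simp add: sec_bconj)
  have "sec (bconj 0 \<otimes> inv (bconj 1)) 0 \<in> ?H" "sec (bconj (p - 1) \<otimes> inv (bconj 0)) 0 \<in> ?H"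
    using bconj_diff_derived by blast+
  then have 1: "a \<otimes> a \<in> ?H" "b \<otimes> inv a \<in> ?H"
    unfolding secs using p_ge_3 by simp_all
  \<comment> \<open>Now \<open>2 (k + 1) = p + 1\<close>, so
    \<open>(a^2)^(k + 1) = a\<close>.\<close>
  obtain k where k: "p = 2 * k + 1" using p_odd by (auto elim: oddE)
  have "(a \<otimes> a) [^] (Suc k) \<in> ?H" using 1 subgroup_int_pow_closed[OF sub, of _ "int (Suc k)"]
    by (simp only: int_pow_int)
  moreover have "(a \<otimes> a) [^] (Suc k) = a"
  proof -
    have "(a \<otimes> a) [^] (Suc k) = (a [^] (2::nat)) [^] (Suc k)" by (simp add: numeral_2_eq_2)
    also have "\<dots> = a [^] Suc p" unfolding nat_pow_pow[OF a_closed] by (simp only: k) (simp add: algebra_simps)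
    finally show ?thesis by simp
  qed
  ultimately have a: "a \<in> ?H" by simp
  then have "b \<otimes> inv a \<otimes> a \<in> ?H" using 1 subgroup.m_closed[OF sub] by blast
  then have "b \<in> ?H" by (simp add: m_assoc)
  then have "?H = carrier G" using generate_abI[OF sub a] by blast
  then obtain g where g: "g \<in> G'" "sec g 0 = x" using x by (metis (no_types, lifting) imageE)
  let ?g = "a [^] (p - j) \<otimes> g \<otimes> inv (a [^] (p - j))"
  have gs: "g \<in> level_stab 1" using g derived_le_level_stab by blast
  have "sec ?g j = x" using conj_a_pow(2)[OF gs j, of "p - j"] g j by simp
  moreover have "?g \<in> level_stab 1" by (rule conj_a_pow(1)[OF gs])
  moreover have "?g \<in> G'" using g by (intro normal.inv_op_closed2[OF derived_normal]) auto
  ultimately show thesis using that by blast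
qed

lemma liftsI_1:
  assumes "j < p" "y \<in> level_stab 1" "sec y j = x" "\<And>i. i < p \<Longrightarrow> i \<noteq> j \<Longrightarrow> sec y i = \<one>"
  shows "lifts [j] x y"
proof (rule liftsI[where n = 1])
  fix u assume "u \<in> words 1" "u \<noteq> [j]"
  then obtain i where "u = [i]" "i < p" "i \<noteq> j" using words_1[of u] by blast
  with assms(4) show "secw y u = \<one>" by simp
qed (use assms in auto)

lemma liftsD_1:
  assumes "lifts [j] x y" "j < p"
  shows "y \<in> level_stab 1" "sec y j = x" "i < p \<Longrightarrow> i \<noteq> j \<Longrightarrow> sec y i = \<one>"
  using liftsD(1,3)[OF assms(1), of 1] liftsD(4)[OF assms(1), of 1 "[i]"] assms(2) by simp_all

text \<open>The commutator of \<open>g\<close> and \<open>h\<close> has only one nontrivial section,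
  the commutator of \<open>sec g 0\<close> and \<open>sec h 0\<close>. The liftable elements of
  \<open>G'\<close> form a normal subgroup, since every conjugation is realised by a section of a
  stabilizer element, and a normal subgroup containing the commutator of two generators contains
  \<open>G'\<close>.\<close>

lemma lifts_derived_0_if:
  assumes g: "g \<in> level_stab 1" and h: "h \<in> level_stab 1"
    and comm: "\<And>i. 0 < i \<Longrightarrow> i < p \<Longrightarrow> sec g i \<otimes> sec h i = sec h i \<otimes> sec g i"
    and gen: "\<And>H. subgroup H G \<Longrightarrow> sec g 0 \<in> H \<Longrightarrow> sec h 0 \<in> H \<Longrightarrow> a \<in> H \<and> b \<in> H"
    and y: "y \<in> G'"
  shows "\<exists>z\<in>G'. lifts [0] y z"
proof -
  let ?Y = "{y \<in> G'. \<exists>z\<in>G'. lifts [0] y z}"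
  interpret D: normal G' G by (rule derived_normal)
  have w: "[0] \<in> words 1" by simp
  have sub: "subgroup ?Y G"
  proof (rule subgroupI)
    show "?Y \<noteq> {}" using D.one_closed lifts_one[OF w] by blast
    show "inv x \<in> ?Y" if "x \<in> ?Y" for x using that lifts_inv[OF _ w] D.m_inv_closed by blast
    show "x \<otimes> x' \<in> ?Y" if "x \<in> ?Y" "x' \<in> ?Y" for x x' using that lifts_mult[OF _ _ w] D.m_closed by blast
  qed auto
  have "k \<otimes> x \<otimes> inv k \<in> ?Y" if k: "k \<in> carrier G" and x: "x \<in> ?Y" for k x
  proof -
    obtain z where z: "z \<in> G'" "lifts [0] x z" "x \<in> G'" using x by blast
    obtain s where s: "s \<in> level_stab 1" "sec s 0 = inv k" using sec_derived_surj[of 0 "inv k"] k by auto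
    have "lifts (actw s [0]) (inv (secw s [0]) \<otimes> x \<otimes> secw s [0]) (inv s \<otimes> z \<otimes> s)"
      using z s level_stab_1D by (intro lifts_conj[OF _ w]) auto
    then have "lifts [0] (k \<otimes> x \<otimes> inv k) (inv s \<otimes> z \<otimes> s)"
      using s level_stab_1D(2)[OF s(1)] k by simp
    moreover have "inv s \<otimes> z \<otimes> s \<in> G'" using s z level_stab_1D by (intro D.inv_op_closed1) auto
    moreover have "k \<otimes> x \<otimes> inv k \<in> G'" using k z by (intro D.inv_op_closed2) auto
    ultimately show ?thesis by blast
  qed
  then have norm: "?Y \<lhd> G" using sub by (simp add: normal_inv_iff)
  let ?u = "sec g 0" and ?v = "sec h 0"
  have gc: "g \<in> carrier G" "h \<in> carrier G" using g h level_stab_1D by auto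
  then have uv: "?u \<in> carrier G" "?v \<in> carrier G" by simp_all
  note [simp] = level_stab_1D(2)[OF g] level_stab_1D(2)[OF h] gc
  have acts: "act (inv g) i = i" "act (inv h) i = i" if "i < p" for i
    using that act_inv_cancel(1)[of g i] act_inv_cancel(1)[of h i] by simp_all
  have "lifts [0] (?u \<otimes> ?v \<otimes> inv ?u \<otimes> inv ?v) (g \<otimes> h \<otimes> inv g \<otimes> inv h)"
  proof (rule liftsI_1)
    show "g \<otimes> h \<otimes> inv g \<otimes> inv h \<in> level_stab 1"
      using g h by (intro subgroup.m_closed[OF subgroup_level_stab] subgroup.m_inv_closed[OF subgroup_level_stab])
    show "sec (g \<otimes> h \<otimes> inv g \<otimes> inv h) 0 = ?u \<otimes> ?v \<otimes> inv ?u \<otimes> inv ?v"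
      using sec_stab_inv[OF g] sec_stab_inv[OF h] by (simp add: acts)
    show "sec (g \<otimes> h \<otimes> inv g \<otimes> inv h) i = \<one>" if "i < p" "i \<noteq> 0" for i
    proof -
      have "sec (g \<otimes> h \<otimes> inv g \<otimes> inv h) i = sec g i \<otimes> sec h i \<otimes> inv (sec g i) \<otimes> inv (sec h i)"
        using sec_stab_inv[OF g] sec_stab_inv[OF h] that by (simp add: acts)
      also have "sec g i \<otimes> sec h i = sec h i \<otimes> sec g i" using comm that by simp
      finally show ?thesis using that by (simp add: m_assoc)
    qed
  qed simp
  then have *: "?u \<otimes> ?v \<otimes> inv ?u \<otimes> inv ?v \<in> ?Y" using comm_in_derived gc uv by blast
  have **: "?v \<otimes> ?u \<otimes> inv ?v \<otimes> inv ?u \<in> ?Y"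
    using subgroup.m_inv_closed[OF sub *] uv by (simp add: inv_mult_group m_assoc)
  have "G' \<subseteq> ?Y"
  proof (rule derived_le_normal[OF norm])
    show "{?u, ?v} \<subseteq> carrier G" using uv by simp
    have "subgroup (generate G {?u, ?v}) G" using uv by (intro generate_is_subgroup) auto
    then show "generate G {?u, ?v} = carrier G"
      using gen[of "generate G {?u, ?v}"] generate_abI by (blast intro: generate.incl)
    show "x \<otimes> y \<otimes> inv x \<otimes> inv y \<in> ?Y" if "x \<in> {?u, ?v}" "y \<in> {?u, ?v}" for x y
      using that * ** subgroup.one_closed[OF sub] uv by (elim insertE emptyE) (simp_all add: m_assoc)
  qed
  with y show ?thesis by blast
qed

lemma lifts_derived_0:
  assumes "y \<in> G'" shows "\<exists>z\<in>G'. lifts [0] y z"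
proof (cases "p = 3")
  case True
  \<comment> \<open>Here all supports of the conjugates of \<open>b\<close> overlap, and the pair of conjugates used for \<open>p \<ge> 5\<close> fails.\<close>
  have sb: "sec (bconj m) j = sec b ((j + m) mod 3)" if "j < 3" for j m
    using that by (simp add: sec_bconj True)
  have b3: "sec b 0 = a" "sec b 1 = inv a" "sec b 2 = b" using sec_b True by simp_all
  \<comment> \<open>In each product \<open>a\<close> cancels against \<open>a^-1\<close> in one
    coordinate, at the letter \<open>1\<close> for \<open>?g\<close> and at \<open>2\<close> for
    \<open>?h\<close>, so away from \<open>0\<close> one of the two sections is always
    trivial.\<close>
  let ?g = "bconj 0 \<otimes> bconj 2" and ?h = "bconj 2 \<otimes> bconj 1"
  have g: "sec ?g 0 = a \<otimes> b" "sec ?g 1 = \<one>" "sec ?g 2 = b \<otimes> inv a"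
    and h: "sec ?h 0 = b \<otimes> inv a" "sec ?h 1 = a \<otimes> b" "sec ?h 2 = \<one>"
    using True by (simp_all add: sb b3 One_nat_def[symmetric] del: One_nat_def)
  show ?thesis
  proof (rule lifts_derived_0_if[of ?g ?h])
    show "sec ?g i \<otimes> sec ?h i = sec ?h i \<otimes> sec ?g i" if "0 < i" "i < p" for i
    proof -
      have "i = 1 \<or> i = 2" using that True by auto
      then show ?thesis using g h by auto
    qed
    fix H assume H: "subgroup H G" "sec ?g 0 \<in> H" "sec ?h 0 \<in> H"
    interpret H: subgroup H G by fact
    have ab: "a \<otimes> b \<in> H" "b \<otimes> inv a \<in> H" using H g h by simp_all
    then have "((a \<otimes> b) \<otimes> (b \<otimes> inv a)) \<otimes> (a \<otimes> b) \<in> H" by simp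
    moreover have "((a \<otimes> b) \<otimes> (b \<otimes> inv a)) \<otimes> (a \<otimes> b) = a \<otimes> (b [^] (3::nat))"
      by (simp add: m_assoc numeral_3_eq_3)
    ultimately have aH: "a \<in> H" using b_pow_p True by simp
    then have "(b \<otimes> inv a) \<otimes> a \<in> H" using ab by blast
    then show "a \<in> H \<and> b \<in> H" using aH by (simp add: m_assoc)
  qed (use assms bconj_stab subgroup.m_closed[OF subgroup_level_stab] in auto)
next
  case False
  then have p: "5 \<le> p" using p_ge_3 p_odd by (cases "p = 4") auto
  show ?thesis
  \<comment> \<open>The sections of these two conjugates are both nontrivial only at
    \<open>0\<close>, where they are \<open>a\<close> and \<open>b\<close>, and at \<open>1\<close>,
    where they are \<open>a^-1\<close> and \<open>a\<close>.\<close>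
  proof (rule lifts_derived_0_if[of "bconj 0" "bconj (p - 1)"])
    show "sec (bconj 0) i \<otimes> sec (bconj (p - 1)) i = sec (bconj (p - 1)) i \<otimes> sec (bconj 0) i"
      if "0 < i" "i < p" for i
    proof -
      have "(i + (p - 1)) mod p = i - 1" using that by (simp add: mod_if)
      then have "sec (bconj (p - 1)) i = sec b (i - 1)" "sec (bconj 0) i = sec b i"
        using that by (simp_all add: sec_bconj)
      moreover have "i = 1 \<or> i = 2 \<or> i = p - 1 \<or> (2 < i \<and> i < p - 1)" using that by linarith
      ultimately show ?thesis using that p by (auto simp: sec_b)
    qed
    show "a \<in> H \<and> b \<in> H" if "subgroup H G" "sec (bconj 0) 0 \<in> H" "sec (bconj (p - 1)) 0 \<in> H" for H
      using that p by (simp add: sec_bconj)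
  qed (use assms bconj_stab in auto)
qed

text \<open>The lift at the letter \<open>0\<close> lies in \<open>G'\<close> again, which allows
  iteration over the levels; conjugation by \<open>a^(p - j)\<close> moves its support from
  \<open>0\<close> to \<open>j\<close>.\<close>

lemma lifts_derived:
  assumes "v \<in> words n" "y \<in> G'" shows "\<exists>z\<in>G'. lifts v y z"
  using assms
proof (induction n arbitrary: v)
  case 0
  then have "lifts v y y" by (auto simp: lifts_def level_stab_def)
  with 0 show ?case by blast
next
  case (Suc n)
  then obtain j u where v: "v = j # u" "j < p" "u \<in> words n" by (auto simp: words_Suc_iff)
  obtain x where x: "x \<in> G'" "lifts u y x" using Suc.IH[OF v(3) Suc.prems(2)] by blast
  obtain z where z: "z \<in> G'" "lifts [0] x z" using lifts_derived_0[OF x(1)] by blast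
  have zs: "z \<in> level_stab 1" using liftsD_1[OF z(2)] by simp
  let ?z = "a [^] (p - j) \<otimes> z \<otimes> inv (a [^] (p - j))"
  have "?z \<in> G'" using z by (intro normal.inv_op_closed2[OF derived_normal]) auto
  moreover have "lifts [j] x ?z"
  proof (rule liftsI_1[OF v(2) conj_a_pow(1)[OF zs]])
    show "sec ?z j = x" using conj_a_pow(2)[OF zs v(2), of "p - j"] liftsD_1(2)[OF z(2)] v(2) by simp
    fix i assume i: "i < p" "i \<noteq> j"
    have "(i + (p - j)) mod p \<noteq> 0"
    proof (cases "i < j")
      case True
      then have "i + (p - j) < p" "0 < i + (p - j)" using v(2) by auto
      then show ?thesis using mod_less[of "i + (p - j)" p] by linarith
    next
      case False
      then have *: "i + (p - j) = p + (i - j)" "0 < i - j" using v(2) i(2) by auto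
      have "(i + (p - j)) mod p = (i - j) mod p" unfolding *(1) by (rule mod_add_self1)
      also have "\<dots> = i - j" using i(1) by (intro mod_less) linarith
      finally show ?thesis using *(2) by linarith
    qed
    then show "sec ?z i = \<one>" using conj_a_pow(2)[OF zs i(1), of "p - j"] liftsD_1(3)[OF z(2)] by simp
  qed
  then have "lifts ([j] @ u) y ?z" using x(2) v by (intro lifts_append[where m = 1 and n = n]) auto
  ultimately show ?case using v by auto
qed

section \<open>Level transitivity and nontrivial normal subgroups\<close>

lemma transitive_words:
  assumes "u \<in> words n" "v \<in> words n"
  obtains g where "g \<in> carrier G" "actw g u = v"
proof -
  have "\<exists>g\<in>carrier G. actw g u = v" using assms
  proof (induction n arbitrary: u v)
    case (Suc n)
    then obtain i j s t where uv: "u = i # s" "v = j # t" "i < p" "j < p" "s \<in> words n" "t \<in> words n"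
      by (auto simp: words_Suc_iff)
    obtain g where g: "g \<in> carrier G" "actw g s = t" using Suc.IH uv by blast
    obtain h where h: "h \<in> level_stab 1" "sec h j = g" using sec_derived_surj[OF uv(4) g(1)] .
    \<comment> \<open>The power \<open>a^(p - i + j)\<close> sends the letter \<open>i\<close> to
      \<open>j\<close>; then \<open>h\<close> fixes \<open>j\<close> and carries \<open>s\<close> to
      \<open>t\<close> below it.\<close>
    have "(i + (p - i + j)) mod p = j" using uv by simp
    then have "act (a [^] (p - i + j)) i = j" using uv by simp
    then have "actw (a [^] (p - i + j) \<otimes> h) u = v"
      using uv g h level_stab_1D[OF h(1)] by simp
    moreover have "a [^] (p - i + j) \<otimes> h \<in> carrier G" using level_stab_1D[OF h(1)] by simp
    ultimately show ?case by blast
  qed (auto intro: bexI[of _ \<one>])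
  then show thesis using that by blast
qed

lemma level_stab_closed:
  "x \<in> level_stab n \<Longrightarrow> y \<in> level_stab n \<Longrightarrow> x \<otimes> y \<in> level_stab n"
  "x \<in> level_stab n \<Longrightarrow> inv x \<in> level_stab n"
  by (rule subgroup.m_closed[OF subgroup_level_stab] subgroup.m_inv_closed[OF subgroup_level_stab];
      assumption)+

lemma secw_stab_mult:
  assumes "x \<in> level_stab n" "y \<in> level_stab n" "u \<in> words n"
  shows "secw (x \<otimes> y) u = secw x u \<otimes> secw y u"
  using assms level_stabD(1)[OF assms(1)] level_stabD(1)[OF assms(2)] level_stabD(2)[OF assms(1,3)] by simp

lemma sec_stab_mult:
  assumes "x \<in> level_stab 1" "y \<in> level_stab 1" "j < p"
  shows "sec (x \<otimes> y) j = sec x j \<otimes> sec y j"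
  using secw_stab_mult[OF assms(1,2), of "[j]"] assms(3) by simp

lemma level_stab_Suc:
  assumes "g \<in> carrier G" "\<And>j. j < p \<Longrightarrow> act g j = j" "\<And>j. j < p \<Longrightarrow> sec g j \<in> level_stab n"
  shows "g \<in> level_stab (Suc n)"
proof -
  have "actw g u = u" if u: "u \<in> words (Suc n)" for u
  proof -
    obtain j v where "u = j # v" "j < p" "v \<in> words n" using u by (auto simp: words_Suc_iff)
    then show ?thesis using assms(2) level_stabD(2)[OF assms(3)] by simp
  qed
  then show ?thesis using assms(1) by (simp add: level_stab_def)
qed

text \<open>
  If \<open>R\<close> is supported below \<open>u\<close>, then \<open>y R y\<^sup>-\<^sup>1\<close> is supported below another vertex, so the commutator
  of \<open>y R y\<^sup>-\<^sup>1 R\<^sup>-\<^sup>1\<close> with an element supported below \<open>u\<close> only sees the factor \<open>R\<^sup>-\<^sup>1\<close>.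
\<close>

lemma normal_contains_lifted_commutators:
  assumes B: "B \<lhd> G" and y: "y \<in> B" and u: "u \<in> words m" "actw y u \<noteq> u"
    and rs: "r \<in> G'" "s \<in> carrier G"
  shows "\<exists>z\<in>B. lifts (u @ [0]) (r \<otimes> s \<otimes> inv r \<otimes> inv s) z"
proof -
  interpret B: normal B G by fact
  interpret D: normal G' G by (rule derived_normal)
  have yc: "y \<in> carrier G" using y by simp
  \<comment> \<open>The inverse of \<open>r\<close> is lifted because the factor of \<open>W\<close>
    that survives at \<open>u\<close> is the inverse of \<open>R'\<close>.\<close>
  obtain R' where R': "R' \<in> G'" "lifts [0] (inv r) R'" using lifts_derived_0[of "inv r"] rs by blast
  obtain R where R: "R \<in> G'" "lifts u R' R" using lifts_derived[OF u(1) R'(1)] by blast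
  \<comment> \<open>Only elements of \<open>G'\<close> are known to lift to \<open>u\<close>. The
    arbitrary \<open>s\<close> therefore enters as a section of some \<open>g\<close> in
    \<open>G'\<close>; this costs one level and accounts for the vertex
    \<open>u @ [0]\<close>.\<close>
  obtain g where g: "g \<in> G'" "g \<in> level_stab 1" "sec g 0 = s" using sec_derived_surj[OF p_gt(1) rs(2)] .
  obtain T where T: "T \<in> G'" "lifts u g T" using lifts_derived[OF u(1) g(1)] by blast
  have c: "R' \<in> carrier G" "R \<in> carrier G" "g \<in> carrier G" "T \<in> carrier G" using R' R g T by simp_all
  define W where "W = (y \<otimes> R \<otimes> inv y) \<otimes> inv R"
  define V where "V = W \<otimes> T \<otimes> inv W \<otimes> inv T"
  have "y \<otimes> (R \<otimes> inv y \<otimes> inv R) \<in> B" using y c by (intro B.m_closed B.inv_op_closed2) auto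
  then have WB: "W \<in> B" using yc c by (simp add: W_def m_assoc)
  then have Wc: "W \<in> carrier G" by simp
  have "W \<otimes> (T \<otimes> inv W \<otimes> inv T) \<in> B" using WB c by (intro B.m_closed B.inv_op_closed2) auto
  then have VB: "V \<in> B" using Wc c by (simp add: V_def m_assoc)
  have "lifts (actw (inv y) u) (inv (secw (inv y) u) \<otimes> R' \<otimes> secw (inv y) u) (inv (inv y) \<otimes> R \<otimes> inv y)"
    by (rule lifts_conj[OF R(2) u(1)]) (use yc in simp)
  then have Ry: "lifts (actw (inv y) u) (inv (secw (inv y) u) \<otimes> R' \<otimes> secw (inv y) u) (y \<otimes> R \<otimes> inv y)"
    using yc by simp
  have yu: "actw (inv y) u \<in> words m" "u \<noteq> actw (inv y) u"
    using yc u actw_inv_cancel(2)[OF yc set_words[OF u(1)]] by (simp, metis)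
  note Ryd = liftsD[OF Ry yu(1)] and Rd = liftsD[OF R(2) u(1)] and Td = liftsD[OF T(2) u(1)]
  have Ws: "W \<in> level_stab m" unfolding W_def by (intro level_stab_closed Ryd(1) Rd(1))
  have Wu: "secw W u = inv R'"
    unfolding W_def using secw_stab_mult[OF Ryd(1) level_stab_closed(2)[OF Rd(1)] u(1)]
      secw_stab_inv[OF Rd(1) u(1)] Rd(3) Ryd(4)[OF u(1) yu(2)] c by simp
  have Vs: "V \<in> level_stab m" unfolding V_def by (intro level_stab_closed Ws Td(1))
  have Vw: "secw V q = secw W q \<otimes> secw T q \<otimes> inv (secw W q) \<otimes> inv (secw T q)" if "q \<in> words m" for q
    unfolding V_def
    using secw_stab_mult[OF _ _ that] secw_stab_inv[OF _ that] Ws Td(1) by (simp add: level_stab_closed)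
  have "lifts u (inv R' \<otimes> g \<otimes> R' \<otimes> inv g) V"
  proof (rule liftsI[OF u(1) Vs])
    show "secw V u = inv R' \<otimes> g \<otimes> R' \<otimes> inv g" using Vw[OF u(1)] Wu Td(3) c by simp
    show "secw V q = \<one>" if "q \<in> words m" "q \<noteq> u" for q
      using Vw[OF that(1)] Td(4)[OF that] Wc that(1) by simp
  qed
  moreover have "lifts [0] (r \<otimes> s \<otimes> inv r \<otimes> inv s) (inv R' \<otimes> g \<otimes> R' \<otimes> inv g)"
  proof -
    note Rs = liftsD_1[OF R'(2) p_gt(1)]
    have "sec (inv R' \<otimes> g \<otimes> R' \<otimes> inv g) j = inv (sec R' j) \<otimes> sec g j \<otimes> sec R' j \<otimes> inv (sec g j)"
      if "j < p" for j
      using sec_stab_mult[OF _ _ that] sec_stab_inv[OF _ that] Rs(1) g(2)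
      by (simp add: level_stab_closed)
    then show ?thesis
      using Rs g c rs by (intro liftsI_1 level_stab_closed) auto
  qed
  ultimately have "lifts (u @ [0]) (r \<otimes> s \<otimes> inv r \<otimes> inv s) V"
    using u(1) by (intro lifts_append[where m = m and n = 1]) auto
  with VB show ?thesis by blast
qed

text \<open>A single nontrivial \<open>y\<close> in \<open>B\<close> moves a vertex on every deep
  level. This yields lifts of \<open>gamma3\<close> at a child of that vertex, and level
  transitivity together with the normality of \<open>gamma3\<close> and \<open>B\<close> carries
  them to all vertices of the level.\<close>

lemma normal_contains_lifts:
  assumes B: "B \<lhd> G" "B \<noteq> {\<one>}"
  obtains n where "\<And>m v x. n \<le> m \<Longrightarrow> v \<in> words m \<Longrightarrow> x \<in> gamma3 \<Longrightarrow> \<exists>z\<in>B. lifts v x z"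
proof -
  interpret B: normal B G by fact
  interpret C: normal gamma3 G by (rule gamma3_normal)
  obtain y where y: "y \<in> B" "y \<noteq> \<one>" using B(2) B.one_closed by blast
  obtain n where n: "\<And>m. n \<le> m \<Longrightarrow> \<exists>u\<in>words m. actw y u \<noteq> u"
    using moves_long_word[OF B.mem_carrier[OF y(1)] y(2)] by blast
  have "\<exists>z\<in>B. lifts v x z" if m: "Suc n \<le> m" and v: "v \<in> words m" and x: "x \<in> gamma3" for m v x
  proof -
    obtain k where k: "m = Suc k" "n \<le> k" using m by (cases m) auto
    obtain u where u: "u \<in> words k" "actw y u \<noteq> u" using n[OF k(2)] by blast
    let ?w = "u @ [0]"
    have w: "?w \<in> words m" using append_words[OF u(1), of "[0]" 1] k by simp
    let ?S = "{x \<in> carrier G. \<exists>z\<in>B. lifts ?w x z}"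
    have sub: "subgroup ?S G"
    proof (rule subgroupI)
      show "?S \<noteq> {}" using lifts_one[OF w] B.one_closed by blast
      show "inv x \<in> ?S" if "x \<in> ?S" for x using that lifts_inv[OF _ w] B.m_inv_closed by blast
      show "x \<otimes> x' \<in> ?S" if "x \<in> ?S" "x' \<in> ?S" for x x'
        using that lifts_mult[OF _ _ w] B.m_closed by blast
    qed auto
    have "gamma3 \<subseteq> ?S"
      unfolding gamma3_def
      by (rule generate_subgroup_incl[OF _ sub])
        (use normal_contains_lifted_commutators[OF B(1) y(1) u] in auto)
    obtain g where g: "g \<in> carrier G" "actw g ?w = v" using transitive_words[OF w v] .
    let ?k = "secw g ?w"
    have kc: "?k \<in> carrier G" using g(1) set_words[OF w] by (rule secw_closed)
    have xc: "x \<in> carrier G" using x by simp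
    have "?k \<otimes> x \<otimes> inv ?k \<in> gamma3" using x kc by (rule C.inv_op_closed2[rotated])
    then obtain z where z: "z \<in> B" "lifts ?w (?k \<otimes> x \<otimes> inv ?k) z" using \<open>gamma3 \<subseteq> ?S\<close> by blast
    have "lifts v (inv ?k \<otimes> (?k \<otimes> x \<otimes> inv ?k) \<otimes> ?k) (inv g \<otimes> z \<otimes> g)"
      using lifts_conj[OF z(2) w g(1)] g(2) by simp
    moreover have "inv ?k \<otimes> (?k \<otimes> x \<otimes> inv ?k) \<otimes> ?k = x" using kc xc by (simp add: m_assoc)
    moreover have "inv g \<otimes> z \<otimes> g \<in> B" using z(1) g(1) by (rule B.inv_op_closed1[rotated])
    ultimately show ?thesis by auto
  qed
  then show thesis using that by blast
qed

text \<open>Two levels are used because \<open>[z, a]\<close>, with \<open>z\<close> a lift of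
  \<open>y\<close> at \<open>j\<close>, has at \<open>j\<close> the section \<open>y\<close>, which
  must lie in \<open>G'\<close>; arbitrary elements occur as sections of such
  \<open>y\<close>.\<close>

lemma gamma3_section_surj:
  assumes j: "j < p" and l: "l < p" and g: "g \<in> carrier G"
  obtains c where "c \<in> gamma3" "c \<in> level_stab 2" "secw c [j, l] = g"
proof -
  obtain y where y: "y \<in> G'" "y \<in> level_stab 1" "sec y l = g" using sec_derived_surj[OF l g] .
  obtain z where z: "z \<in> G'" "lifts [j] y z" using lifts_derived[of "[j]" 1] y(1) j by auto
  note zd = liftsD_1[OF z(2) j]
  have zc: "z \<in> carrier G" using z by simp
  let ?c = "z \<otimes> a \<otimes> inv z \<otimes> inv a"
  have cs: "?c \<in> level_stab 1" by (rule derived_stab) (use zc in \<open>auto intro: comm_in_derived\<close>)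
  have sec: "sec ?c i = sec z i \<otimes> inv (sec z ((i + 1) mod p))" if i: "i < p" for i
  proof -
    have "act (inv z) k = k" if "k < p" for k
      by (rule level_stab_1D(2)[OF level_stab_closed(2)[OF zd(1)] that])
    then show ?thesis
      using i zc level_stab_1D(2)[OF zd(1)] sec_stab_inv[OF zd(1)] sec_inv_a_pow[of _ 1] by simp
  qed
  have "(j + 1) mod p \<noteq> j" using j p_ge_3 by (cases "Suc j = p") auto
  then have "sec ?c j = y" using sec[OF j] zd(2) zd(3)[of "(j + 1) mod p"] y level_stab_1D by simp
  moreover have "?c \<in> level_stab (Suc 1)"
  proof (rule level_stab_Suc)
    show "sec ?c i \<in> level_stab 1" if "i < p" for i
    proof -
      have "sec z k \<in> level_stab 1" if "k < p" for k
        using zd(2) zd(3)[OF that] y(2) subgroup.one_closed[OF subgroup_level_stab] by (cases "k = j") auto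
      then show ?thesis unfolding sec[OF that] using that by (intro level_stab_closed) auto
    qed
  qed (use zc level_stab_1D(2)[OF cs] in auto)
  moreover have "?c \<in> gamma3" using z(1) by (rule comm_in_gamma3) simp
  ultimately show thesis using y(3) that[of ?c] by (simp add: numeral_2_eq_2)
qed

lemma gamma3_nontrivial:
  obtains c where "c \<in> gamma3" "c \<noteq> \<one>"
proof -
  obtain c where c: "c \<in> gamma3" "secw c [0, 0] = a" using gamma3_section_surj[of 0 0 a] by auto
  have "act a 0 \<noteq> act \<one> 0" using p_ge_3 by simp
  then have "a \<noteq> \<one>" by metis
  with c have "c \<noteq> \<one>" by auto
  with c that show thesis by blast
qed

lemma finite_index_gamma3_G: "finite_index gamma3 G"
  by (rule finite_index_gamma3[OF a_closed b_closed generate_ab a_pow_p b_pow_p p_gt(1)])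

text \<open>At a deep level \<open>B\<close> contains every stabilizer element all of whose sections
  lie in \<open>gamma3\<close>, being a product of lifts. These elements form a subgroup of finite
  index.\<close>

lemma finite_index_if_normal:
  assumes B: "B \<lhd> G" "B \<noteq> {\<one>}" shows "finite_index B G"
proof -
  obtain n where n: "\<And>m v x. n \<le> m \<Longrightarrow> v \<in> words m \<Longrightarrow> x \<in> gamma3 \<Longrightarrow> \<exists>z\<in>B. lifts v x z"
    using normal_contains_lifts[OF B] by blast
  let ?R = "{g \<in> level_stab n. \<forall>u\<in>words n. secw g u \<in> gamma3}"
  let ?K = "G\<lparr>carrier := level_stab n\<rparr>"
  have sB: "subgroup B G" using B(1) by (rule normal_imp_subgroup)
  have sC: "subgroup gamma3 G" by (rule normal_imp_subgroup[OF gamma3_normal])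
  have R: "subgroup ?R G" "finite_index ?R G"
    using finite_index_level_stab_vimage[OF sC finite_index_gamma3_G] by blast+
  have "subgroup (B \<inter> level_stab n) ?K"
    using subgroup_incl[OF subgroups_Inter_pair[OF sB subgroup_level_stab] subgroup_level_stab] by blast
  then have "g \<in> B \<inter> level_stab n" if "g \<in> ?R" for g
  proof (rule subgroup_contains_supported[where I = "words n" and \<phi> = "\<lambda>u g. secw g u" and K = ?K
        and A = "\<lambda>_. gamma3", rotated 4])
    show "\<exists>d\<in>B \<inter> level_stab n. secw d u = x \<and> (\<forall>j\<in>words n - {u}. secw d j = \<one>)"
      if u: "u \<in> words n" and x: "x \<in> gamma3" for u x
    proof -
      obtain z where z: "z \<in> B" "lifts u x z" using n[OF order_refl u x] by blast
      then show ?thesis using liftsD[OF z(2) u] by blast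
    qed
    show "group ?K" by (rule subgroup_imp_group[OF subgroup_level_stab])
    show "x = \<one>\<^bsub>?K\<^esub>" if "x \<in> carrier ?K" "\<forall>i\<in>words n. secw x i = \<one>" for x
      using level_stab_trivial[of x n] that by simp
  qed (use that secw_hom in auto)
  then have "?R \<subseteq> B" by blast
  then show ?thesis using finite_index_mono[OF R(1) sB _ R(2)] by blast
qed

text \<open>Some \<open>x\<close> in \<open>A\<close> moves a deep vertex \<open>v\<close>, and
  \<open>B\<close> contains a nontrivial element supported below \<open>v\<close>. Conjugation by
  \<open>x\<close> moves this support to \<open>v^x\<close>, so the two elements do not
  commute.\<close>

lemma normal_noncommuting:
  assumes A: "A \<lhd> G" "A \<noteq> {\<one>}" and B: "B \<lhd> G" "B \<noteq> {\<one>}"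
  shows "\<exists>x\<in>A. \<exists>y\<in>B. x \<otimes> y \<noteq> y \<otimes> x"
proof (rule ccontr)
  assume "\<not> ?thesis"
  then have comm: "x \<otimes> y = y \<otimes> x" if "x \<in> A" "y \<in> B" for x y using that by blast
  interpret A: normal A G by fact
  obtain x where x: "x \<in> A" "x \<noteq> \<one>" using A(2) A.one_closed by blast
  have xc: "x \<in> carrier G" using x by simp
  obtain k where k: "\<And>m. k \<le> m \<Longrightarrow> \<exists>u\<in>words m. actw x u \<noteq> u"
    using moves_long_word[OF xc x(2)] by blast
  obtain n where n: "\<And>m v x. n \<le> m \<Longrightarrow> v \<in> words m \<Longrightarrow> x \<in> gamma3 \<Longrightarrow> \<exists>z\<in>B. lifts v x z"
    using normal_contains_lifts[OF B] by blast
  obtain v where v: "v \<in> words (max k n)" "actw x v \<noteq> v" using k[of "max k n"] by auto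
  obtain c where c: "c \<in> gamma3" "c \<noteq> \<one>" by (rule gamma3_nontrivial)
  obtain y where y: "y \<in> B" "lifts v c y" using n[OF _ v(1) c(1)] by auto
  have yc: "y \<in> carrier G" using liftsD(2)[OF y(2) v(1)] .
  have "inv x \<otimes> y \<otimes> x = inv x \<otimes> (x \<otimes> y)" using xc yc comm[OF x(1) y(1)] by (simp add: m_assoc)
  then have e: "inv x \<otimes> y \<otimes> x = y" using xc yc by simp
  have "lifts (actw x v) (inv (secw x v) \<otimes> c \<otimes> secw x v) y"
    using lifts_conj[OF y(2) v(1) xc] e by simp
  then have "secw y v = \<one>" using v xc by (intro liftsD(4)[where v = "actw x v"]) auto
  with c(2) show False using liftsD(3)[OF y(2) v(1)] by simp
qed

sublocale noncommuting_just_infinite G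
  by unfold_locales (use finite_index_if_normal normal_noncommuting in blast)+

section \<open>Sections of dense subgroups\<close>

lemma separate_by_level_stab:
  assumes "c \<in> carrier G" "c \<noteq> \<one>"
  obtains n where "c \<notin> level_stab n"
  using moves_word[OF assms] level_stabD(2) by metis

text \<open>A nontrivial \<open>c\<close> in \<open>gamma3\<close>, placed at one coordinate, meets
  the separation hypothesis: some level stabilizer omits it.\<close>

lemma dense_sections_eq_carrier:
  assumes "group K" "finite I" "\<And>i. i \<in> I \<Longrightarrow> \<phi> i \<in> hom K G"
    and "\<And>x. x \<in> carrier K \<Longrightarrow> \<forall>i\<in>I. \<phi> i x = \<one> \<Longrightarrow> x = \<one>\<^bsub>K\<^esub>"
    and "profinitely_dense D K" and "\<And>i. i \<in> I \<Longrightarrow> \<phi> i ` D = carrier G"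
    and lift: "\<And>i c. i \<in> I \<Longrightarrow> c \<in> gamma3 \<Longrightarrow> \<exists>x\<in>carrier K. \<phi> i x = c \<and> (\<forall>j\<in>I - {i}. \<phi> j x = \<one>)"
  shows "D = carrier K"
proof (rule dense_subdirect_eq_carrier[OF assms(1-6)])
  fix i assume i: "i \<in> I"
  obtain c where c: "c \<in> gamma3" "c \<noteq> \<one>" by (rule gamma3_nontrivial)
  have "c \<in> carrier G" using c(1) gamma3_subset_derived by auto
  then obtain n where n: "c \<notin> level_stab n" using separate_by_level_stab c(2) by blast
  obtain x where "x \<in> carrier K" "\<phi> i x = c" "\<forall>j\<in>I - {i}. \<phi> j x = \<one>" using lift[OF i c(1)] by blast
  with n show "\<exists>N x. N \<lhd> G \<and> finite_index N G \<and> x \<in> carrier K \<and> \<phi> i x \<notin> N \<and> (\<forall>j\<in>I - {i}. \<phi> j x = \<one>)"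
    using normal_level_stab finite_index_level_stab by blast
qed

text \<open>The first-level stabilizer is normal of finite index, so \<open>D\<close> acts on the
  letters as the whole group does.\<close>

lemma dense_act:
  assumes D: "profinitely_dense D G" and "i < p" "j < p"
  obtains d where "d \<in> D" "act d i = j"
proof -
  have "a [^] (p - i + j) \<in> carrier G" by simp
  then obtain d n where dn: "d \<in> D" "n \<in> level_stab 1" "a [^] (p - i + j) = d \<otimes> n"
    using profinitely_denseD(2)[OF D normal_level_stab[of 1] finite_index_level_stab[of 1]] by blast
  have dc: "d \<in> carrier G" by (rule subgroup.mem_carrier[OF profinitely_denseD(1)[OF D] dn(1)])
  have "act (a [^] (p - i + j)) i = j" using assms by simp
  then have "act n (act d i) = j" unfolding dn(3) using level_stab_1D(1)[OF dn(2)] dc assms by simp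
  then have "act d i = j" using level_stab_1D(2)[OF dn(2)] dc assms(2) by simp
  with dn(1) show thesis by (rule that)
qed

text \<open>The section group of \<open>D\<close> at \<open>j\<close>, conjugated by
  \<open>g\<close>. Whether it is everything does not depend on \<open>g\<close>, and the freedom in
  \<open>g\<close> lets a chosen section be normalised to a generator.\<close>

definition section_conj :: "'a set \<Rightarrow> nat \<Rightarrow> 'a \<Rightarrow> 'a set"
  where "section_conj D j g = (\<lambda>x. g \<otimes> sec x j \<otimes> inv g) ` (D \<inter> level_stab 1)"

lemma conj_hom: "g \<in> carrier G \<Longrightarrow> (\<lambda>x. g \<otimes> x \<otimes> inv g) \<in> hom G G"
  by (auto simp: hom_def m_assoc)

lemma conj_surj:
  assumes g: "g \<in> carrier G" and H: "H \<subseteq> carrier G" "(\<lambda>x. g \<otimes> x \<otimes> inv g) ` H = carrier G"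
  shows "H = carrier G"
proof
  show "carrier G \<subseteq> H"
  proof
    fix x assume x: "x \<in> carrier G"
    then have "g \<otimes> x \<otimes> inv g \<in> (\<lambda>x. g \<otimes> x \<otimes> inv g) ` H" using g H(2) by simp
    then obtain h where h: "h \<in> H" "g \<otimes> x \<otimes> inv g = g \<otimes> h \<otimes> inv g" by blast
    have "h \<in> carrier G" using h(1) H(1) by blast
    have "x = inv g \<otimes> (g \<otimes> x \<otimes> inv g) \<otimes> g" using x g by (simp add: m_assoc)
    also have "\<dots> = inv g \<otimes> (g \<otimes> h \<otimes> inv g) \<otimes> g" unfolding h(2) ..
    also have "\<dots> = h" using g \<open>h \<in> carrier G\<close> by (simp add: m_assoc)
    finally have "x = h" .
    with h show "x \<in> H" by simp
  qed
qed (rule H(1))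

lemma conj_dense:
  assumes D: "profinitely_dense D G" and g: "g \<in> carrier G"
  shows "profinitely_dense ((\<lambda>x. g \<otimes> x \<otimes> inv g) ` D) G"
proof (rule profinitely_dense_image[OF is_group conj_hom[OF g] _ D])
  show "(\<lambda>x. g \<otimes> x \<otimes> inv g) ` carrier G = carrier G"
  proof
    show "carrier G \<subseteq> (\<lambda>x. g \<otimes> x \<otimes> inv g) ` carrier G"
    proof
      fix x assume "x \<in> carrier G"
      then have "x = g \<otimes> (inv g \<otimes> x \<otimes> g) \<otimes> inv g" "inv g \<otimes> x \<otimes> g \<in> carrier G"
        using g by (simp_all add: m_assoc)
      then show "x \<in> (\<lambda>x. g \<otimes> x \<otimes> inv g) ` carrier G" by blast
    qed
  qed (use g in auto)
qed

lemma section_conj_image: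
  "section_conj D j g = (\<lambda>x. g \<otimes> x \<otimes> inv g) ` ((\<lambda>x. sec x j) ` (D \<inter> level_stab 1))"
  by (auto simp: section_conj_def)

lemma section_conj_dense:
  assumes D: "profinitely_dense D G" and j: "j < p" and g: "g \<in> carrier G"
  shows "profinitely_dense (section_conj D j g) G"
proof -
  interpret K: group "G\<lparr>carrier := level_stab 1\<rparr>" by (rule subgroup_imp_group[OF subgroup_level_stab])
  have "profinitely_dense (D \<inter> level_stab 1) (G\<lparr>carrier := level_stab 1\<rparr>)"
    by (rule profinitely_dense_Int[OF subgroup_level_stab finite_index_level_stab D])
  moreover have "(\<lambda>x. sec x j) ` carrier (G\<lparr>carrier := level_stab 1\<rparr>) = carrier G"
  proof
    show "carrier G \<subseteq> (\<lambda>x. sec x j) ` carrier (G\<lparr>carrier := level_stab 1\<rparr>)"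
    proof
      fix x assume "x \<in> carrier G"
      then obtain h where "h \<in> level_stab 1" "sec h j = x" using sec_derived_surj[OF j] by metis
      then show "x \<in> (\<lambda>x. sec x j) ` carrier (G\<lparr>carrier := level_stab 1\<rparr>)" by auto
    qed
  qed (use level_stab_1D j in auto)
  ultimately have "profinitely_dense ((\<lambda>x. sec x j) ` (D \<inter> level_stab 1)) G"
    by (intro K.profinitely_dense_image[OF is_group sec_hom[OF j]])
  then show ?thesis unfolding section_conj_image by (rule conj_dense[OF _ g])
qed

text \<open>An element of \<open>D\<close> sending \<open>j\<close> to \<open>i\<close> transports
  surjectivity of the sections from \<open>j\<close> to \<open>i\<close>. So \<open>D\<close> has
  surjective sections at all letters, and the subdirect criterion applies to
  \<open>level_stab 1\<close>.\<close>

lemma section_conj_full: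
  assumes D: "profinitely_dense D G" and j: "j < p" and g: "g \<in> carrier G"
    and full: "section_conj D j g = carrier G"
  shows "D = carrier G"
proof -
  interpret D: subgroup D G by (rule profinitely_denseD(1)[OF D])
  let ?K = "G\<lparr>carrier := level_stab 1\<rparr>"
  have "(\<lambda>x. sec x j) ` (D \<inter> level_stab 1) = carrier G"
    using full unfolding section_conj_image by (rule conj_surj[OF g, rotated]) (use j level_stab_1D in auto)
  then have sj: "\<exists>f\<in>D \<inter> level_stab 1. sec f j = x" if "x \<in> carrier G" for x
    using that by (metis (no_types, lifting) imageE)
  have surj: "(\<lambda>x. sec x i) ` (D \<inter> level_stab 1) = carrier G" if i: "i < p" for i
  proof
    show "carrier G \<subseteq> (\<lambda>x. sec x i) ` (D \<inter> level_stab 1)"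
    proof
      fix x assume x: "x \<in> carrier G"
      obtain d where d: "d \<in> D" "act d j = i" using dense_act[OF D j i] .
      have dc: "d \<in> carrier G" using d by simp
      have dj: "sec d j \<in> carrier G" using dc j by simp
      obtain f where f: "f \<in> D" "f \<in> level_stab 1" "sec f j = sec d j \<otimes> x \<otimes> inv (sec d j)"
        using sj[of "sec d j \<otimes> x \<otimes> inv (sec d j)"] x dj by auto
      have fc: "f \<in> carrier G" using f by simp
      have act_d: "act (inv d) i = j" using act_inv_cancel(1)[OF dc j] d(2) by simp
      have "sec (inv d) i = inv (sec d j)" using sec_inv[OF dc j] d(2) by simp
      then have "sec (inv d \<otimes> f \<otimes> d) i = x"
        using i j dc fc f(3) dj x act_d level_stab_1D(2)[OF f(2)] by (simp add: m_assoc)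
      moreover have "inv d \<otimes> f \<otimes> d \<in> level_stab 1"
        using f(2) dc by (intro normal.inv_op_closed1[OF normal_level_stab])
      moreover have "inv d \<otimes> f \<otimes> d \<in> D" using d f by simp
      ultimately show "x \<in> (\<lambda>x. sec x i) ` (D \<inter> level_stab 1)" by blast
    qed
  qed (use i level_stab_1D in auto)
  have "D \<inter> level_stab 1 = carrier ?K"
  proof (rule dense_sections_eq_carrier[where I = "{..<p}" and \<phi> = "\<lambda>i x. sec x i"])
    show "group ?K" by (rule subgroup_imp_group[OF subgroup_level_stab])
    show "profinitely_dense (D \<inter> level_stab 1) ?K"
      by (rule profinitely_dense_Int[OF subgroup_level_stab finite_index_level_stab D])
    show "x = \<one>\<^bsub>?K\<^esub>" if "x \<in> carrier ?K" "\<forall>i\<in>{..<p}. sec x i = \<one>" for x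
      using trivial_if_trivial_sections[of x] level_stab_1D that by simp
    show "\<exists>x\<in>carrier ?K. sec x i = c \<and> (\<forall>j\<in>{..<p} - {i}. sec x j = \<one>)"
      if ic: "i \<in> {..<p}" "c \<in> gamma3" for i c
    proof -
      have i: "i < p" using ic by simp
      obtain z where z: "lifts [i] c z"
        using lifts_derived[of "[i]" 1 c] ic gamma3_subset_derived by auto
      show ?thesis using liftsD_1[OF z i] by (intro bexI[of _ z]) auto
    qed
  qed (use surj sec_hom in auto)
  then show ?thesis
    using dense_containing_finite_index[OF subgroup_level_stab finite_index_level_stab _ D] by auto
qed

end

section \<open>Dense subgroups of the Gupta--Sidki group\<close>

context gupta_sidki_group
begin

text \<open>\<open>syllables n e g\<close>: \<open>g\<close> can be written as a word with \<open>n\<close> powers of \<open>b\<close> whose exponents add up to \<open>e\<close>.\<close>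

inductive syllables :: "nat \<Rightarrow> int \<Rightarrow> 'a \<Rightarrow> bool"
  where
    one: "syllables 0 0 \<one>"
  | a: "syllables 0 0 a"
  | inv_a: "syllables 0 0 (inv a)"
  | b: "syllables 1 e (b [^] e)"
  | mult: "syllables m e g \<Longrightarrow> syllables n f h \<Longrightarrow> syllables (m + n) (e + f) (g \<otimes> h)"

lemma syllables_closed [simp]: "syllables n e g \<Longrightarrow> g \<in> carrier G"
  by (induction rule: syllables.induct) auto

lemma syllables_inv: "syllables n e g \<Longrightarrow> syllables n (- e) (inv g)"
proof (induction rule: syllables.induct)
  case (b e)
  then show ?case using syllables.b[of "- e"] by (simp add: int_pow_neg)
next
  case (mult m e g n f h)
  have "syllables (n + m) (- f + - e) (inv h \<otimes> inv g)" by (rule syllables.mult[OF mult.IH(2,1)])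
  then show ?case using mult.hyps by (simp add: inv_mult_group add.commute)
qed (auto intro: syllables.intros)

lemma syllables_a_pow: "syllables 0 0 (a [^] (n::nat))"
proof (induction n)
  case (Suc n)
  then show ?case using syllables.mult[OF Suc syllables.a] by simp
qed (auto intro: syllables.intros)

lemma syllables_a_int_pow: "syllables 0 0 (a [^] (e::int))"
  using syllables_a_pow syllables_inv[OF syllables_a_pow]
  by (cases e rule: int_cases2) (simp_all add: int_pow_int int_pow_neg_int)

lemma syllables_mult_a_pow:
  "syllables n e g \<Longrightarrow> syllables n e (g \<otimes> a [^] (k::nat))"
  using syllables.mult[OF _ syllables_a_pow] by force

lemma syllables_exist:
  assumes "g \<in> carrier G" obtains n e where "syllables n e g"
proof -
  let ?R = "{g \<in> carrier G. \<exists>n e. syllables n e g}"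
  have "subgroup ?R G"
    by (rule subgroupI) (auto intro: syllables.one syllables_inv syllables.mult)
  moreover have "syllables 1 1 b" using syllables.b[of 1] by simp
  ultimately have "?R = carrier G" by (intro generate_abI) (auto intro: syllables.a)
  with assms that show thesis by blast
qed

text \<open>In a commutator both exponent sums occur once with each sign.\<close>

lemma syllables_derived:
  assumes "g \<in> G'" obtains n where "syllables n 0 g"
proof -
  let ?R = "{g \<in> carrier G. \<exists>n. syllables n 0 g}"
  have sub: "subgroup ?R G"
  proof (rule subgroupI)
    show "inv g \<in> ?R" if "g \<in> ?R" for g using that syllables_inv[of _ 0 g] by auto
    show "g \<otimes> h \<in> ?R" if "g \<in> ?R" "h \<in> ?R" for g h using that syllables.mult[of _ 0 g _ 0 h] by auto
  qed (auto intro: syllables.one)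
  have "r \<otimes> s \<otimes> inv r \<otimes> inv s \<in> ?R" if rs: "r \<in> carrier G" "s \<in> carrier G" for r s
  proof -
    obtain m e where r: "syllables m e r" using syllables_exist[OF rs(1)] .
    obtain n f where s: "syllables n f s" using syllables_exist[OF rs(2)] .
    have "syllables (m + n + m + n) (e + f + - e + - f) (r \<otimes> s \<otimes> inv r \<otimes> inv s)"
      by (intro syllables.mult syllables_inv r s)
    then show ?thesis using rs by auto
  qed
  then have "G' \<subseteq> ?R" unfolding derived_def by (intro generate_subgroup_incl[OF _ sub]) auto
  with assms that show thesis by blast
qed

lemma b_pow_stab: "b [^] (n::nat) \<in> level_stab 1"
  using b_stab subgroup.one_closed[OF subgroup_level_stab] by (induction n) (auto intro: level_stab_closed)

lemma b_int_pow_stab: "b [^] (e::int) \<in> level_stab 1"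
  using b_pow_stab level_stab_closed(2)[OF b_pow_stab]
  by (cases e rule: int_cases2) (simp_all add: int_pow_int int_pow_neg_int)

lemma sec_b_pow: "j < p \<Longrightarrow> sec (b [^] (n::nat)) j = sec b j [^] n"
  using level_stab_1D(2)[OF b_pow_stab] by (induction n) auto

lemma sec_b_int_pow: "j < p \<Longrightarrow> sec (b [^] (e::int)) j = sec b j [^] e"
  using sec_stab_inv[OF b_pow_stab] sec_b_pow
  by (cases e rule: int_cases2) (simp_all add: int_pow_int int_pow_neg_int)

lemma act_b_int_pow [simp]: "j < p \<Longrightarrow> act (b [^] (e::int)) j = j"
  by (rule level_stab_1D(2)[OF b_int_pow_stab])

lemma a_pow_eq_one: "n mod p = 0 \<Longrightarrow> a [^] (n::nat) = \<one>"
  using nat_pow_mod[OF a_closed a_pow_p, of n] by simp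

lemma syllables_sections_b:
  fixes e :: int
  defines "ns \<equiv> \<lambda>j. if j = p - 1 then 1 else (0::nat)" and "es \<equiv> \<lambda>j. if j = p - 1 then e else 0"
  shows "j < p \<Longrightarrow> syllables (ns j) (es j) (sec (b [^] e) j)"
    and "(\<Sum>j<p. ns j) = 1" "(\<Sum>j<p. es j) = e"
proof -
  show "syllables (ns j) (es j) (sec (b [^] e) j)" if j: "j < p"
  proof -
    have "syllables 0 0 (inv a [^] e)"
      using syllables_inv[OF syllables_a_int_pow[of e]] by (simp add: int_pow_inv)
    moreover have "\<one> [^] e = \<one>" by simp
    ultimately show ?thesis
      using syllables_a_int_pow[of e] syllables.b[of e] syllables.one j
      by (auto simp: sec_b_int_pow sec_b ns_def es_def)
  qed
qed (simp_all add: ns_def es_def)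

text \<open>The last conjunct covers the case in which all \<open>b\<close>-syllables contribute to the same section.\<close>

lemma syllables_sections:
  assumes "syllables n e g"
  shows "\<exists>ns es. (\<Sum>j<p. ns j) = n \<and> (\<Sum>j<p. es j) = e \<and>
    (\<forall>j<p. syllables (ns j) (es j) (sec g j)) \<and>
    (\<forall>j<p. (\<forall>i<p. i \<noteq> j \<longrightarrow> ns i = 0) \<longrightarrow> (\<exists>s::nat. g = a [^] (p - 1 - j) \<otimes> b [^] e \<otimes> a [^] s))"
  using assms
proof (induction rule: syllables.induct)
  case one
  \<comment> \<open>Without \<open>b\<close>-syllables the premise holds for every \<open>j\<close>,
    so a witness is due for each; with \<open>s = j + 1\<close> the exponents of \<open>a\<close>
    add up to \<open>p\<close>.\<close>
  have ex: "\<exists>s::nat. \<one> = a [^] (p - 1 - j) \<otimes> b [^] (0::int) \<otimes> a [^] s" if "j < p" for j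
  proof -
    have "p - 1 - j + (j + 1) = p" using that by linarith
    then show ?thesis
      by (intro exI[of _ "j + 1"]) (simp only: int_pow_0 r_one nat_pow_closed a_closed nat_pow_mult a_pow_p)
  qed
  show ?case
    by (rule exI[of _ "\<lambda>_. 0"], rule exI[of _ "\<lambda>_. 0"], intro conjI allI impI)
      ((rule ex, assumption) | simp add: syllables.one)+
next
  case a
  have ex: "\<exists>s::nat. a = a [^] (p - 1 - j) \<otimes> b [^] (0::int) \<otimes> a [^] s" if "j < p" for j
  proof -
    have "p - 1 - j + (j + 2) = Suc p" using that by linarith
    moreover have "a [^] Suc p = a" by simp
    ultimately show ?thesis
      by (intro exI[of _ "j + 2"]) (simp only: int_pow_0 r_one nat_pow_closed a_closed nat_pow_mult)
  qed
  show ?case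
    by (rule exI[of _ "\<lambda>_. 0"], rule exI[of _ "\<lambda>_. 0"], intro conjI allI impI)
      ((rule ex, assumption) | simp add: syllables.one)+
next
  case inv_a
  have ex: "\<exists>s::nat. inv a = a [^] (p - 1 - j) \<otimes> b [^] (0::int) \<otimes> a [^] s" if "j < p" for j
  proof -
    have "a [^] (p - 1 - j) \<otimes> a [^] j = a [^] (p - 1)" using that by (simp add: nat_pow_mult)
    moreover have "a [^] (p - 1) \<otimes> a = \<one>"
      using a_pow_p by (metis Suc_diff_1 nat_pow_Suc p_gt(1))
    ultimately show ?thesis by (intro exI[of _ j]) (simp add: inv_equality)
  qed
  have sec: "sec (inv a) j = \<one>" if "j < p" for j using sec_inv_a_pow[OF that, of 1] by simp
  show ?case
    by (rule exI[of _ "\<lambda>_. 0"], rule exI[of _ "\<lambda>_. 0"], intro conjI allI impI)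
      ((rule ex, assumption) | simp add: syllables.one sec)+
next
  case (b e)
  let ?ns = "\<lambda>j. if j = p - 1 then 1 else (0::nat)" and ?es = "\<lambda>j. if j = p - 1 then e else 0"
  have "\<exists>s::nat. b [^] e = a [^] (p - 1 - j) \<otimes> b [^] e \<otimes> a [^] s"
    if "j < p" "\<forall>i<p. i \<noteq> j \<longrightarrow> ?ns i = 0" for j
  proof -
    have "j = p - 1" using that(2)[rule_format, of "p - 1"] by (cases "j = p - 1") auto
    then have "b [^] e = a [^] (p - 1 - j) \<otimes> b [^] e \<otimes> a [^] (0::nat)" by simp
    then show ?thesis by blast
  qed
  then show ?case
    using syllables_sections_b(1)[of _ e] syllables_sections_b(2) syllables_sections_b(3)[of e] by (intro exI[of _ ?ns] exI[of _ ?es] conjI) blast+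
next
  case (mult m e g n f h)
  obtain ns es where g: "(\<Sum>j<p. ns j) = m" "(\<Sum>j<p. es j) = e"
    "\<And>j. j < p \<Longrightarrow> syllables (ns j) (es j) (sec g j)"
    "\<And>j. j < p \<Longrightarrow> \<forall>i<p. i \<noteq> j \<longrightarrow> ns i = 0 \<Longrightarrow> \<exists>s::nat. g = a [^] (p - 1 - j) \<otimes> b [^] e \<otimes> a [^] s"
    using mult.IH(1) by blast
  obtain ms fs where h: "(\<Sum>j<p. ms j) = n" "(\<Sum>j<p. fs j) = f"
    "\<And>j. j < p \<Longrightarrow> syllables (ms j) (fs j) (sec h j)"
    "\<And>j. j < p \<Longrightarrow> \<forall>i<p. i \<noteq> j \<longrightarrow> ms i = 0 \<Longrightarrow> \<exists>s::nat. h = a [^] (p - 1 - j) \<otimes> b [^] f \<otimes> a [^] s"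
    using mult.IH(2) by blast
  have gh: "g \<in> carrier G" "h \<in> carrier G" using mult.hyps by simp_all
  \<comment> \<open>The section of \<open>g h\<close> at \<open>j\<close> multiplies the section of
    \<open>g\<close> at \<open>j\<close> with that of \<open>h\<close> at \<open>act g j\<close>;
    the totals follow by reindexing along the permutation \<open>act g\<close>.\<close>
  let ?ns = "\<lambda>j. ns j + ms (act g j)" and ?es = "\<lambda>j. es j + fs (act g j)"
  have "(\<Sum>j<p. ?ns j) = m + n" "(\<Sum>j<p. ?es j) = e + f"
    using g(1,2) h(1,2) sum.reindex_bij_betw[OF bij_betw_act[OF gh(1)], of ms]
      sum.reindex_bij_betw[OF bij_betw_act[OF gh(1)], of fs] by (simp_all add: sum.distrib)
  moreover have "syllables (?ns j) (?es j) (sec (g \<otimes> h) j)" if "j < p" for j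
    using g(3)[OF that] h(3)[of "act g j"] gh that by (simp add: syllables.mult)
  moreover have "\<exists>s::nat. g \<otimes> h = a [^] (p - 1 - j) \<otimes> b [^] (e + f) \<otimes> a [^] s"
    if j: "j < p" and zero: "\<forall>i<p. i \<noteq> j \<longrightarrow> ?ns i = 0" for j
  proof -
    let ?j = "act g j"
    have "\<exists>s::nat. g = a [^] (p - 1 - j) \<otimes> b [^] e \<otimes> a [^] s" using zero by (intro g(4) j) simp
    then obtain s :: nat where s: "g = a [^] (p - 1 - j) \<otimes> b [^] e \<otimes> a [^] s" ..
    have "ms i = 0" if "i < p" "i \<noteq> ?j" for i
    proof -
      have "act (inv g) i < p" "act (inv g) i \<noteq> j" using that gh act_inv_cancel(2)[of g i] by auto
      then have "?ns (act (inv g) i) = 0" using zero by blast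
      then show ?thesis using gh that by simp
    qed
    then have "\<exists>s::nat. h = a [^] (p - 1 - ?j) \<otimes> b [^] f \<otimes> a [^] s" using gh j by (intro h(4)) auto
    then obtain t :: nat where t: "h = a [^] (p - 1 - ?j) \<otimes> b [^] f \<otimes> a [^] t" ..
    \<comment> \<open>All syllables of both factors meet at matching letters. This makes
      \<open>s + (p - 1 - ?j)\<close> a multiple of \<open>p\<close>, so the powers of
      \<open>a\<close> between \<open>b^e\<close> and \<open>b^f\<close> cancel and the two
      syllables merge.\<close>
    have "?j = (p - 1 + s) mod p" unfolding s using j by (simp add: mod_simps)
    moreover have "?j < p" using gh j by simp
    ultimately have "s + (p - 1 - ?j) = (p - 1 + s) - (p - 1 + s) mod p" by linarith
    then have "(s + (p - 1 - ?j)) mod p = 0" by (simp only: minus_mod_eq_mult_div mod_mult_self1_is_0)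
    then have "a [^] s \<otimes> a [^] (p - 1 - ?j) = \<one>" by (simp add: nat_pow_mult a_pow_eq_one)
    then have "(a [^] (p - 1 - j) \<otimes> b [^] e) \<otimes> (a [^] s \<otimes> a [^] (p - 1 - ?j)) \<otimes> (b [^] f \<otimes> a [^] t) =
        a [^] (p - 1 - j) \<otimes> b [^] (e + f) \<otimes> a [^] t"
      by (simp add: m_assoc int_pow_mult)
    moreover have "g \<otimes> h = (a [^] (p - 1 - j) \<otimes> b [^] e) \<otimes> (a [^] s \<otimes> a [^] (p - 1 - ?j)) \<otimes> (b [^] f \<otimes> a [^] t)"
      by (subst s, subst t) (simp add: m_assoc)
    ultimately show ?thesis by auto
  qed
  ultimately show ?case by (intro exI[of _ ?ns] exI[of _ ?es]) blast
qed

text \<open>The sum is additive modulo \<open>p\<close> and vanishes on both generators: in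
  \<open>b\<close> the sections \<open>a\<close> and \<open>a^-1\<close> contribute \<open>1\<close>
  and \<open>p - 1\<close>, and the section \<open>b\<close> has rotation \<open>0\<close>.\<close>

lemma sum_rot_sections:
  assumes "g \<in> carrier G" shows "(\<Sum>j<p. rot (sec g j)) mod p = 0"
proof -
  define F where "F g = (\<Sum>j<p. rot (sec g j))" for g
  have F_mult: "F (g \<otimes> h) mod p = (F g + F h) mod p" if gh: "g \<in> carrier G" "h \<in> carrier G" for g h
  proof -
    have "F (g \<otimes> h) = (\<Sum>j<p. (rot (sec g j) + rot (sec h (act g j))) mod p)"
      unfolding F_def using gh by (intro sum.cong) (auto simp: rot_mult)
    then have "F (g \<otimes> h) mod p = (\<Sum>j<p. rot (sec g j) + rot (sec h (act g j))) mod p"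
      by (simp add: mod_sum_eq)
    also have "(\<Sum>j<p. rot (sec g j) + rot (sec h (act g j))) = F g + F h"
      unfolding F_def sum.distrib
      using sum.reindex_bij_betw[OF bij_betw_act[OF gh(1)], of "\<lambda>j. rot (sec h j)"] by simp
    finally show ?thesis .
  qed
  have rot1: "rot \<one> = 0" by (simp add: rot_def)
  have F1: "F \<one> = 0" by (simp add: F_def rot1)
  let ?R = "{g \<in> carrier G. F g mod p = 0}"
  have "subgroup ?R G"
  proof (rule subgroupI)
    show "?R \<noteq> {}" using F1 by (auto intro!: exI[of _ \<one>])
    show "inv g \<in> ?R" if "g \<in> ?R" for g
    proof -
      have "(F g + F (inv g)) mod p = 0" using that F_mult[of g "inv g"] F1 by simp
      then show ?thesis using that by (simp add: mod_add_left_eq[of "F g", symmetric])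
    qed
    show "g \<otimes> h \<in> ?R" if "g \<in> ?R" "h \<in> ?R" for g h
      using that F_mult[of g h] by (simp add: mod_add_eq[of "F g", symmetric])
  qed auto
  moreover have "a \<in> ?R" by (simp add: F_def rot1)
  moreover have "b \<in> ?R"
  proof -
    have ra: "rot a = 1" using p_ge_3 by (simp add: rot_def)
    have "rot (inv a) = p - 1"
      using act_inv_cancel(1)[of a "p - 1"] p_ge_3 by (simp add: rot_def)
    moreover have "rot b = 0" by (simp add: rot_def)
    ultimately have "F b = (\<Sum>j<p. (if j = 0 then 1 else 0) + (if j = 1 then p - 1 else 0))"
      unfolding F_def using ra rot1 by (intro sum.cong) (auto simp: sec_b)
    also have "\<dots> = p" using p_ge_3 by (simp add: sum.distrib)
    finally show ?thesis by simp
  qed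
  ultimately have "?R = carrier G" by (rule generate_abI)
  with assms show ?thesis by (auto simp: F_def)
qed

lemma bij_betw_mult_mod:
  assumes "0 < r" "r < p" shows "bij_betw (\<lambda>k. k * r mod p) {..<p} {..<p}"
proof -
  have r: "\<not> p dvd r" using assms by (auto dest: dvd_imp_le)
  have le: "k = l" if "k \<le> l" "l < p" "k * r mod p = l * r mod p" for k l
  proof -
    have "p dvd l * r - k * r"
      using that(3) mod_eq_dvd_iff_nat[OF mult_le_mono1[OF that(1)], of r p] by simp
    then have "p dvd (l - k) * r" by (simp add: diff_mult_distrib)
    then have "p dvd l - k" using r p_prime by (simp add: prime_dvd_mult_iff)
    then show ?thesis using that by (auto dest: dvd_imp_le)
  qed
  have inj: "inj_on (\<lambda>k. k * r mod p) {..<p}"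
  proof (rule inj_onI)
    fix k l assume "k \<in> {..<p}" "l \<in> {..<p}" "k * r mod p = l * r mod p"
    then show "k = l" using le[of k l] le[of l k] by (cases "k \<le> l") auto
  qed
  then have "(\<lambda>k. k * r mod p) ` {..<p} = {..<p}" by (intro endo_inj_surj) auto
  with inj show ?thesis by (simp add: bij_betw_def)
qed

text \<open>As \<open>p\<close> is prime, \<open>x\<close> permutes the letters in one cycle. The
  section of \<open>x^p\<close> at \<open>0\<close> is thus the product of all sections of
  \<open>x\<close>, each taken once: counts and exponents add up to those of \<open>x\<close>, and
  rotations add up to \<open>0\<close>.\<close>

lemma sec_pow_p:
  assumes x: "syllables n e x" and r: "rot x \<noteq> 0"
  shows "x [^] p \<in> level_stab 1" "sec (x [^] p) 0 \<in> level_stab 1" "syllables n e (sec (x [^] p) 0)"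
proof -
  let ?r = "rot x"
  have xc: "x \<in> carrier G" using x by simp
  obtain ns es where ns: "(\<Sum>j<p. ns j) = n" "(\<Sum>j<p. es j) = e"
    "\<And>j. j < p \<Longrightarrow> syllables (ns j) (es j) (sec x j)"
    using syllables_sections[OF x] by blast
  have rot1: "rot \<one> = 0" by (simp add: rot_def)
  have *: "act (x [^] m) 0 = m * ?r mod p \<and>
      syllables (\<Sum>k<m. ns (k * ?r mod p)) (\<Sum>k<m. es (k * ?r mod p)) (sec (x [^] m) 0) \<and>
      rot (sec (x [^] m) 0) = (\<Sum>k<m. rot (sec x (k * ?r mod p))) mod p" for m
  proof (induction m)
    case (Suc m)
    have "act (x [^] Suc m) 0 = (m * ?r mod p + ?r) mod p" using Suc xc by (simp add: act_rot[OF xc])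
    moreover have s: "sec (x [^] Suc m) 0 = sec (x [^] m) 0 \<otimes> sec x (m * ?r mod p)" using Suc xc by simp
    moreover have "syllables (\<Sum>k<Suc m. ns (k * ?r mod p)) (\<Sum>k<Suc m. es (k * ?r mod p)) (sec (x [^] Suc m) 0)"
      unfolding s using syllables.mult[OF _ ns(3)[of "m * ?r mod p"]] Suc by simp
    moreover have "rot (sec (x [^] Suc m) 0) = (\<Sum>k<Suc m. rot (sec x (k * ?r mod p))) mod p"
      unfolding s using Suc xc by (simp add: rot_mult mod_simps)
    ultimately show ?case by (simp add: mod_simps add.commute)
  qed (simp add: syllables.one rot1)
  note bij = bij_betw_mult_mod[of ?r]
  have re: "(\<Sum>k<p. f (k * ?r mod p)) = (\<Sum>j<p. f j)" for f :: "nat \<Rightarrow> 'x::comm_monoid_add"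
    using sum.reindex_bij_betw[OF bij, of f] r xc by simp
  show "syllables n e (sec (x [^] p) 0)" using *[of p] ns(1,2) by (simp add: re)
  show "x [^] p \<in> level_stab 1" using *[of p] xc by (simp add: level_stab_rot[unfolded One_nat_def] rot_def)
  show "sec (x [^] p) 0 \<in> level_stab 1"
    using *[of p] sum_rot_sections[OF xc] re[of "\<lambda>j. rot (sec x j)"] xc
    by (simp add: level_stab_rot[unfolded One_nat_def])
qed

text \<open>Induction on the syllables of the conjugator. The sections of \<open>b^w\<close> at
  \<open>0\<close>, \<open>1\<close> and \<open>p - 1\<close> are conjugates of \<open>a\<close>,
  \<open>a^-1\<close> and \<open>b\<close> by the sections of \<open>w\<close>. Conjugating back at
  \<open>j = 0\<close> or \<open>j = 1\<close> restores \<open>a\<close> or \<open>a^-1\<close> and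
  leaves \<open>b\<close> conjugated by the product of two sections of \<open>w\<close>, one of them
  inverted. With two choices of \<open>j\<close>, at least one conjugator is shorter unless all
  syllables sit at \<open>p - 1\<close>.\<close>

lemma conj_syllables_full:
  assumes "syllables n e g" "profinitely_dense D G" "a \<in> D" "inv g \<otimes> b \<otimes> g \<in> D"
  shows "D = carrier G"
  using assms
proof (induction n arbitrary: e g D rule: less_induct)
  case (less n)
  note D = less.prems(2)
  interpret D: subgroup D G by (rule profinitely_denseD(1)[OF D])
  have gc: "g \<in> carrier G" using less.prems(1) by simp
  have aD: "a [^] m \<in> D" for m :: nat using less.prems(3) by (induction m) auto
  \<comment> \<open>As \<open>a\<close> is in \<open>D\<close>, the conjugator may be multiplied by
    powers of \<open>a\<close>; \<open>k\<close> cancels its rotation.\<close>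
  define k where "k = p - rot g"
  define w where "w = g \<otimes> a [^] k"
  have w: "syllables n e w" unfolding w_def by (rule syllables_mult_a_pow[OF less.prems(1)])
  have wc: "w \<in> carrier G" using w by simp
  have "rot (a [^] k) = k mod p" by (simp add: rot_def)
  moreover have "rot g + k = p" unfolding k_def using rot_less[OF gc] by linarith
  ultimately have "rot w = 0" unfolding w_def using gc by (simp add: rot_mult mod_simps)
  then have ws: "w \<in> level_stab 1" using wc by (simp add: level_stab_rot[unfolded One_nat_def])
  define x where "x = inv w \<otimes> b \<otimes> w"
  have "inv (a [^] k) \<otimes> (inv g \<otimes> b \<otimes> g) \<otimes> a [^] k \<in> D" using aD less.prems(4) by simp
  then have xD: "x \<in> D" unfolding x_def w_def using gc by (simp add: inv_mult_group m_assoc)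
  have xs: "x \<in> level_stab 1" unfolding x_def by (intro level_stab_closed ws b_stab)
  have sec_x: "sec x j = inv (sec w j) \<otimes> sec b j \<otimes> sec w j" if "j < p" for j
    unfolding x_def using sec_stab_mult[OF _ _ that] sec_stab_inv[OF ws that] ws b_stab
    by (simp add: level_stab_closed)
  \<comment> \<open>Conjugation by powers of \<open>a\<close> inside \<open>D\<close> brings every
    section of \<open>x\<close> to the letter \<open>0\<close>.\<close>
  have in_sections: "h \<otimes> sec x m \<otimes> inv h \<in> section_conj D 0 h" if "m < p" for m h
  proof -
    have "a [^] m \<otimes> x \<otimes> inv (a [^] m) \<in> D \<inter> level_stab 1"
      using aD xD conj_a_pow(1)[OF xs] by simp
    moreover have "sec (a [^] m \<otimes> x \<otimes> inv (a [^] m)) 0 = sec x m"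
      using conj_a_pow(2)[OF xs p_gt(1), of m] that by simp
    ultimately show ?thesis unfolding section_conj_def by (metis (no_types, lifting) image_eqI)
  qed
  obtain ns es where ns: "(\<Sum>j<p. ns j) = n" "\<And>j. j < p \<Longrightarrow> syllables (ns j) (es j) (sec w j)"
    "\<And>j. j < p \<Longrightarrow> \<forall>i<p. i \<noteq> j \<longrightarrow> ns i = 0 \<Longrightarrow> \<exists>s::nat. w = a [^] (p - 1 - j) \<otimes> b [^] e \<otimes> a [^] s"
    using syllables_sections[OF w] by blast
  let ?l = "p - Suc 0"
  have sw: "sec w j \<in> carrier G" if "j < p" for j using that wc by simp
  have step: "D = carrier G" if j: "j < p" "ns ?l + ns j < n" "sec b j = a \<or> sec b j = inv a" for j
  proof -
    let ?E = "section_conj D 0 (sec w j)"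
    have dense: "profinitely_dense ?E G" by (rule section_conj_dense[OF D p_gt(1) sw[OF j(1)]])
    interpret E: subgroup ?E G by (rule profinitely_denseD(1)[OF dense])
    have "sec w j \<otimes> sec x j \<otimes> inv (sec w j) = sec b j"
      using sw[OF j(1)] j(1) by (simp add: sec_x m_assoc)
    then have "sec b j \<in> ?E" using in_sections[OF j(1), of "sec w j"] by simp
    then have "a \<in> ?E" using j(3) E.m_inv_closed[of "inv a"] by auto
    moreover have "inv (sec w ?l \<otimes> inv (sec w j)) \<otimes> b \<otimes> (sec w ?l \<otimes> inv (sec w j)) \<in> ?E"
      using in_sections[of ?l "sec w j"] sw[OF j(1)] sw[of ?l]
      by (simp add: sec_x inv_mult_group m_assoc)
    moreover have "syllables (ns ?l + ns j) (es ?l + - es j) (sec w ?l \<otimes> inv (sec w j))"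
      using ns(2) j(1) by (intro syllables.mult syllables_inv) auto
    ultimately have "?E = carrier G" using less.IH[OF j(2) _ dense] by blast
    then show ?thesis by (rule section_conj_full[OF D p_gt(1) sw[OF j(1)]])
  qed
  show ?case
  proof (cases "ns ?l + ns 0 < n \<or> ns ?l + ns 1 < n")
    case True
    then show ?thesis using step[of 0] step[of 1] by auto
  next
    case False
    \<comment> \<open>Both partial sums reach \<open>n\<close>, which is already the total, so all
      counts away from \<open>?l\<close> vanish. Then \<open>w = b^e a^s\<close>, where
      \<open>b^e\<close> commutes with \<open>b\<close>.\<close>
    let ?R = "{..<p} - {?l} - {0} - {1}"
    have "sum ns {..<p} = ns ?l + sum ns ({..<p} - {?l})" by (rule sum.remove) auto
    moreover have "sum ns ({..<p} - {?l}) = ns 0 + sum ns ({..<p} - {?l} - {0})"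
      by (rule sum.remove) auto
    moreover have "sum ns ({..<p} - {?l} - {0}) = ns 1 + sum ns ?R" by (rule sum.remove) auto
    ultimately have z: "ns 0 = 0" "ns 1 = 0" "sum ns ?R = 0" using False ns(1) by linarith+
    have "ns i = 0" if "i < p" "i \<noteq> ?l" for i
      using z that by (cases "i = 0 \<or> i = 1") auto
    then have "\<exists>s::nat. w = a [^] (p - 1 - ?l) \<otimes> b [^] e \<otimes> a [^] s" by (intro ns(3)) auto
    then obtain s :: nat where s: "w = b [^] e \<otimes> a [^] s" by auto
    have "x = inv (a [^] s) \<otimes> (inv (b [^] e) \<otimes> (b \<otimes> b [^] e)) \<otimes> a [^] s"
      unfolding x_def s by (simp add: inv_mult_group m_assoc)
    also have "b \<otimes> b [^] e = b [^] e \<otimes> b"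
      using int_pow_mult[of b 1 e] int_pow_mult[of b e 1] by (simp add: add.commute)
    finally have "x = inv (a [^] s) \<otimes> b \<otimes> a [^] s" by simp
    then have "a [^] s \<otimes> x \<otimes> inv (a [^] s) = b" by (simp add: m_assoc)
    moreover have "a [^] s \<otimes> x \<otimes> inv (a [^] s) \<in> D" using aD xD by simp
    ultimately show ?thesis using generate_abI[OF D.subgroup_axioms less.prems(3)] by simp
  qed
qed

text \<open>The section of \<open>b\<close> at \<open>0\<close> is \<open>a\<close>. Conjugating
  \<open>b\<close> by an element of \<open>D\<close> that sends \<open>p - 1\<close> to
  \<open>0\<close> gives a section at \<open>0\<close> conjugate to \<open>b\<close>. So a section
  group meets the hypotheses of \<open>conj_syllables_full\<close>.\<close>

lemma dense_with_b_full:
  assumes D: "profinitely_dense D G" and b: "b \<in> D"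
  shows "D = carrier G"
proof -
  interpret D: subgroup D G by (rule profinitely_denseD(1)[OF D])
  let ?l = "p - Suc 0"
  obtain y where y: "y \<in> D" "act y ?l = 0" using dense_act[OF D, of ?l 0] by auto
  have yc: "y \<in> carrier G" using y by simp
  let ?k = "sec y ?l" and ?E = "section_conj D 0 \<one>"
  have kc: "?k \<in> carrier G" using yc by simp
  have Xs: "inv y \<otimes> b \<otimes> y \<in> level_stab 1"
    using yc b_stab by (intro normal.inv_op_closed1[OF normal_level_stab])
  have "act (inv y) 0 = ?l" using act_inv_cancel(1)[OF yc, of ?l] y(2) by simp
  moreover have "sec (inv y) 0 = inv ?k" using sec_inv[OF yc, of ?l] y(2) by simp
  ultimately have "sec (inv y \<otimes> b \<otimes> y) 0 = inv ?k \<otimes> b \<otimes> ?k" using yc by simp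
  moreover have "\<one> \<otimes> sec (inv y \<otimes> b \<otimes> y) 0 \<otimes> inv \<one> \<in> ?E"
    unfolding section_conj_def using Xs y b by (intro imageI) simp
  ultimately have bE: "inv ?k \<otimes> b \<otimes> ?k \<in> ?E" using kc by simp
  have "\<one> \<otimes> sec b 0 \<otimes> inv \<one> \<in> ?E" unfolding section_conj_def using b b_stab by (intro imageI) simp
  then have aE: "a \<in> ?E" by simp
  obtain n e where "syllables n e ?k" using syllables_exist[OF kc] .
  then have "?E = carrier G"
    by (rule conj_syllables_full[OF _ section_conj_dense[OF D p_gt(1) one_closed] aE bE])
  then show ?thesis by (rule section_conj_full[OF D p_gt(1) one_closed])
qed

text \<open>After conjugating \<open>D\<close>, Bezout modulo \<open>p\<close> recovers
  \<open>b\<close> from \<open>b^e\<close>, because \<open>b^p = 1\<close>.\<close>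

lemma dense_with_conj_b_pow_full:
  assumes D: "profinitely_dense D G" and g: "g \<in> carrier G"
    and b: "g \<otimes> b [^] e \<otimes> inv g \<in> D" and e: "\<not> int p dvd e"
  shows "D = carrier G"
proof -
  define E where "E = (\<lambda>x. inv g \<otimes> x \<otimes> inv (inv g)) ` D"
  interpret D: subgroup D G by (rule profinitely_denseD(1)[OF D])
  have dense: "profinitely_dense E G" unfolding E_def using g by (intro conj_dense[OF D]) simp
  interpret E: subgroup E G by (rule profinitely_denseD(1)[OF dense])
  have "inv g \<otimes> (g \<otimes> b [^] e \<otimes> inv g) \<otimes> inv (inv g) \<in> E" unfolding E_def using b by (rule imageI)
  moreover have "inv g \<otimes> (g \<otimes> b [^] e \<otimes> inv g) \<otimes> inv (inv g) = b [^] e" using g by (simp add: m_assoc)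
  ultimately have be: "b [^] e \<in> E" by (simp only:)
  have "coprime (int p) e" using e p_prime by (simp add: prime_imp_coprime)
  then obtain u v where uv: "u * int p + v * e = 1" using bezout_int[of "int p" e] by auto
  have "(b [^] e) [^] v \<in> E" using be by (rule subgroup_int_pow_closed[OF E.subgroup_axioms])
  moreover have "(b [^] e) [^] v = b"
  proof -
    have "b = b [^] (u * int p + v * e)" using uv by simp
    also have "\<dots> = b [^] (int p * u) \<otimes> b [^] (e * v)" by (simp add: int_pow_mult mult.commute)
    also have "b [^] (int p * u) = (b [^] int p) [^] u" by (simp add: int_pow_pow)
    also have "\<dots> = \<one>" by (simp add: int_pow_int)
    finally show ?thesis by (simp add: int_pow_pow)
  qed
  ultimately have "E = carrier G" using dense_with_b_full[OF dense] by simp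
  then show ?thesis unfolding E_def using g D.subset by (intro conj_surj[of "inv g" D]) simp_all
qed

text \<open>For a stabilizer element the exponent sums of the sections add up to \<open>e\<close>,
  so some section inherits a sum not divisible by \<open>p\<close>; induction applies unless it
  carries all the syllables.\<close>

lemma dense_with_syllables_full:
  assumes "syllables n e x" "profinitely_dense D G" "x \<in> D" "\<not> int p dvd e"
  shows "D = carrier G"
  using assms
proof (induction n arbitrary: e x D rule: less_induct)
  case (less n)
  \<comment> \<open>This is stated for any \<open>x\<close> and \<open>D\<close> with the same
    \<open>n\<close>, because the case of nonzero rotation passes to a section group without
    lowering \<open>n\<close>.\<close>
  have stab: "D = carrier G"
    if x: "syllables n e x" "x \<in> level_stab 1" and D: "profinitely_dense D G" "x \<in> D" for x D
  proof -
    obtain ns es where ns: "(\<Sum>j<p. ns j) = n" "(\<Sum>j<p. es j) = e"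
      "\<And>j. j < p \<Longrightarrow> syllables (ns j) (es j) (sec x j)"
      "\<And>j. j < p \<Longrightarrow> \<forall>i<p. i \<noteq> j \<longrightarrow> ns i = 0 \<Longrightarrow> \<exists>s::nat. x = a [^] (p - 1 - j) \<otimes> b [^] e \<otimes> a [^] s"
      using syllables_sections[OF x(1)] by blast
    obtain j where j: "j < p" "\<not> int p dvd es j"
      using less.prems(4) ns(2) dvd_sum[of "{..<p}" "int p" es] by auto
    show ?thesis
    proof (cases "ns j < n")
      case True
      have "\<one> \<otimes> sec x j \<otimes> inv \<one> \<in> section_conj D j \<one>"
        unfolding section_conj_def using x(2) D(2) by (intro imageI) simp
      then have "sec x j \<in> section_conj D j \<one>" using x(1) j(1) by simp
      then have "section_conj D j \<one> = carrier G"
        using less.IH[OF True ns(3)[OF j(1)] section_conj_dense[OF D(1) j(1) one_closed]] j(2) by blast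
      then show ?thesis by (rule section_conj_full[OF D(1) j(1) one_closed])
    next
      case False
      have "n = ns j + (\<Sum>i\<in>{..<p} - {j}. ns i)" using ns(1) j(1) by (simp add: sum.remove[of _ j])
      then have "(\<Sum>i\<in>{..<p} - {j}. ns i) = 0" using False by simp
      then have "\<exists>s::nat. x = a [^] (p - 1 - j) \<otimes> b [^] e \<otimes> a [^] s" by (intro ns(4) j(1)) simp
      then obtain s :: nat where s: "x = a [^] (p - 1 - j) \<otimes> b [^] e \<otimes> a [^] s" ..
      \<comment> \<open>Fixing the first level forces the outer powers of \<open>a\<close> to
        cancel, so \<open>x\<close> is a conjugate of \<open>b^e\<close>.\<close>
      have "act x 0 = 0" using level_stab_1D(2)[OF x(2)] by simp
      then have "(p - 1 - j + s) mod p = 0" unfolding s by (simp add: mod_simps)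
      then have "a [^] s \<otimes> a [^] (p - 1 - j) = \<one>"
        by (simp add: nat_pow_mult a_pow_eq_one add.commute)
      then have "inv (a [^] (p - 1 - j)) = a [^] s" by (intro inv_equality) auto
      then have "a [^] (p - 1 - j) \<otimes> b [^] e \<otimes> inv (a [^] (p - 1 - j)) \<in> D" using D(2) s by simp
      then show ?thesis using less.prems(4) by (intro dense_with_conj_b_pow_full[OF D(1)]) auto
    qed
  qed
  show ?case
  proof (cases "rot x = 0")
    case True
    then have "x \<in> level_stab 1" using less.prems(1) by (simp add: level_stab_rot[unfolded One_nat_def])
    then show ?thesis using stab less.prems by blast
  next
    case False
    note D = less.prems(2)
    interpret D: subgroup D G by (rule profinitely_denseD(1)[OF D])
    note y = sec_pow_p[OF less.prems(1) False]
    have "x [^] m \<in> D" for m :: nat using less.prems(3) by (induction m) auto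
    then have "\<one> \<otimes> sec (x [^] p) 0 \<otimes> inv \<one> \<in> section_conj D 0 \<one>"
      unfolding section_conj_def using y(1) by (intro imageI) simp
    then have "sec (x [^] p) 0 \<in> section_conj D 0 \<one>" using y(3) by simp
    then have "section_conj D 0 \<one> = carrier G"
      by (rule stab[OF y(3,2) section_conj_dense[OF D p_gt(1) one_closed]])
    then show ?thesis by (rule section_conj_full[OF D p_gt(1) one_closed])
  qed
qed

text \<open>\<open>D\<close> meets the coset of \<open>b\<close> modulo \<open>gamma3\<close>, and
  elements of \<open>G'\<close> have exponent sum \<open>0\<close>, so \<open>D\<close> contains an
  element of exponent sum \<open>1\<close>.\<close>

lemma no_proper_dense_G: "no_proper_dense G"
  unfolding no_proper_dense_def
proof (intro allI impI)
  fix D assume D: "profinitely_dense D G"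
  obtain d c where dc: "d \<in> D" "c \<in> gamma3" "b = d \<otimes> c"
    using profinitely_denseD(2)[OF D gamma3_normal finite_index_gamma3_G b_closed] by blast
  have "d \<in> carrier G" by (rule subgroup.mem_carrier[OF profinitely_denseD(1)[OF D] dc(1)])
  have cG: "c \<in> G'" using dc(2) gamma3_subset_derived by blast
  then obtain n where n: "syllables n 0 c" using syllables_derived by blast
  have "d = b \<otimes> inv c" using dc(3) \<open>d \<in> carrier G\<close> cG by (simp add: m_assoc)
  moreover have "syllables (1 + n) (1 + - 0) (b [^] (1::int) \<otimes> inv c)"
    by (intro syllables.mult syllables.b syllables_inv n)
  ultimately have "syllables (1 + n) 1 d" by simp
  moreover have "\<not> int p dvd 1" using p_ge_3 by simp
  ultimately show "D = carrier G" using D dc(1) by (intro dense_with_syllables_full)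
qed

end

section \<open>Commensurable groups\<close>

context gupta_sidki_group
begin

text \<open>The group is infinite, since its proper subgroup \<open>level_stab 1\<close> maps onto
  it.\<close>

lemma infinite_index_trivial: "\<not> finite_index {\<one>} G"
proof
  assume fin: "finite_index {\<one>} G"
  obtain c :: "'a \<Rightarrow> 'a set" where c: "finite (c ` carrier G)"
    "\<And>x y. x \<in> carrier G \<Longrightarrow> y \<in> carrier G \<Longrightarrow> c x = c y \<Longrightarrow> x \<otimes> inv y \<in> {\<one>}"
    using finite_indexE[OF triv_subgroup fin] by blast
  have "inj_on c (carrier G)"
  proof (rule inj_onI)
    fix x y assume xy: "x \<in> carrier G" "y \<in> carrier G" "c x = c y"
    then have "x \<otimes> inv y = \<one>" using c(2) by blast
    then have "(x \<otimes> inv y) \<otimes> y = y" using xy by simp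
    then show "x = y" using xy by (simp add: m_assoc)
  qed
  then have finG: "finite (carrier G)" using c(1) finite_imageD by blast
  have sub: "level_stab 1 \<subset> carrier G"
  proof
    show "level_stab 1 \<subseteq> carrier G" using level_stab_1D(1) by blast
    have "act a 0 \<noteq> 0" using p_ge_3 by simp
    then have "a \<notin> level_stab 1" using level_stab_1D(2)[of a 0] by auto
    with a_closed show "level_stab 1 \<noteq> carrier G" by metis
  qed
  have "carrier G \<subseteq> (\<lambda>x. sec x 0) ` level_stab 1"
  proof
    fix x assume "x \<in> carrier G"
    then obtain h where "h \<in> level_stab 1" "sec h 0 = x" using sec_derived_surj[OF p_gt(1)] by metis
    then show "x \<in> (\<lambda>x. sec x 0) ` level_stab 1" by blast
  qed
  then have "card (carrier G) \<le> card (level_stab 1)"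
    using finG sub by (meson finite_subset psubset_imp_subset surj_card_le)
  then show False using psubset_card_mono[OF finG sub] by simp
qed

lemma level_stab_append:
  assumes z: "z \<in> level_stab m" "\<And>u. u \<in> words m \<Longrightarrow> secw z u \<in> level_stab n"
  shows "z \<in> level_stab (m + n)"
proof -
  have "actw z w = w" if mn: "w \<in> words (m + n)" for w
  proof -
    obtain u v where w: "u \<in> words m" "v \<in> words n" "w = u @ v" using words_append_split[OF mn] .
    then show ?thesis using level_stabD(2)[OF z(1)] level_stabD(2)[OF z(2)] by (simp add: actw_append)
  qed
  then show ?thesis using level_stabD(1)[OF z(1)] by (simp add: level_stab_def)
qed

text \<open>The preimages of \<open>L\<close> under the embeddings of the factors intersect in a
  subgroup of finite index. Its core is nontrivial as the group is infinite, and so contains lifts;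
  the intersection makes \<open>n\<close> uniform in \<open>i\<close>.\<close>

lemma finite_index_product_contains_lifts:
  fixes k :: nat
  defines "P \<equiv> product_group {..<k} (\<lambda>_. G)"
    and "emb \<equiv> \<lambda>i g. \<lambda>j\<in>{..<k}. if j = i then g else \<one>"
  assumes L: "subgroup L P" "finite_index L P"
  obtains n where "\<And>i m v x. i < k \<Longrightarrow> n \<le> m \<Longrightarrow> v \<in> words m \<Longrightarrow> x \<in> gamma3 \<Longrightarrow>
    \<exists>z. emb i z \<in> L \<and> lifts v x z"
proof -
  have P: "group P" unfolding P_def by (rule product_group) (rule is_group)
  have emb: "emb i \<in> hom G P" for i
    by (rule homI) (auto simp: P_def emb_def fun_eq_iff)
  let ?B = "{g \<in> carrier G. \<forall>i\<in>{..<k}. emb i g \<in> L}"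
  have B: "subgroup ?B G" "finite_index ?B G"
    using emb L by (intro subgroup_vimage_family[OF P] finite_index_vimage_family[OF P]; simp)+
  obtain N where N: "N \<lhd> G" "finite_index N G" "N \<subseteq> ?B" using finite_index_core[OF B] .
  have "N \<noteq> {\<one>}" using N(2) infinite_index_trivial by auto
  then obtain n where n: "\<And>m v x. n \<le> m \<Longrightarrow> v \<in> words m \<Longrightarrow> x \<in> gamma3 \<Longrightarrow> \<exists>z\<in>N. lifts v x z"
    using normal_contains_lifts[OF N(1)] by blast
  have "\<exists>z. emb i z \<in> L \<and> lifts v x z" if "i < k" "n \<le> m" "v \<in> words m" "x \<in> gamma3" for i m v x
    using n[OF that(2-4)] N(3) that(1) by blast
  then show thesis using that by blast
qed

lemma no_proper_dense_of_iso_finite_index: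
  fixes k :: nat
  defines "P \<equiv> product_group {..<k} (\<lambda>_. G)"
  assumes H: "group H" and K: "subgroup K H" "finite_index K H"
    and L: "subgroup L P" "finite_index L P" and f: "f \<in> iso (H\<lparr>carrier := K\<rparr>) (P\<lparr>carrier := L\<rparr>)"
  shows "no_proper_dense H"
proof -
  interpret H: group H by fact
  have P: "group P" unfolding P_def by (rule product_group) (rule is_group)
  interpret P: group P by fact
  let ?K = "H\<lparr>carrier := K\<rparr>"
  interpret K: group ?K by (rule H.subgroup_imp_group[OF K(1)])
  define emb where "emb i g = (\<lambda>j\<in>{..<k}. if j = i then g else \<one>)" for i g
  have f_inj: "inj_on f K" and f_img: "f ` K = L"
    using f by (auto simp: iso_def bij_betw_def)
  have f_hom: "f \<in> hom ?K P"
    using f subgroup.subset[OF L(1)] by (auto simp: iso_def hom_def)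
  define coord where "coord i x = f x i" for i x
  have coord: "coord i \<in> hom ?K G" if "i < k" for i
    using f_hom that by (auto simp: hom_def coord_def P_def Pi_iff PiE_iff)
  obtain n where n: "\<And>i m v x. i < k \<Longrightarrow> n \<le> m \<Longrightarrow> v \<in> words m \<Longrightarrow> x \<in> gamma3 \<Longrightarrow>
    \<exists>z. emb i z \<in> L \<and> lifts v x z"
    using finite_index_product_contains_lifts[OF L[unfolded P_def]] unfolding emb_def by blast
  \<comment> \<open>Level \<open>n\<close> supplies lifts inside \<open>L\<close>; two more levels
    let \<open>gamma3_section_surj\<close> make all sections surjective.\<close>
  define m where "m = n + 2"
  define K' where "K' = {x \<in> K. \<forall>i\<in>{..<k}. coord i x \<in> level_stab m}"
  have "subgroup K' ?K" "finite_index K' ?K"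
    using K.subgroup_vimage_family[of G "{..<k}" coord "\<lambda>_. level_stab m"]
      K.finite_index_vimage_family[of G "{..<k}" coord "\<lambda>_. level_stab m"]
      coord subgroup_level_stab finite_index_level_stab is_group by (simp_all add: K'_def)
  then have K': "subgroup K' H" "finite_index K' H"
    using H.incl_subgroup[OF K(1)] H.finite_index_trans[OF K, of K'] by (auto simp: K'_def)
  let ?K' = "H\<lparr>carrier := K'\<rparr>"
  interpret K': group ?K' by (rule H.subgroup_imp_group[OF K'(1)])
  \<comment> \<open>The coordinates of \<open>K'\<close> are its sections at all vertices of level
    \<open>m\<close> in all \<open>k\<close> factors, so \<open>dense_sections_eq_carrier\<close>
    can treat the product like a single level.\<close>
  define \<phi> where "\<phi> iv x = secw (coord (fst iv) x) (snd iv)" for iv x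
  let ?I = "{..<k} \<times> words m"
  have coord_stab: "coord i x \<in> level_stab m" if "x \<in> K'" "i < k" for i x
    using that by (simp add: K'_def)
  have coord_mult: "coord i (x \<otimes>\<^bsub>H\<^esub> y) = coord i x \<otimes> coord i y"
    if "i < k" "x \<in> K'" "y \<in> K'" for i x y
    using hom_mult[OF coord[OF that(1)]] that by (simp add: K'_def)
  have \<phi>: "\<phi> iv \<in> hom ?K' G" if "iv \<in> ?I" for iv
  proof (rule homI)
    show "\<phi> iv x \<in> carrier G" if "x \<in> carrier ?K'" for x
      using that \<open>iv \<in> ?I\<close> level_stabD(1)[OF coord_stab] by (auto simp: \<phi>_def)
    show "\<phi> iv (x \<otimes>\<^bsub>?K'\<^esub> y) = \<phi> iv x \<otimes> \<phi> iv y" if "x \<in> carrier ?K'" "y \<in> carrier ?K'" for x y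
      using that \<open>iv \<in> ?I\<close> by (auto simp: \<phi>_def coord_mult secw_stab_mult[OF coord_stab coord_stab])
  qed
  have lift: "\<exists>x\<in>K'. \<forall>j\<in>{..<k}. coord j x = (if j = i then z else \<one>)"
    if z: "emb i z \<in> L" "z \<in> level_stab m" for i z
  proof -
    obtain x where x: "x \<in> K" "f x = emb i z" using z(1) f_img by (metis imageE)
    then have c: "\<forall>j\<in>{..<k}. coord j x = (if j = i then z else \<one>)" by (simp add: coord_def emb_def)
    then have "x \<in> K'" using x z(2) subgroup.one_closed[OF subgroup_level_stab] by (auto simp: K'_def)
    with c show ?thesis by blast
  qed
  have "no_proper_dense ?K'"
    unfolding no_proper_dense_def
  proof (intro allI impI)
    fix D assume D: "profinitely_dense D ?K'"
    show "D = carrier ?K'"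
    proof (rule dense_sections_eq_carrier[where I = ?I and \<phi> = \<phi>])
      show "x = \<one>\<^bsub>?K'\<^esub>" if x: "x \<in> carrier ?K'" "\<forall>i\<in>?I. \<phi> i x = \<one>" for x
      proof -
        have xK: "x \<in> K" using x(1) by (simp add: K'_def)
        have "coord i x = \<one>" if "i < k" for i
          using level_stab_trivial[of "coord i x" m] coord_stab[of x i] x that by (auto simp: \<phi>_def)
        moreover have "f x \<in> carrier P" using hom_in_carrier[OF f_hom] xK by simp
        ultimately have "f x = \<one>\<^bsub>P\<^esub>" by (auto simp: coord_def P_def fun_eq_iff PiE_iff extensional_def)
        moreover have "f \<one>\<^bsub>H\<^esub> = \<one>\<^bsub>P\<^esub>" using hom_one[OF f_hom K.is_group P] by simp
        ultimately have "x = \<one>\<^bsub>H\<^esub>" using f_inj xK subgroup.one_closed[OF K(1)] by (metis inj_onD)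
        then show ?thesis by simp
      qed
      show "\<exists>x\<in>carrier ?K'. \<phi> iv x = c \<and> (\<forall>jw\<in>?I - {iv}. \<phi> jw x = \<one>)"
        if iv: "iv \<in> ?I" and c: "c \<in> gamma3" for iv c
      proof -
        obtain i v where i: "iv = (i, v)" "i < k" "v \<in> words m" using iv by auto
        obtain z where z: "emb i z \<in> L" "lifts v c z" using n[OF i(2) _ i(3) c] m_def by auto
        note zd = liftsD[OF z(2) i(3)]
        obtain x where x: "x \<in> K'" "\<forall>j\<in>{..<k}. coord j x = (if j = i then z else \<one>)"
          using lift[OF z(1) zd(1)] by blast
        have "\<phi> iv x = c" using x(2) i zd(3) by (simp add: \<phi>_def)
        moreover have "\<phi> (j, w) x = \<one>" if "j < k" "w \<in> words m" "(j, w) \<noteq> iv" for j w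
          using that x(2) i zd(4) by (cases "j = i") (auto simp: \<phi>_def)
        ultimately show ?thesis using x(1) by (intro bexI[of _ x]) auto
      qed
      show "\<phi> iv ` D = carrier G" if iv: "iv \<in> ?I" for iv
      proof -
        obtain i v where i: "iv = (i, v)" "i < k" "v \<in> words m" using iv by auto
        \<comment> \<open>Lift to \<open>u\<close> an element of \<open>gamma3\<close> that fixes
          two levels and has the prescribed section at \<open>t\<close>.\<close>
        obtain u t where ut: "u \<in> words n" "t \<in> words 2" "v = u @ t"
          using words_append_split i(3) unfolding m_def by blast
        obtain j l where jl: "t = [j, l]" "j < p" "l < p"
          using ut(2) by (auto simp: numeral_2_eq_2 words_Suc_iff)
        have "\<exists>x\<in>K'. \<phi> iv x = g" if g: "g \<in> carrier G" for g
        proof -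
          obtain c where c: "c \<in> gamma3" "c \<in> level_stab 2" "secw c [j, l] = g"
            using gamma3_section_surj[OF jl(2,3) g] .
          obtain z where z: "emb i z \<in> L" "lifts u c z" using n[OF i(2) order_refl ut(1) c(1)] by auto
          note zd = liftsD[OF z(2) ut(1)]
          have "z \<in> level_stab m" unfolding m_def
          proof (rule level_stab_append[OF zd(1)])
            show "secw z q \<in> level_stab 2" if "q \<in> words n" for q
              using zd(3) zd(4)[OF that] c(2) subgroup.one_closed[OF subgroup_level_stab]
              by (cases "q = u") auto
          qed
          then obtain x where x: "x \<in> K'" "\<forall>j\<in>{..<k}. coord j x = (if j = i then z else \<one>)"
            using lift[OF z(1)] by blast
          then have "\<phi> iv x = g" using i ut jl zd(3) c(3) by (simp add: \<phi>_def secw_append)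
          with x(1) show ?thesis by blast
        qed
        then have "\<phi> iv ` carrier ?K' = carrier G"
          using hom_in_carrier[OF \<phi>[OF iv]] by (fastforce simp: image_iff)
        then have "profinitely_dense (\<phi> iv ` D) G"
          by (rule K'.profinitely_dense_image[OF is_group \<phi>[OF iv] _ D])
        then show ?thesis using no_proper_dense_G by (simp add: no_proper_dense_def)
      qed
    qed (use \<phi> D K'.is_group in auto)
  qed
  then show ?thesis by (rule H.no_proper_dense_if_finite_index[OF K'])
qed

end

section \<open>The tree automorphisms as an instance\<close>

definition tree_act :: "(nat list \<Rightarrow> nat list) \<Rightarrow> nat \<Rightarrow> nat"
  where "tree_act g j = hd (g [j])"

text \<open>The restriction makes sections extensional, as elements of \<open>Aut_tree\<close> must
  be.\<close>

definition tree_sec :: "nat \<Rightarrow> (nat list \<Rightarrow> nat list) \<Rightarrow> nat \<Rightarrow> nat list \<Rightarrow> nat list"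
  where "tree_sec p g j = (\<lambda>w\<in>tree_words p. tl (g (j # w)))"

text \<open>Automorphisms commute with \<open>butlast\<close>, so the first letter of the image
  depends on the first letter only.\<close>

lemma tree_auts_Cons:
  assumes g: "g \<in> tree_auts p" and j: "j < p" and w: "w \<in> tree_words p"
  shows "g (j # w) = tree_act g j # tree_sec p g j w" "tree_act g j < p" "tree_sec p g j w \<in> tree_words p"
    and "length (tree_sec p g j w) = length w"
proof -
  have hd: "hd (g (j # w)) = hd (g [j])" using w
  proof (induction w rule: rev_induct)
    case (snoc x w)
    have len: "length (g (j # w)) = Suc (length w)"
      using tree_auts_length[OF g, of "j # w"] snoc.prems j by simp
    have "butlast (g ((j # w) @ [x])) = g (j # w)"
      using tree_auts_butlast[OF g, of "j # w" x] snoc.prems j by simp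
    then have "hd (g ((j # w) @ [x])) = hd (g (j # w))"
      using len by (metis butlast.simps(1) hd_append2 append_butlast_last_id length_0_conv nat.distinct(1))
    then show ?case using snoc by simp
  qed simp
  have jw: "j # w \<in> tree_words p" using j w by simp
  have "length (g (j # w)) = Suc (length w)" using tree_auts_length[OF g jw] by simp
  then obtain i u where iu: "g (j # w) = i # u" "length u = length w" by (cases "g (j # w)") auto
  then show "g (j # w) = tree_act g j # tree_sec p g j w" "length (tree_sec p g j w) = length w"
    using hd w by (simp_all add: tree_act_def tree_sec_def)
  then show "tree_act g j < p" "tree_sec p g j w \<in> tree_words p"
    using tree_autsD(4)[OF g jw] by simp_all
qed

lemma Aut_tree_simps:
  "carrier (Aut_tree p) = tree_auts p"
  "g \<otimes>\<^bsub>Aut_tree p\<^esub> h = compose (tree_words p) h g"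
  "\<one>\<^bsub>Aut_tree p\<^esub> = (\<lambda>w\<in>tree_words p. w)"
  by (simp_all add: Aut_tree_def)

lemma tree_act_mult:
  assumes "g \<in> tree_auts p" "h \<in> tree_auts p" "j < p"
  shows "tree_act (g \<otimes>\<^bsub>Aut_tree p\<^esub> h) j = tree_act h (tree_act g j)"
  using tree_auts_Cons[OF assms(1,3), of "[]"] assms(3)
  by (simp add: Aut_tree_simps tree_act_def[of "compose _ _ _"] compose_def) (simp add: tree_act_def)

lemma tree_sec_mult:
  assumes "g \<in> tree_auts p" "h \<in> tree_auts p" "j < p"
  shows "tree_sec p (g \<otimes>\<^bsub>Aut_tree p\<^esub> h) j = tree_sec p g j \<otimes>\<^bsub>Aut_tree p\<^esub> tree_sec p h (tree_act g j)"
proof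
  fix w
  show "tree_sec p (g \<otimes>\<^bsub>Aut_tree p\<^esub> h) j w = (tree_sec p g j \<otimes>\<^bsub>Aut_tree p\<^esub> tree_sec p h (tree_act g j)) w"
  proof (cases "w \<in> tree_words p")
    case True
    note g = tree_auts_Cons[OF assms(1,3) True]
    show ?thesis using g tree_auts_Cons(1)[OF assms(2) g(2,3)] True assms(3)
      unfolding Aut_tree_simps tree_sec_def[of p "compose (tree_words p) h g"] by (simp add: compose_def)
  qed (simp add: Aut_tree_simps tree_sec_def compose_def)
qed

lemma tree_act_one: "j < p \<Longrightarrow> tree_act \<one>\<^bsub>Aut_tree p\<^esub> j = j"
  by (simp add: tree_act_def Aut_tree_simps)

lemma tree_sec_one: "j < p \<Longrightarrow> tree_sec p \<one>\<^bsub>Aut_tree p\<^esub> j = \<one>\<^bsub>Aut_tree p\<^esub>"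
  by (auto simp: tree_sec_def Aut_tree_simps)

lemma tree_sec_inv_cancel:
  assumes g: "g \<in> tree_auts p" and j: "j < p" and w: "w \<in> tree_words p"
  defines "g' \<equiv> inv\<^bsub>Aut_tree p\<^esub> g"
  shows "tree_sec p g' (tree_act g j) (tree_sec p g j w) = w"
    and "tree_act g' (tree_act g j) = j"
proof -
  interpret A: group "Aut_tree p" by (rule group_Aut_tree)
  have gA: "g \<in> carrier (Aut_tree p)" using g by (simp add: Aut_tree_simps)
  then have g': "g' \<in> tree_auts p" using A.inv_closed by (simp add: g'_def Aut_tree_simps(1))
  have one: "g \<otimes>\<^bsub>Aut_tree p\<^esub> g' = \<one>\<^bsub>Aut_tree p\<^esub>" using gA by (simp add: g'_def)
  have "tree_sec p g j \<otimes>\<^bsub>Aut_tree p\<^esub> tree_sec p g' (tree_act g j) = \<one>\<^bsub>Aut_tree p\<^esub>"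
    using tree_sec_mult[OF g g' j] tree_sec_one[OF j] one by simp
  from fun_cong[OF this, of w] show "tree_sec p g' (tree_act g j) (tree_sec p g j w) = w"
    using w by (simp add: Aut_tree_simps compose_def)
  show "tree_act g' (tree_act g j) = j" using tree_act_mult[OF g g' j] tree_act_one[OF j] one by simp
qed

lemma tree_sec_closed:
  assumes g: "g \<in> tree_auts p" and j: "j < p" shows "tree_sec p g j \<in> tree_auts p"
proof (rule tree_autsI)
  interpret A: group "Aut_tree p" by (rule group_Aut_tree)
  let ?g = "inv\<^bsub>Aut_tree p\<^esub> g" and ?i = "tree_act g j"
  have gA: "g \<in> carrier (Aut_tree p)" using g by (simp add: Aut_tree_simps)
  then have g': "?g \<in> tree_auts p" using A.inv_closed by (simp add: Aut_tree_simps(1))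
  have inv_inv: "inv\<^bsub>Aut_tree p\<^esub> ?g = g" using gA by simp
  have i: "?i < p" using tree_auts_Cons(2)[OF g j, of "[]"] by simp
  have ret: "tree_act ?g ?i = j" by (rule tree_sec_inv_cancel(2)[OF g j, of "[]"]) simp
  show "bij_betw (tree_sec p g j) (tree_words p) (tree_words p)"
  proof (rule bij_betw_byWitness[where f' = "tree_sec p ?g ?i"])
    show "\<forall>w\<in>tree_words p. tree_sec p ?g ?i (tree_sec p g j w) = w"
      using tree_sec_inv_cancel(1)[OF g j] by blast
    show "\<forall>w\<in>tree_words p. tree_sec p g j (tree_sec p ?g ?i w) = w"
      using tree_sec_inv_cancel(1)[OF g' i] by (simp add: inv_inv ret)
  qed (use tree_auts_Cons(3)[OF g j] tree_auts_Cons(3)[OF g' i] in auto)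
  show "tree_sec p g j \<in> extensional (tree_words p)" by (simp add: tree_sec_def)
  show "length (tree_sec p g j u) = length u" if "u \<in> tree_words p" for u
    by (rule tree_auts_Cons(4)[OF g j that])
  show "butlast (tree_sec p g j (u @ [x])) = tree_sec p g j u" if ux: "u @ [x] \<in> tree_words p" for u x
  proof -
    have u: "u \<in> tree_words p" using ux by simp
    have "butlast (g ((j # u) @ [x])) = g (j # u)" by (rule tree_auts_butlast[OF g]) (use ux j in simp)
    then have "butlast (?i # tree_sec p g j (u @ [x])) = ?i # tree_sec p g j u"
      using tree_auts_Cons(1)[OF g j ux] tree_auts_Cons(1)[OF g j u] by simp
    then show ?thesis using tree_auts_Cons(4)[OF g j ux] by (cases "tree_sec p g j (u @ [x])") auto
  qed
qed

lemma tree_sec_inv: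
  assumes g: "g \<in> tree_auts p" and j: "j < p"
  shows "tree_sec p (inv\<^bsub>Aut_tree p\<^esub> g) (tree_act g j) = inv\<^bsub>Aut_tree p\<^esub> (tree_sec p g j)"
proof -
  interpret A: group "Aut_tree p" by (rule group_Aut_tree)
  let ?g = "inv\<^bsub>Aut_tree p\<^esub> g"
  have gA: "g \<in> carrier (Aut_tree p)" using g by (simp add: Aut_tree_simps)
  then have g': "?g \<in> tree_auts p" using A.inv_closed by (simp add: Aut_tree_simps(1))
  have i: "tree_act g j < p" using tree_auts_Cons(2)[OF g j, of "[]"] by simp
  have "tree_sec p g j \<otimes>\<^bsub>Aut_tree p\<^esub> tree_sec p ?g (tree_act g j) = \<one>\<^bsub>Aut_tree p\<^esub>"
    using tree_sec_mult[OF g g' j] tree_sec_one[OF j] gA by simp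
  moreover have c: "tree_sec p g j \<in> carrier (Aut_tree p)" "tree_sec p ?g (tree_act g j) \<in> carrier (Aut_tree p)"
    using tree_sec_closed[OF g j] tree_sec_closed[OF g' i] by (simp_all add: Aut_tree_simps)
  ultimately have "inv\<^bsub>Aut_tree p\<^esub> (tree_sec p ?g (tree_act g j)) = tree_sec p g j"
    by (intro A.inv_equality)
  then show ?thesis using A.inv_inv[OF c(2)] by simp
qed

lemma gs_a_tree_auts: "gs_a p \<in> tree_auts p" and gs_b_tree_auts: "gs_b p \<in> tree_auts p"
  using gs_a_in_carrier gs_b_in_carrier by (simp_all add: Aut_tree_def)

lemma tree_act_gs_a: "j < p \<Longrightarrow> tree_act (gs_a p) j = Suc j mod p"
  by (simp add: tree_act_def gs_a_Cons)

lemma tree_sec_gs_a: "j < p \<Longrightarrow> tree_sec p (gs_a p) j = \<one>\<^bsub>Aut_tree p\<^esub>"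
  by (auto simp: tree_sec_def gs_a_Cons Aut_tree_simps)

lemma tree_act_gs_b: "j < p \<Longrightarrow> tree_act (gs_b p) j = j"
  by (simp add: tree_act_def gs_b_Cons)

lemma tree_sec_gs_b:
  assumes "j < p"
  shows "tree_sec p (gs_b p) j = (if j = 0 then gs_a p else if j = 1 then inv\<^bsub>Aut_tree p\<^esub> (gs_a p)
    else if j = p - 1 then gs_b p else \<one>\<^bsub>Aut_tree p\<^esub>)" (is "_ = ?r")
proof
  fix w
  have "gs_a p \<in> extensional (tree_words p)" "gs_b p \<in> extensional (tree_words p)"
    "inv\<^bsub>Aut_tree p\<^esub> (gs_a p) \<in> extensional (tree_words p)"
    using tree_autsD(1) gs_a_tree_auts gs_b_tree_auts
      group.inv_closed[OF group_Aut_tree gs_a_in_carrier, of p]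
    unfolding Aut_tree_simps by (blast intro: Bij_imp_extensional)+
  then show "tree_sec p (gs_b p) j w = ?r w"
    using assms by (cases "w \<in> tree_words p") (auto simp: tree_sec_def gs_b_Cons Aut_tree_simps extensional_def)
qed

lemma gupta_sidki_simps:
  "carrier (gupta_sidki p) = generate (Aut_tree p) {gs_a p, gs_b p}"
  "x \<otimes>\<^bsub>gupta_sidki p\<^esub> y = x \<otimes>\<^bsub>Aut_tree p\<^esub> y"
  "\<one>\<^bsub>gupta_sidki p\<^esub> = \<one>\<^bsub>Aut_tree p\<^esub>"
  by (simp_all add: carrier_gupta_sidki) (simp_all add: gupta_sidki_def)

lemma subgroup_gupta_sidki: "subgroup (carrier (gupta_sidki p)) (Aut_tree p)"
  unfolding carrier_gupta_sidki
  by (rule group.generate_is_subgroup[OF group_Aut_tree]) (simp add: gs_a_in_carrier gs_b_in_carrier)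

lemma gupta_sidki_tree_auts: "g \<in> carrier (gupta_sidki p) \<Longrightarrow> g \<in> tree_auts p"
  using subgroup.mem_carrier[OF subgroup_gupta_sidki] by (simp add: Aut_tree_simps)

lemma inv_gupta_sidki:
  "g \<in> carrier (gupta_sidki p) \<Longrightarrow> inv\<^bsub>gupta_sidki p\<^esub> g = inv\<^bsub>Aut_tree p\<^esub> g"
  unfolding gupta_sidki_def by (rule group.inv_subgroup_generated[OF group_Aut_tree])

lemma gs_in_gupta_sidki: "gs_a p \<in> carrier (gupta_sidki p)" "gs_b p \<in> carrier (gupta_sidki p)"
  unfolding carrier_gupta_sidki by (auto intro: generate.incl)

lemma tree_sec_gupta_sidki:
  assumes "g \<in> carrier (gupta_sidki p)" "j < p"
  shows "tree_sec p g j \<in> carrier (gupta_sidki p)"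
proof -
  interpret S: subgroup "carrier (gupta_sidki p)" "Aut_tree p" by (rule subgroup_gupta_sidki)
  have gens: "tree_sec p h i \<in> carrier (gupta_sidki p)" if "h \<in> {gs_a p, gs_b p}" "i < p" for h i
    using that gs_in_gupta_sidki[of p] S.one_closed S.m_inv_closed
    by (auto simp: tree_sec_gs_a tree_sec_gs_b)
  have "g \<in> generate (Aut_tree p) {gs_a p, gs_b p}" using assms(1) by (simp add: carrier_gupta_sidki)
  then show ?thesis using assms(2)
  proof (induction g arbitrary: j rule: generate.induct)
    case one
    then show ?case by (simp add: tree_sec_one)
  next
    case (incl h)
    then show ?case using gens by blast
  next
    case (inv h)
    have h: "h \<in> tree_auts p" using inv(1) gs_a_tree_auts gs_b_tree_auts by blast
    \<comment> \<open>The section of an inverse at \<open>j\<close> is the inverse of the section at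
      the preimage \<open>?i\<close> of \<open>j\<close> under \<open>h\<close>.\<close>
    let ?i = "tree_act (inv\<^bsub>Aut_tree p\<^esub> h) j"
    interpret A: group "Aut_tree p" by (rule group_Aut_tree)
    have hA: "h \<in> carrier (Aut_tree p)" using h by (simp add: Aut_tree_simps)
    have h': "inv\<^bsub>Aut_tree p\<^esub> h \<in> tree_auts p" using A.inv_closed[OF hA] by (simp add: Aut_tree_simps(1))
    have i: "?i < p" using tree_auts_Cons(2)[OF h' inv(2), of "[]"] by simp
    have "tree_act (inv\<^bsub>Aut_tree p\<^esub> (inv\<^bsub>Aut_tree p\<^esub> h)) ?i = j"
      by (rule tree_sec_inv_cancel(2)[OF h' inv(2), of "[]"]) simp
    then have "tree_act h ?i = j" using A.inv_inv[OF hA] by simp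
    then have "tree_sec p (inv\<^bsub>Aut_tree p\<^esub> h) j = inv\<^bsub>Aut_tree p\<^esub> (tree_sec p h ?i)"
      using tree_sec_inv[OF h i] by simp
    then show ?case using gens[OF inv(1) i] S.m_inv_closed by simp
  next
    case (eng h1 h2)
    have h: "h1 \<in> tree_auts p" "h2 \<in> tree_auts p"
      using eng.hyps gupta_sidki_tree_auts by (auto simp: carrier_gupta_sidki)
    have "tree_act h1 j < p" using tree_auts_Cons(2)[OF h(1) eng.prems, of "[]"] by simp
    then show ?case using eng tree_sec_mult[OF h eng.prems] S.m_closed by simp
  qed
qed

lemma gupta_sidki_self_similar:
  assumes "0 < p"
  shows "self_similar_group (gupta_sidki p) p tree_act (tree_sec p)"
proof -
  interpret group "gupta_sidki p" by (rule group_gupta_sidki)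
  show ?thesis
  proof
    show "tree_act g j < p" if "g \<in> carrier (gupta_sidki p)" "j < p" for g j
      using tree_auts_Cons(2)[OF gupta_sidki_tree_auts[OF that(1)] that(2), of "[]"] by simp
  qed (use assms in \<open>simp_all add: tree_sec_gupta_sidki gupta_sidki_simps(2,3) tree_act_one
      tree_act_mult tree_sec_mult gupta_sidki_tree_auts\<close>)
qed

lemma gupta_sidki_gupta_sidki_group:
  assumes p: "Factorial_Ring.prime p" "odd p"
  shows "gupta_sidki_group (gupta_sidki p) p tree_act (tree_sec p) (gs_a p) (gs_b p)"
proof -
  have p0: "0 < p" using prime_gt_0_nat[OF p(1)] .
  interpret self_similar_group "gupta_sidki p" p tree_act "tree_sec p"
    by (rule gupta_sidki_self_similar[OF p0])
  \<comment> \<open>The action rebuilt from the recursion is the original one, so faithfulness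
    reduces to extensionality of functions.\<close>
  have actw: "actw g v = g v" if "g \<in> carrier (gupta_sidki p)" "v \<in> tree_words p" for g v
    using that
  proof (induction v arbitrary: g)
    case Nil
    then show ?case using tree_autsD(2)[OF gupta_sidki_tree_auts[OF Nil.prems(1)]] by simp
  next
    case (Cons j v)
    then show ?case
      using tree_auts_Cons(1)[OF gupta_sidki_tree_auts[OF Cons.prems(1)]] tree_sec_gupta_sidki by simp
  qed
  show ?thesis
  proof
    fix g assume g: "g \<in> carrier (gupta_sidki p)" "\<And>n v. v \<in> words n \<Longrightarrow> actw g v = v"
    have "g v = v" if v: "v \<in> tree_words p" for v
    proof -
      have "v \<in> words (length v)" using v unfolding words_def tree_words_def by blast
      then show ?thesis using g(2) actw[OF g(1) v] by metis
    qed
    moreover have "g \<in> extensional (tree_words p)"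
      using tree_autsD(1)[OF gupta_sidki_tree_auts[OF g(1)]] by (rule Bij_imp_extensional)
    ultimately show "g = \<one>\<^bsub>gupta_sidki p\<^esub>"
      by (auto simp: gupta_sidki_simps(3) Aut_tree_simps fun_eq_iff extensional_def)
  next
    have "generate (Aut_tree p\<lparr>carrier := carrier (gupta_sidki p)\<rparr>) {gs_a p, gs_b p} =
        generate (Aut_tree p) {gs_a p, gs_b p}"
      using gs_in_gupta_sidki
      by (intro group.generate_consistent[OF group_Aut_tree _ subgroup_gupta_sidki]) simp
    moreover have "Aut_tree p\<lparr>carrier := carrier (gupta_sidki p)\<rparr> = gupta_sidki p"
      by (simp add: gupta_sidki_def subgroup_generated_def)
    ultimately show "generate (gupta_sidki p) {gs_a p, gs_b p} = carrier (gupta_sidki p)"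
      by (simp add: carrier_gupta_sidki)
  next
    show "tree_sec p (gs_b p) j = (if j = 0 then gs_a p else if j = 1 then inv\<^bsub>gupta_sidki p\<^esub> (gs_a p)
      else if j = p - 1 then gs_b p else \<one>\<^bsub>gupta_sidki p\<^esub>)" if "j < p" for j
      using that gs_in_gupta_sidki by (simp add: tree_sec_gs_b inv_gupta_sidki gupta_sidki_simps(3))
  qed (use p gs_in_gupta_sidki in \<open>simp_all add: tree_act_gs_a tree_sec_gs_a tree_act_gs_b gupta_sidki_simps(3)\<close>)
qed

theorem theorem5:
  fixes p k :: nat and H :: "('h, 'm) monoid_scheme"
  assumes "Factorial_Ring.prime p" and "odd p" and "k \<ge> 1"
    and "group H"
    and "commensurable H (product_group {..<k} (\<lambda>_. gupta_sidki p))"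
  shows "\<forall>M. maximal_subgroup M H \<longrightarrow> finite_index M H"
proof (intro allI impI)
  fix M assume M: "maximal_subgroup M H"
  interpret GS: gupta_sidki_group "gupta_sidki p" p tree_act "tree_sec p" "gs_a p" "gs_b p"
    by (rule gupta_sidki_gupta_sidki_group[OF assms(1,2)])
  interpret H: group H by fact
  obtain K L f where KL: "subgroup K H" "finite_index K H"
    "subgroup L (product_group {..<k} (\<lambda>_. gupta_sidki p))"
    "finite_index L (product_group {..<k} (\<lambda>_. gupta_sidki p))"
    "f \<in> iso (H\<lparr>carrier := K\<rparr>) ((product_group {..<k} (\<lambda>_. gupta_sidki p))\<lparr>carrier := L\<rparr>)"
    using assms(5) unfolding commensurable_def is_iso_def by blast
  have "no_proper_dense H"
    by (rule GS.no_proper_dense_of_iso_finite_index[OF assms(4) KL])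
  then show "finite_index M H" using M by (rule H.maximal_subgroup_finite_index)
qed

end
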